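(* Let $y:M\to Q^3_1$ be any timelike surface that is both isothermic (i.e. $(+)$-isothermic or $(-)$-isothermic) and Willmore. Then $y$ is conformally equivalent to a timelike minimal surface in some 3-dimensional Lorentzian space form $R^3_1$, $S^3_1$ or $H^3_1$.
   Context: **Ambient space.** $\mathbb{R}^m_s$ is $\mathbb{R}^m$ with $\langle x,x\rangle=\sum_{i=1}^{m-s}x_i^2-\sum_{i=m-s+1}^m x_i^2$. $Q^3_1=\{[x]\in\mathbb{R}P^{4} : x\in\mathbb{R}^{5}_{2}\setminus\{0\},\ \langle x,x\rangle=0\}$ is the projectivized light cone, with its natural conformal structure of Lorentzian signature $(2,1)$. Its conformal group is $O(3,2)/\{\pm1\}$, acting linearly on representatives. **Space forms and conformal equivalence.** $R^3_1=\mathbb{R}^3_1$, $S^3_1=\{x\in\mathbb{R}^4_1:\langle x,x\rangle=1\}$, $H^3_1=\{x\in\mathbb{R}^4_2:\langle x,x\rangle=-1\}$. They are conformally embedded in $Q^3_1$ by $$\varphi_0(x)=\left[\left(\tfrac{-1+\langle x,x\rangle}{2},\,x,\,\tfrac{1+\langle x,x\rangle}{2}\right)\right],\qquad \varphi_+(x)=[(x,1)],\qquad \varphi_-(x)=[(1,x)].$$ A timelike surface in a space form is an immersed surface with Lorentzian induced metric; it is minimal if its mean curvature vanishes identically. A surface $y$ in $Q^3_1$ is conformally equivalent to a surface $x$ in one of these space forms if $T\circ y=\varphi\circ x$ for some conformal transform $T$ of $Q^3_1$, where $\varphi$ is the corresponding embedding $\varphi_0$, $\varphi_+$ or $\varphi_-$.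 **Timelike surfaces in $Q^3_1$ and invariants.** A timelike surface is an immersion $y:M\to Q^3_1$ of a 2-manifold whose induced metric is Lorentzian. A local lift is a map $Y$ from an open subset of $M$ to the nonzero null vectors of $\mathbb{R}^5_2$ with $y=[Y]$. Asymptotic coordinates $(u,v)$ are local coordinates with $\langle Y_u,Y_u\rangle=\langle Y_v,Y_v\rangle=0$ (independent of the lift). Replacing $v$ by $-v$ if necessary, there is a lift with $\langle Y_u,Y_v\rangle=\frac12$, called the canonical lift with respect to $(u,v)$. The bundle $V=\mathrm{Span}\{Y,Y_u,Y_v,Y_{uv}\}$ is a rank 4 subbundle of $M\times\mathbb{R}^5_2$ of signature $(2,2)$, independent of choices; $V^\perp$ is its orthogonal complement, with normal connection $D$ (the orthogonal projection of the derivative onto $V^\perp$). For the canonical lift one has $$Y_{uu}=-\tfrac{s_1}{2}Y+\kappa_1,\qquad Y_{vv}=-\tfrac{s_2}{2}Y+\kappa_2,$$ with functions $s_1,s_2$ and sections $\kappa_1,\kappa_2$ of $V^\perp$ (the conformal Hopf differentials). A point is umbilic if $\kappa_1=\kappa_2=0$ there. **Isothermic.** A timelike surface without umbilic points is $(\pm)$-isothermic if around each point there are asymptotic coordinates $(u,v)$ such that, for the canonical lift, $\kappa_1=\pm\kappa_2$. It is isothermic if it is $(+)$- or $(-)$-isothermic. **Willmore.** The Willmore functional is $W(y)=2\int_M\langle\kappa_1,\kappa_2\rangle\,du\,dv$. A timelike surface $y$ is Willmore if it is a critical point of $W$ with respect to any timelike variation; equivalently, $D_vD_v\kappa_1+\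frac{s_2}{2}\kappa_1=D_uD_u\kappa_2+\frac{s_1}{2}\kappa_2=0$.
   Formalization: M is assumed connected; for disconnected M the claim with a single conformal transform T fails, e.g. for two copies of a suitable surface, one of them moved by a conformal transform that does not preserve its determining vector. *)

theory Defs
  imports "HOL-Analysis.Analysis"
begin

section \<open>Smooth maps between Euclidean spaces\<close>

primrec Ck_on :: "nat \<Rightarrow> 'a set \<Rightarrow> ('a::euclidean_space \<Rightarrow> 'b::real_normed_vector) \<Rightarrow> bool" where
  "Ck_on 0 S f \<longleftrightarrow> continuous_on S f"
| "Ck_on (Suc k) S f \<longleftrightarrow> (\<forall>x\<in>S. f differentiable (at x)) \<and>
     (\<forall>h. Ck_on k S (\<lambda>x. frechet_derivative f (at x) h))"

text \<open>Only used for open \<open>S\<close>.\<close>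

definition smooth_on :: "'a set \<Rightarrow> ('a::euclidean_space \<Rightarrow> 'b::real_normed_vector) \<Rightarrow> bool" where
  "smooth_on S f \<longleftrightarrow> (\<forall>k. Ck_on k S f)"


section \<open>Smooth 2-manifolds\<close>

text \<open>The manifold is the whole type \<open>'m\<close>; a chart is a pair of its domain and its coordinate map,
  the values of which outside the domain are irrelevant. The atlas need not be maximal.\<close>

type_synonym 'm chart = "'m set \<times> ('m \<Rightarrow> real^2)"

definition is_chart :: "'m::topological_space chart \<Rightarrow> bool" where
  "is_chart c \<longleftrightarrow> open (fst c) \<and> open (snd c ` fst c) \<and>
     (\<exists>g. homeomorphism (fst c) (snd c ` fst c) (snd c) g)"

definition in_chart :: "'m chart \<Rightarrow> ('m \<Rightarrow> 'b) \<Rightarrow> real^2 \<Rightarrow> 'b" where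
  "in_chart c f = f \<circ> inv_into (fst c) (snd c)"

definition compatible :: "'m chart \<Rightarrow> 'm chart \<Rightarrow> bool" where
  "compatible c d \<longleftrightarrow> smooth_on (snd c ` (fst c \<inter> fst d)) (in_chart c (snd d)) \<and>
     smooth_on (snd d ` (fst c \<inter> fst d)) (in_chart d (snd c))"

definition smooth_atlas :: "'m::topological_space chart set \<Rightarrow> bool" where
  "smooth_atlas A \<longleftrightarrow> (\<forall>c\<in>A. is_chart c) \<and> (\<forall>c\<in>A. \<forall>d\<in>A. compatible c d) \<and>
     (\<Union>c\<in>A. fst c) = UNIV"

definition local_coords :: "'m::topological_space chart set \<Rightarrow> 'm chart \<Rightarrow> bool" where
  "local_coords A c \<longleftrightarrow> is_chart c \<and> (\<forall>d\<in>A. compatible c d)"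

definition smooth_map_on ::
  "'m::topological_space chart set \<Rightarrow> 'm set \<Rightarrow> ('m \<Rightarrow> 'b::real_normed_vector) \<Rightarrow> bool" where
  "smooth_map_on A W f \<longleftrightarrow> (\<forall>c\<in>A. smooth_on (snd c ` (fst c \<inter> W)) (in_chart c f))"

text \<open>The differential of \<open>f\<close> at \<open>p\<close>, tangent vectors being given by their components in the
  coordinates \<open>c\<close>, and the coordinate derivatives: \<open>pd c 1 Y = Y\<^sub>u\<close> and \<open>pd c 2 Y = Y\<^sub>v\<close>.\<close>

definition differential :: "'m chart \<Rightarrow> ('m \<Rightarrow> 'b::real_normed_vector) \<Rightarrow> 'm \<Rightarrow> real^2 \<Rightarrow> 'b" where
  "differential c f p = frechet_derivative (in_chart c f) (at (snd c p))"

definition pd :: "'m chart \<Rightarrow> 2 \<Rightarrow> ('m \<Rightarrow> 'b::real_normed_vector) \<Rightarrow> 'm \<Rightarrow> 'b" where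
  "pd c i f p = differential c f p (axis i 1)"


section \<open>Pseudo-Euclidean spaces and the conformal space\<close>

text \<open>The scalar product which is negative on the axes in \<open>N\<close>. The numeral types are cyclic, so the
  last axis of \<open>real^5\<close> is \<open>5 = 0\<close>; the five indices \<open>1, \<dots>, 5\<close> are distinct.\<close>

definition sprod :: "'n set \<Rightarrow> real^'n::finite \<Rightarrow> real^'n \<Rightarrow> real" where
  "sprod N x y = (\<Sum>i\<in>UNIV. (if i \<in> N then - 1 else 1) * x $ i * y $ i)"

abbreviation ip52 :: "real^5 \<Rightarrow> real^5 \<Rightarrow> real" where
  "ip52 \<equiv> sprod {4, 5}"

text \<open>A symmetric bilinear form on the plane of signature \<open>(1,1)\<close>.\<close>

definition lorentzian :: "(real^2 \<Rightarrow> real^2 \<Rightarrow> real) \<Rightarrow> bool" where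
  "lorentzian g \<longleftrightarrow> (\<exists>a b. g a a = 1 \<and> g b b = - 1 \<and> g a b = 0)"

text \<open>A point of the projective space is the line \<open>span {x}\<close> in \<open>real^5\<close>.\<close>

definition Q31 :: "(real^5) set set" where
  "Q31 = {span {x} | x. x \<noteq> 0 \<and> ip52 x x = 0}"

text \<open>An element of \<open>O(3,2)\<close>; it acts on points of \<open>Q31\<close>, which are lines, by taking images.\<close>

definition pseudo_orthogonal :: "(real^5 \<Rightarrow> real^5) \<Rightarrow> bool" where
  "pseudo_orthogonal T \<longleftrightarrow> linear T \<and> (\<forall>x y. ip52 (T x) (T y) = ip52 x y)"


section \<open>Timelike surfaces in the conformal space\<close>

definition local_lift ::
  "'m::topological_space chart set \<Rightarrow> ('m \<Rightarrow> (real^5) set) \<Rightarrow> 'm set \<Rightarrow> ('m \<Rightarrow> real^5) \<Rightarrow> bool" where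
  "local_lift A y W Y \<longleftrightarrow> open W \<and> smooth_map_on A W Y \<and>
     (\<forall>p\<in>W. Y p \<noteq> 0 \<and> ip52 (Y p) (Y p) = 0 \<and> y p = span {Y p})"

text \<open>Smoothness of \<open>y\<close> is the existence of smooth local lifts. The tangent space of the projective
  space at the line \<open>\<ell>\<close> is \<open>Hom(\<ell>, real^5 / \<ell>)\<close>, so that \<open>y\<close> is an immersion when
  \<open>dY\<close> is injective modulo \<open>span {Y}\<close>. A lift induces the metric \<open>\<langle>dY, dY\<rangle>\<close>, in
  the conformal class of the induced metric.\<close>

definition timelike_surface :: "'m::topological_space chart set \<Rightarrow> ('m \<Rightarrow> (real^5) set) \<Rightarrow> bool" where
  "timelike_surface A y \<longleftrightarrow>
     (\<forall>p. y p \<in> Q31) \<and>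
     (\<forall>p. \<exists>W Y. p \<in> W \<and> local_lift A y W Y) \<and>
     (\<forall>W Y. local_lift A y W Y \<longrightarrow> (\<forall>c\<in>A. \<forall>p\<in>fst c \<inter> W.
        (\<forall>h. differential c Y p h \<in> span {Y p} \<longrightarrow> h = 0) \<and>
        lorentzian (\<lambda>h k. ip52 (differential c Y p h) (differential c Y p k))))"

definition canonical_at :: "'m chart \<Rightarrow> ('m \<Rightarrow> real^5) \<Rightarrow> 'm \<Rightarrow> bool" where
  "canonical_at c Y p \<longleftrightarrow> ip52 (pd c 1 Y p) (pd c 1 Y p) = 0 \<and>
     ip52 (pd c 2 Y p) (pd c 2 Y p) = 0 \<and> ip52 (pd c 1 Y p) (pd c 2 Y p) = 1 / 2"

text \<open>\<open>c\<close> are asymptotic coordinates and \<open>Y\<close> is the canonical lift with respect to \<open>c\<close>.\<close>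

definition canonical_lift ::
  "'m::topological_space chart set \<Rightarrow> ('m \<Rightarrow> (real^5) set) \<Rightarrow> 'm chart \<Rightarrow> ('m \<Rightarrow> real^5) \<Rightarrow> bool" where
  "canonical_lift A y c Y \<longleftrightarrow> local_coords A c \<and> local_lift A y (fst c) Y \<and>
     (\<forall>p\<in>fst c. canonical_at c Y p)"

definition V_space :: "'m chart \<Rightarrow> ('m \<Rightarrow> real^5) \<Rightarrow> 'm \<Rightarrow> (real^5) set" where
  "V_space c Y p = span {Y p, pd c 1 Y p, pd c 2 Y p, pd c 2 (pd c 1 Y) p}"

definition V_perp :: "'m chart \<Rightarrow> ('m \<Rightarrow> real^5) \<Rightarrow> 'm \<Rightarrow> (real^5) set" where
  "V_perp c Y p = {n. \<forall>w\<in>V_space c Y p. ip52 n w = 0}"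

text \<open>The conformal Hopf differentials \<open>\<kappa>\<^sub>1\<close> (\<open>i = 1\<close>) and \<open>\<kappa>\<^sub>2\<close> (\<open>i = 2\<close>). For
  a canonical lift \<open>Y\<^sub>u\<^sub>u = - (s\<^sub>1 / 2) Y + \<kappa>\<^sub>1\<close> and \<open>Y\<^sub>v\<^sub>v = - (s\<^sub>2 / 2) Y + \<kappa>\<^sub>2\<close>, so these
  are the components of \<open>Y\<^sub>u\<^sub>u\<close> and \<open>Y\<^sub>v\<^sub>v\<close> in the orthogonal complement of \<open>V\<close>.\<close>

definition hopf :: "'m chart \<Rightarrow> ('m \<Rightarrow> real^5) \<Rightarrow> 2 \<Rightarrow> 'm \<Rightarrow> real^5" where
  "hopf c Y i p = (THE k. k \<in> V_perp c Y p \<and> pd c i (pd c i Y) p - k \<in> V_space c Y p)"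

definition umbilic :: "'m::topological_space chart set \<Rightarrow> ('m \<Rightarrow> (real^5) set) \<Rightarrow> 'm \<Rightarrow> bool" where
  "umbilic A y p \<longleftrightarrow> (\<exists>c Y. canonical_lift A y c Y \<and> p \<in> fst c \<and> hopf c Y 1 p = 0 \<and> hopf c Y 2 p = 0)"

definition isothermic_sgn ::
  "real \<Rightarrow> 'm::topological_space chart set \<Rightarrow> ('m \<Rightarrow> (real^5) set) \<Rightarrow> bool" where
  "isothermic_sgn \<sigma> A y \<longleftrightarrow> timelike_surface A y \<and> (\<forall>p. \<not> umbilic A y p) \<and>
     (\<forall>p. \<exists>c Y. p \<in> fst c \<and> canonical_lift A y c Y \<and>
        (\<forall>q\<in>fst c. hopf c Y 1 q = \<sigma> *\<^sub>R hopf c Y 2 q))"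

definition isothermic :: "'m::topological_space chart set \<Rightarrow> ('m \<Rightarrow> (real^5) set) \<Rightarrow> bool" where
  "isothermic A y \<longleftrightarrow> isothermic_sgn 1 A y \<or> isothermic_sgn (- 1) A y"


section \<open>The Willmore functional\<close>

text \<open>The density of \<open>2 \<langle>\<kappa>\<^sub>1, \<kappa>\<^sub>2\<rangle> du dv\<close> at \<open>p\<close> with respect to the coordinates \<open>d\<close>:
  \<open>2 \<langle>\<kappa>\<^sub>1, \<kappa>\<^sub>2\<rangle>\<close> times the Jacobian of \<open>(u,v)\<close> in terms of \<open>d\<close>. The coordinates \<open>c = (u,v)\<close> and
  the lift only have to be asymptotic and canonical at the point \<open>p\<close> itself. At \<open>p\<close> the value
  depends on \<open>c\<close> only through the coordinate vectors, since second derivatives of a change of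
  coordinates or of a rescaling of the lift contribute to \<open>Y\<^sub>u\<^sub>u\<close>, \<open>Y\<^sub>u\<^sub>v\<close>, \<open>Y\<^sub>v\<^sub>v\<close> only terms in
  \<open>span {Y, Y\<^sub>u, Y\<^sub>v}\<close>; rescaling the coordinate vectors cancels against the lift and the
  Jacobian. So this is the value that asymptotic coordinates around \<open>p\<close> give.\<close>

definition willmore_density ::
  "'m::topological_space chart set \<Rightarrow> ('m \<Rightarrow> (real^5) set) \<Rightarrow> 'm chart \<Rightarrow> 'm \<Rightarrow> real" where
  "willmore_density A y d p = (THE r. \<exists>c W Y. local_coords A c \<and> local_lift A y W Y \<and>
     p \<in> fst c \<inter> W \<and> canonical_at c Y p \<and>
     r = 2 * ip52 (hopf c Y 1 p) (hopf c Y 2 p) * \<bar>det (matrix (differential d (snd c) p))\<bar>)"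

text \<open>A finite decomposition of \<open>K\<close> into Borel sets, each inside the domain of a chart.\<close>

definition chart_partition ::
  "'m::topological_space chart set \<Rightarrow> 'm set \<Rightarrow> ('m chart \<times> 'm set) set \<Rightarrow> bool" where
  "chart_partition A K P \<longleftrightarrow> finite P \<and>
     (\<forall>(c, B)\<in>P. c \<in> A \<and> B \<in> sets borel \<and> B \<subseteq> fst c) \<and>
     disjoint_family_on snd P \<and> (\<Union>(c, B)\<in>P. B) = K"

text \<open>The integral over \<open>K\<close>, computed with a decomposition \<open>P\<close> of \<open>K\<close>; its value does not depend
  on \<open>P\<close>.\<close>

definition willmore_energy ::
  "'m::topological_space chart set \<Rightarrow> ('m chart \<times> 'm set) set \<Rightarrow> ('m \<Rightarrow> (real^5) set) \<Rightarrow> real" where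
  "willmore_energy A P y =
     (\<Sum>(c, B)\<in>P. LINT x : snd c ` B | lborel. in_chart c (willmore_density A y c) x)"

text \<open>Smooth families of timelike surfaces which differ from \<open>y\<close> only in the compact set \<open>K\<close>;
  \<open>K = UNIV\<close> is possible if the manifold is compact.\<close>

definition timelike_variation ::
  "'m::topological_space chart set \<Rightarrow> ('m \<Rightarrow> (real^5) set) \<Rightarrow> 'm set \<Rightarrow> real \<Rightarrow>
     (real \<Rightarrow> 'm \<Rightarrow> (real^5) set) \<Rightarrow> bool" where
  "timelike_variation A y K \<epsilon> \<eta> \<longleftrightarrow> compact K \<and> 0 < \<epsilon> \<and> \<eta> 0 = y \<and>
     (\<forall>t\<in>{-\<epsilon><..<\<epsilon>}. timelike_surface A (\<eta> t) \<and> (\<forall>p. p \<notin> K \<longrightarrow> \<eta> t p = y p)) \<and>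
     (\<forall>t\<in>{-\<epsilon><..<\<epsilon>}. \<forall>p. \<exists>I W Y. t \<in> I \<and> open I \<and> p \<in> W \<and> open W \<and>
        (\<forall>s\<in>I. \<forall>q\<in>W. Y s q \<noteq> 0 \<and> \<eta> s q = span {Y s q}) \<and>
        (\<forall>c\<in>A. smooth_on (I \<times> snd c ` (fst c \<inter> W)) (\<lambda>(s, x). in_chart c (Y s) x)))"

text \<open>A critical point: on a non-compact manifold the integral over the complement of \<open>K\<close>,
  which may diverge, is not affected by the variation and is left out.\<close>

definition willmore :: "'m::topological_space chart set \<Rightarrow> ('m \<Rightarrow> (real^5) set) \<Rightarrow> bool" where
  "willmore A y \<longleftrightarrow> timelike_surface A y \<and>
     (\<forall>K \<epsilon> \<eta> P. timelike_variation A y K \<epsilon> \<eta> \<longrightarrow> chart_partition A K P \<longrightarrow>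
        ((\<lambda>t. willmore_energy A P (\<eta> t)) has_real_derivative 0) (at 0))"


section \<open>Timelike minimal surfaces in Lorentzian space forms\<close>

text \<open>\<open>space_form {3} 0\<close> in \<open>real^3\<close> is \<open>R\<^sup>3\<^sub>1\<close>, \<open>space_form {4} 1\<close> in \<open>real^4\<close> is \<open>S\<^sup>3\<^sub>1\<close> and
  \<open>space_form {3, 4} (-1)\<close> in \<open>real^4\<close> is \<open>H\<^sup>3\<^sub>1\<close>. For \<open>e \<noteq> 0\<close> the tangent space at \<open>x\<close> is the
  orthogonal complement of \<open>x\<close>.\<close>

definition space_form :: "'n set \<Rightarrow> real \<Rightarrow> (real^'n::finite) set" where
  "space_form N e = {x. e \<noteq> 0 \<longrightarrow> sprod N x x = e}"

definition space_form_tangent :: "'n set \<Rightarrow> real \<Rightarrow> real^'n::finite \<Rightarrow> (real^'n) set" where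
  "space_form_tangent N e x = {w. e \<noteq> 0 \<longrightarrow> sprod N x w = 0}"

definition timelike_surface_in ::
  "'n set \<Rightarrow> real \<Rightarrow> 'm::topological_space chart set \<Rightarrow> ('m \<Rightarrow> real^'n::finite) \<Rightarrow> bool" where
  "timelike_surface_in N e A x \<longleftrightarrow> (\<forall>p. x p \<in> space_form N e) \<and> smooth_map_on A UNIV x \<and>
     (\<forall>c\<in>A. \<forall>p\<in>fst c. inj (differential c x p) \<and>
        lorentzian (\<lambda>h k. sprod N (differential c x p h) (differential c x p k)))"

definition unit_normal ::
  "'n set \<Rightarrow> real \<Rightarrow> 'm chart \<Rightarrow> ('m \<Rightarrow> real^'n::finite) \<Rightarrow> 'm \<Rightarrow> real^'n \<Rightarrow> bool" where
  "unit_normal N e c x p n \<longleftrightarrow> n \<in> space_form_tangent N e (x p) \<and> sprod N n n = 1 \<and>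
     (\<forall>h. sprod N (differential c x p h) n = 0)"

definition fund1 :: "'n set \<Rightarrow> 'm chart \<Rightarrow> ('m \<Rightarrow> real^'n::finite) \<Rightarrow> 'm \<Rightarrow> real^2^2" where
  "fund1 N c x p = (\<chi> i j. sprod N (pd c i x p) (pd c j x p))"

text \<open>The second fundamental form inside the space form: a unit normal \<open>n\<close> is tangent to the space
  form, so the ambient second derivative may be used.\<close>

definition fund2 :: "'n set \<Rightarrow> 'm chart \<Rightarrow> ('m \<Rightarrow> real^'n::finite) \<Rightarrow> 'm \<Rightarrow> real^'n \<Rightarrow> real^2^2" where
  "fund2 N c x p n = (\<chi> i j. sprod N (pd c i (pd c j x) p) n)"

definition mean_curvature ::
  "'n set \<Rightarrow> 'm chart \<Rightarrow> ('m \<Rightarrow> real^'n::finite) \<Rightarrow> 'm \<Rightarrow> real^'n \<Rightarrow> real" where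
  "mean_curvature N c x p n = trace (matrix_inv (fund1 N c x p) ** fund2 N c x p n) / 2"

definition timelike_minimal_in ::
  "'n set \<Rightarrow> real \<Rightarrow> 'm::topological_space chart set \<Rightarrow> ('m \<Rightarrow> real^'n::finite) \<Rightarrow> bool" where
  "timelike_minimal_in N e A x \<longleftrightarrow> timelike_surface_in N e A x \<and>
     (\<forall>c\<in>A. \<forall>p\<in>fst c. \<forall>n. unit_normal N e c x p n \<longrightarrow> mean_curvature N c x p n = 0)"

abbreviation minimal_in_R31 :: "'m::topological_space chart set \<Rightarrow> ('m \<Rightarrow> real^3) \<Rightarrow> bool" where
  "minimal_in_R31 \<equiv> timelike_minimal_in {3} 0"

abbreviation minimal_in_S31 :: "'m::topological_space chart set \<Rightarrow> ('m \<Rightarrow> real^4) \<Rightarrow> bool" where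
  "minimal_in_S31 \<equiv> timelike_minimal_in {4} 1"

abbreviation minimal_in_H31 :: "'m::topological_space chart set \<Rightarrow> ('m \<Rightarrow> real^4) \<Rightarrow> bool" where
  "minimal_in_H31 \<equiv> timelike_minimal_in {3, 4} (- 1)"


section \<open>Conformal embeddings of the space forms and conformal equivalence\<close>

definition phi0 :: "real^3 \<Rightarrow> (real^5) set" where
  "phi0 x = span {vector [(- 1 + sprod {3} x x) / 2, x $ 1, x $ 2, x $ 3, (1 + sprod {3} x x) / 2]}"

definition phi_plus :: "real^4 \<Rightarrow> (real^5) set" where
  "phi_plus x = span {vector [x $ 1, x $ 2, x $ 3, x $ 4, 1]}"

definition phi_minus :: "real^4 \<Rightarrow> (real^5) set" where
  "phi_minus x = span {vector [1, x $ 1, x $ 2, x $ 3, x $ 4]}"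

definition conformally_equivalent ::
  "('a \<Rightarrow> (real^5) set) \<Rightarrow> ('m \<Rightarrow> (real^5) set) \<Rightarrow> ('m \<Rightarrow> 'a) \<Rightarrow> bool" where
  "conformally_equivalent \<phi> y x \<longleftrightarrow> (\<exists>T. pseudo_orthogonal T \<and> (\<forall>p. T ` y p = \<phi> (x p)))"

end

theory Submission
  imports Defs
begin

text \<open>
  Let \<open>n\<close> be the unit normal of \<open>V = Span {Y, Y\<^sub>u, Y\<^sub>v, Y\<^sub>u\<^sub>v}\<close> and \<open>\<kappa>\<^sub>i = k\<^sub>i n\<close>. For an arbitrary lift in
  arbitrary coordinates the Willmore density is \<open>det b\<^sub>0 / sqrt (- det g)\<close>, where \<open>b\<^sub>0\<close> is the trace-free
  second fundamental form, so that it can be differentiated along the null variation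
  \<open>Y + t \<phi> n + t\<^sup>2 \<phi>\<^sup>2 N / 2\<close>. This gives \<open>(k\<^sub>2)\<^sub>u\<^sub>u + s\<^sub>1 k\<^sub>2 / 2 + (k\<^sub>1)\<^sub>v\<^sub>v + s\<^sub>2 k\<^sub>1 / 2 = 0\<close>, and by the Codazzi
  equation the two halves are equal, hence both zero. If \<open>k\<^sub>1 = \<plusminus> k\<^sub>2\<close>, it follows that \<open>k = k\<^sub>1\<close> solves the
  linear system satisfied by \<open>\<langle>Y, c\<rangle>\<close> for a constant vector \<open>c\<close> orthogonal to \<open>n\<close>, so that locally there is
  such a \<open>c\<close> with \<open>\<langle>Y, c\<rangle> = k\<close>. It is unique up to a factor on every open set, hence \<open>c\<close> exists globally on
  a connected surface, and \<open>\<langle>Y, c\<rangle>\<close> has no zeros because there are no umbilics. An element of \<open>O(3,2)\<close>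
  moves \<open>c\<close> to a multiple of \<open>e\<^sub>5\<close>, \<open>e\<^sub>1\<close> or \<open>e\<^sub>1 + e\<^sub>5\<close> according to the sign of \<open>\<langle>c, c\<rangle>\<close>. The lift normalised by
  constant \<open>\<langle>Y, c\<rangle>\<close> then lies in \<open>S\<^sup>3\<^sub>1\<close>, \<open>H\<^sup>3\<^sub>1\<close> or \<open>R\<^sup>3\<^sub>1\<close>; since \<open>n\<close> is orthogonal to \<open>c\<close>, it is the normal of the
  surface in the space form, and the mean curvature vanishes.
\<close>

section \<open>Calculus of smooth maps\<close>

text \<open>A variation destroys the asymptotic coordinates, and finding new ones for each
  \<open>t\<close> would mean integrating null directions with smooth dependence on
  \<open>t\<close>. A density that is algebraic in the derivatives of an arbitrary lift is visibly
  smooth in \<open>t\<close>, and comparing it with the Hopf differentials takes only a linear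
  change of coordinates at one point. The normal bundle has rank one, so the variation yields a
  single scalar equation where two are needed; this is why Codazzi is essential. Signature matters
  too: \<open>V\<close> has signature (2,2) inside (3,2), so its complement is positive definite and
  a nowhere zero Hopf differential can be normalised to a smooth unit normal. In general neither
  \<open>n\<close> nor \<open>k\<close> is global, as the normal is fixed only up to sign and
  \<open>k\<close> depends on the coordinates. The condition on \<open>c\<close> with a global
  meaning is orthogonality to the whole normal line, which is linear in \<open>c\<close>. The
  vectors that satisfy it near a point form a line, so the set of points near which a given one
  satisfies it is open and closed.\<close>

lemma Ck_on_subset: "Ck_on k S f \<Longrightarrow> T \<subseteq> S \<Longrightarrow> Ck_on k T f"
  by (induction k arbitrary: f) (auto intro: continuous_on_subset)

lemma Ck_on_Suc_imp: "Ck_on (Suc k) S f \<Longrightarrow> Ck_on k S f"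
proof (induction k arbitrary: f)
  case 0
  then show ?case
    by (auto intro!: continuous_at_imp_continuous_on differentiable_imp_continuous_within)
next
  case (Suc k)
  then show ?case
    by (metis Ck_on.simps(2))
qed

text \<open>Derivatives are taken in the full space, so agreement on \<open>S\<close> passes to them
  because \<open>S\<close> is open; the same proviso returns in most rules below.\<close>

lemma Ck_on_cong:
  assumes "open S" "\<And>x. x \<in> S \<Longrightarrow> f x = g x" "Ck_on k S f"
  shows "Ck_on k S g"
  using assms(2,3)
proof (induction k arbitrary: f g)
  case 0
  then show ?case
    by (metis Ck_on.simps(1) continuous_on_cong)
next
  case (Suc k)
  have eq: "frechet_derivative f (at x) = frechet_derivative g (at x)" if "x \<in> S" for x
    using frechet_derivative_transform_within_open[of f x S g] Suc.prems assms(1) that by auto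
  have "g differentiable (at x)" if "x \<in> S" for x
  proof -
    have "f differentiable (at x)" using Suc.prems that by auto
    then show ?thesis
      unfolding differentiable_def
      by (metis has_derivative_transform_within_open[OF _ assms(1) that] Suc.prems(1))
  qed
  moreover have "Ck_on k S (\<lambda>x. frechet_derivative g (at x) h)" for h
    by (rule Suc.IH[of "\<lambda>x. frechet_derivative f (at x) h"]) (use Suc.prems eq in auto)
  ultimately show ?case by simp
qed

lemma Ck_on_local:
  assumes "\<And>x. x \<in> S \<Longrightarrow> \<exists>U. open U \<and> x \<in> U \<and> Ck_on k U f"
  shows "Ck_on k S f"
  using assms
proof (induction k arbitrary: f)
  case 0
  then show ?case
    by (metis Ck_on.simps(1) continuous_at_imp_continuous_on continuous_on_eq_continuous_at)
next
  case (Suc k)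
  have "f differentiable (at x)" if "x \<in> S" for x
    using Suc.prems[OF that] by auto
  moreover have "Ck_on k S (\<lambda>x. frechet_derivative f (at x) h)" for h
    by (rule Suc.IH) (metis Suc.prems Ck_on.simps(2))
  ultimately show ?case by simp
qed

text \<open>Working rule for the inductions on the order: an explicit formula for the derivative
  replaces the \<open>frechet_derivative\<close> of the definition.\<close>

lemma Ck_on_Suc_I:
  assumes "open S" "\<And>x. x \<in> S \<Longrightarrow> (f has_derivative f' x) (at x)"
    and "\<And>h. Ck_on k S (\<lambda>x. f' x h)"
  shows "Ck_on (Suc k) S f"
proof -
  have eq: "frechet_derivative f (at x) = f' x" if "x \<in> S" for x
    using frechet_derivative_at[OF assms(2)[OF that]] by simp
  have "Ck_on k S (\<lambda>x. frechet_derivative f (at x) h)" for h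
    by (rule Ck_on_cong[OF assms(1) _ assms(3)[of h]]) (simp add: eq)
  then show ?thesis
    using assms(2) by (auto simp: differentiable_def)
qed

lemma Ck_on_Suc_D:
  assumes "Ck_on (Suc k) S f" "x \<in> S"
  shows "(f has_derivative frechet_derivative f (at x)) (at x)"
  using assms by (simp add: frechet_derivative_works[symmetric])

lemma Ck_on_const: "Ck_on k S (\<lambda>x. c)"
  by (induction k arbitrary: c) auto

lemma Ck_on_linear: "open S \<Longrightarrow> bounded_linear f \<Longrightarrow> Ck_on k S f"
proof (cases k)
  case 0
  then show "bounded_linear f \<Longrightarrow> Ck_on k S f"
    by (simp add: linear_continuous_on)
next
  case (Suc j)
  then show "open S \<Longrightarrow> bounded_linear f \<Longrightarrow> Ck_on k S f"
    by (auto intro!: Ck_on_Suc_I[where f'="\<lambda>_. f"] Ck_on_const bounded_linear_imp_has_derivative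
        simp del: Ck_on.simps)
qed

lemma Ck_on_add:
  assumes "open S" "Ck_on k S f" "Ck_on k S g"
  shows "Ck_on k S (\<lambda>x. f x + g x)"
  using assms(2,3)
proof (induction k arbitrary: f g)
  case 0
  then show ?case by (simp add: continuous_on_add)
next
  case (Suc k)
  show ?case
  proof (rule Ck_on_Suc_I[OF assms(1)])
    show "((\<lambda>x. f x + g x) has_derivative
        (\<lambda>h. frechet_derivative f (at x) h + frechet_derivative g (at x) h)) (at x)" if "x \<in> S" for x
      by (intro has_derivative_add Ck_on_Suc_D[OF Suc.prems(1) that] Ck_on_Suc_D[OF Suc.prems(2) that])
    show "Ck_on k S (\<lambda>x. frechet_derivative f (at x) h + frechet_derivative g (at x) h)" for h
      using Suc.prems by (intro Suc.IH) simp_all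
  qed
qed

lemma Ck_on_bounded_linear_comp:
  assumes "open S" "bounded_linear L" "Ck_on k S f"
  shows "Ck_on k S (\<lambda>x. L (f x))"
  using assms(3)
proof (induction k arbitrary: f)
  case 0
  then show ?case
    using bounded_linear.continuous_on[OF assms(2)] by simp
next
  case (Suc k)
  show ?case
  proof (rule Ck_on_Suc_I[OF assms(1)])
    show "((\<lambda>x. L (f x)) has_derivative (\<lambda>h. L (frechet_derivative f (at x) h))) (at x)" if "x \<in> S" for x
      by (intro bounded_linear.has_derivative[OF assms(2)] Ck_on_Suc_D[OF Suc.prems that])
    show "Ck_on k S (\<lambda>x. L (frechet_derivative f (at x) h))" for h
      using Suc.prems by (intro Suc.IH) simp
  qed
qed

lemma Ck_on_bilinear:
  assumes "open S" "bounded_bilinear B" "Ck_on k S f" "Ck_on k S g"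
  shows "Ck_on k S (\<lambda>x. B (f x) (g x))"
  using assms(3,4)
proof (induction k arbitrary: f g)
  case 0
  then show ?case
    using bounded_bilinear.continuous_on[OF assms(2)] by simp
next
  case (Suc k)
  show ?case
  proof (rule Ck_on_Suc_I[OF assms(1)])
    show "((\<lambda>x. B (f x) (g x)) has_derivative
        (\<lambda>h. B (f x) (frechet_derivative g (at x) h) + B (frechet_derivative f (at x) h) (g x))) (at x)"
      if "x \<in> S" for x
      by (intro bounded_bilinear.FDERIV[OF assms(2)] Ck_on_Suc_D[OF Suc.prems(1) that]
          Ck_on_Suc_D[OF Suc.prems(2) that])
    show "Ck_on k S (\<lambda>x. B (f x) (frechet_derivative g (at x) h) + B (frechet_derivative f (at x) h) (g x))" for h
    proof (rule Ck_on_add[OF assms(1)])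
      show "Ck_on k S (\<lambda>x. B (f x) (frechet_derivative g (at x) h))"
        using Suc.prems by (intro Suc.IH Ck_on_Suc_imp[OF Suc.prems(1)]) simp
      show "Ck_on k S (\<lambda>x. B (frechet_derivative f (at x) h) (g x))"
        using Suc.prems by (intro Suc.IH Ck_on_Suc_imp[OF Suc.prems(2)]) simp
    qed
  qed
qed

lemma Ck_on_sum:
  assumes "open S" "\<And>i. i \<in> I \<Longrightarrow> Ck_on k S (f i)"
  shows "Ck_on k S (\<lambda>x. \<Sum>i\<in>I. f i x)"
  using assms(2)
proof (induction I rule: infinite_finite_induct)
  case (insert i I)
  then show ?case by (auto intro!: Ck_on_add assms(1))
qed (auto intro: Ck_on_const)

lemma Ck_on_compose:
  fixes f :: "'a::euclidean_space \<Rightarrow> 'b::euclidean_space"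
  assumes "open S" "open T" "Ck_on k S f" "Ck_on k T g" "f ` S \<subseteq> T"
  shows "Ck_on k S (\<lambda>x. g (f x))"
  using assms(3,4)
proof (induction k arbitrary: g)
  case 0
  then show ?case
    by (metis Ck_on.simps(1) assms(5) continuous_on_compose2)
next
  case (Suc k)
  \<comment> \<open>\<open>Ck_on\<close> controls derivatives in fixed directions only, while the
    chain rule applies the derivative of \<open>g\<close> in a direction that moves with
    \<open>x\<close>. Expanding that direction in the basis leaves scalar factors times derivatives
    of \<open>g\<close> in fixed directions.\<close>
  define f' where "f' x h = (\<Sum>b\<in>Basis. (frechet_derivative f (at x) h \<bullet> b) *\<^sub>R frechet_derivative g (at (f x)) b)" for x h
  have "((\<lambda>x. g (f x)) has_derivative f' x) (at x)" if x: "x \<in> S" for x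
  proof -
    have fd: "(f has_derivative frechet_derivative f (at x)) (at x)"
      using Suc.prems x Ck_on_Suc_D by blast
    have "f x \<in> T" using x assms(5) by auto
    then have gd: "(g has_derivative frechet_derivative g (at (f x))) (at (f x))"
      using Suc.prems Ck_on_Suc_D by blast
    then have lin: "linear (frechet_derivative g (at (f x)))"
      by (rule has_derivative_linear)
    have "frechet_derivative g (at (f x)) w = (\<Sum>b\<in>Basis. (w \<bullet> b) *\<^sub>R frechet_derivative g (at (f x)) b)" for w
    proof -
      have "frechet_derivative g (at (f x)) w = frechet_derivative g (at (f x)) (\<Sum>b\<in>Basis. (w \<bullet> b) *\<^sub>R b)"
        by (simp add: euclidean_representation)
      also have "\<dots> = (\<Sum>b\<in>Basis. (w \<bullet> b) *\<^sub>R frechet_derivative g (at (f x)) b)"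
        using lin by (simp add: linear_sum linear_scale)
      finally show ?thesis .
    qed
    from this[symmetric]
    have "f' x = (\<lambda>h. frechet_derivative g (at (f x)) (frechet_derivative f (at x) h))"
      unfolding f'_def by (intro ext) simp
    then show ?thesis
      using has_derivative_compose[OF fd gd] by simp
  qed
  moreover have "Ck_on k S (\<lambda>x. f' x h)" for h
    unfolding f'_def
  proof (intro Ck_on_sum assms(1) Ck_on_bilinear[OF assms(1) bounded_bilinear_scaleR])
    fix b :: 'b assume "b \<in> Basis"
    show "Ck_on k S (\<lambda>x. frechet_derivative f (at x) h \<bullet> b)"
      using Suc.prems by (intro Ck_on_bounded_linear_comp[OF assms(1) bounded_linear_inner_left]) auto
    have "Ck_on k S f" using Suc.prems Ck_on_Suc_imp by blast
    then show "Ck_on k S (\<lambda>x. frechet_derivative g (at (f x)) b)"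
      using Suc.prems(2) by (intro Suc.IH) auto
  qed
  ultimately show ?case by (rule Ck_on_Suc_I[OF assms(1)])
qed

lemma Ck_on_inverse: "Ck_on k (- {0}) (inverse :: real \<Rightarrow> real)"
proof (induction k)
  case 0
  show ?case by (auto intro!: continuous_intros)
next
  case (Suc k)
  show ?case
    by (rule Ck_on_Suc_I[where f'="\<lambda>x h. - (inverse x * h * inverse x)"])
      (auto intro!: has_derivative_inverse' Ck_on_bounded_linear_comp[OF _ bounded_linear_minus[OF bounded_linear_ident]]
        Ck_on_bilinear[OF _ bounded_bilinear_mult] Ck_on_const Suc)
qed

lemma Ck_on_sqrt: "Ck_on k {0<..} sqrt"
proof (induction k)
  case 0
  show ?case using continuous_on_real_sqrt[OF continuous_on_id] by (simp add: id_def)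
next
  case (Suc k)
  show ?case
  proof (rule Ck_on_Suc_I)
    show "(sqrt has_derivative (\<lambda>h. inverse (2 * sqrt x) * h)) (at x)" if "x \<in> {0<..}" for x
    proof -
      have "inverse (sqrt x) / 2 = inverse (2 * sqrt x)" by simp
      moreover have "(sqrt has_derivative (\<lambda>h. inverse (sqrt x) / 2 * h)) (at x)"
        by (rule DERIV_real_sqrt[unfolded has_field_derivative_def]) (use that in simp)
      ultimately show ?thesis by metis
    qed
    have "Ck_on k {0<..} (\<lambda>x. 2 * sqrt x)"
      by (rule Ck_on_bounded_linear_comp[OF _ bounded_linear_mult_right Suc]) simp
    then have "Ck_on k {0<..} (\<lambda>x. inverse (2 * sqrt x))"
      by (rule Ck_on_compose[OF _ _ _ Ck_on_inverse, rotated 2]) auto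
    then show "Ck_on k {0<..} (\<lambda>x. inverse (2 * sqrt x) * h)" for h
      by (rule Ck_on_bilinear[OF _ bounded_bilinear_mult _ Ck_on_const, rotated]) simp
  qed simp
qed

subsection \<open>Closure properties\<close>

named_theorems smooth_intros

lemma smooth_on_subset: "smooth_on S f \<Longrightarrow> T \<subseteq> S \<Longrightarrow> smooth_on T f"
  unfolding smooth_on_def using Ck_on_subset by blast

lemma smooth_on_cong:
  "open S \<Longrightarrow> (\<And>x. x \<in> S \<Longrightarrow> f x = g x) \<Longrightarrow> smooth_on S f \<Longrightarrow> smooth_on S g"
  unfolding smooth_on_def using Ck_on_cong by blast

lemma smooth_on_local:
  "(\<And>x. x \<in> S \<Longrightarrow> \<exists>U. open U \<and> x \<in> U \<and> smooth_on U f) \<Longrightarrow> smooth_on S f"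
  unfolding smooth_on_def by (metis Ck_on_local)

lemma smooth_on_imp_differentiable: "smooth_on S f \<Longrightarrow> x \<in> S \<Longrightarrow> f differentiable (at x)"
  unfolding smooth_on_def using Ck_on.simps(2) by blast

lemma smooth_on_has_derivative:
  "smooth_on S f \<Longrightarrow> x \<in> S \<Longrightarrow> (f has_derivative frechet_derivative f (at x)) (at x)"
  using frechet_derivative_works smooth_on_imp_differentiable by blast

lemma smooth_on_imp_continuous_on: "smooth_on S f \<Longrightarrow> continuous_on S f"
  unfolding smooth_on_def using Ck_on.simps(1) by blast

lemma smooth_on_frechet_derivative:
  "smooth_on S f \<Longrightarrow> smooth_on S (\<lambda>x. frechet_derivative f (at x) h)"
  unfolding smooth_on_def using Ck_on.simps(2) by blast

lemma smooth_on_const [smooth_intros]: "smooth_on S (\<lambda>x. c)"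
  by (simp add: smooth_on_def Ck_on_const)

lemma smooth_on_linear: "open S \<Longrightarrow> bounded_linear f \<Longrightarrow> smooth_on S f"
  by (simp add: smooth_on_def Ck_on_linear)

lemma smooth_on_id [smooth_intros]: "open S \<Longrightarrow> smooth_on S (\<lambda>x. x)"
  by (simp add: smooth_on_linear bounded_linear_ident)

lemma smooth_on_bounded_linear:
  "bounded_linear L \<Longrightarrow> open S \<Longrightarrow> smooth_on S f \<Longrightarrow> smooth_on S (\<lambda>x. L (f x))"
  by (simp add: smooth_on_def Ck_on_bounded_linear_comp)

lemma smooth_on_bilinear:
  "bounded_bilinear B \<Longrightarrow> open S \<Longrightarrow> smooth_on S f \<Longrightarrow> smooth_on S g \<Longrightarrow> smooth_on S (\<lambda>x. B (f x) (g x))"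
  by (simp add: smooth_on_def Ck_on_bilinear)

lemma smooth_on_add [smooth_intros]:
  "open S \<Longrightarrow> smooth_on S f \<Longrightarrow> smooth_on S g \<Longrightarrow> smooth_on S (\<lambda>x. f x + g x)"
  by (simp add: smooth_on_def Ck_on_add)

lemmas smooth_on_minus [smooth_intros] = smooth_on_bounded_linear[OF bounded_linear_minus[OF bounded_linear_ident]]
lemmas smooth_on_scaleR [smooth_intros] = smooth_on_bilinear[OF bounded_bilinear_scaleR]

lemma smooth_on_mult [smooth_intros]:
  fixes f g :: "'a::euclidean_space \<Rightarrow> real"
  shows "open S \<Longrightarrow> smooth_on S f \<Longrightarrow> smooth_on S g \<Longrightarrow> smooth_on S (\<lambda>x. f x * g x)"
  by (rule smooth_on_bilinear[OF bounded_bilinear_mult])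

lemma smooth_on_power [smooth_intros]:
  fixes f :: "'a::euclidean_space \<Rightarrow> real"
  shows "open S \<Longrightarrow> smooth_on S f \<Longrightarrow> smooth_on S (\<lambda>x. f x ^ n)"
  by (induction n) (auto intro: smooth_intros)

lemma smooth_on_diff [smooth_intros]:
  "open S \<Longrightarrow> smooth_on S f \<Longrightarrow> smooth_on S g \<Longrightarrow> smooth_on S (\<lambda>x. f x - g x)"
  using smooth_on_add[of S f "\<lambda>x. - g x"] smooth_on_minus[of S g] by simp

lemma smooth_on_compose:
  fixes f :: "'a::euclidean_space \<Rightarrow> 'b::euclidean_space"
  shows "smooth_on T g \<Longrightarrow> open S \<Longrightarrow> open T \<Longrightarrow> smooth_on S f \<Longrightarrow> f ` S \<subseteq> T \<Longrightarrow> smooth_on S (\<lambda>x. g (f x))"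
  by (simp add: smooth_on_def Ck_on_compose)

lemma smooth_on_inverse [smooth_intros]:
  fixes f :: "'a::euclidean_space \<Rightarrow> real"
  shows "open S \<Longrightarrow> smooth_on S f \<Longrightarrow> (\<And>x. x \<in> S \<Longrightarrow> f x \<noteq> 0) \<Longrightarrow> smooth_on S (\<lambda>x. inverse (f x))"
  by (rule smooth_on_compose[where T="-{0}"]) (auto simp: smooth_on_def Ck_on_inverse)

lemma smooth_on_divide [smooth_intros]:
  fixes f :: "'a::euclidean_space \<Rightarrow> real"
  shows "open S \<Longrightarrow> smooth_on S f \<Longrightarrow> smooth_on S g \<Longrightarrow> (\<And>x. x \<in> S \<Longrightarrow> g x \<noteq> 0) \<Longrightarrow> smooth_on S (\<lambda>x. f x / g x)"
  unfolding divide_inverse by (intro smooth_on_mult smooth_on_inverse)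

lemma smooth_on_sqrt [smooth_intros]:
  "open S \<Longrightarrow> smooth_on S f \<Longrightarrow> (\<And>x. x \<in> S \<Longrightarrow> f x > 0) \<Longrightarrow> smooth_on S (\<lambda>x. sqrt (f x))"
  by (rule smooth_on_compose[where T="{0<..}"]) (auto simp: smooth_on_def Ck_on_sqrt)

lemma smooth_on_Pair:
  assumes "open S" "smooth_on S f" "smooth_on S g"
  shows "smooth_on S (\<lambda>x. (f x, g x))"
proof -
  have "smooth_on S (\<lambda>x. (f x, 0) + (0, g x))"
    by (intro smooth_on_add assms smooth_on_bounded_linear[where L="\<lambda>z. (z, 0)"]
        smooth_on_bounded_linear[where L="\<lambda>z. (0, z)"] bounded_linear_Pair bounded_linear_ident bounded_linear_zero)
  then show ?thesis by simp
qed

subsection \<open>A bump function\<close>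

text \<open>\<open>flat 0\<close> is the classical function exp(-1/x) that is flat at zero. The
  extra powers make the family closed under differentiation up to linear combinations, so that
  smoothness of all members follows by one induction.\<close>

definition flat :: "nat \<Rightarrow> real \<Rightarrow> real" where
  "flat j x = (if x > 0 then inverse x ^ j * exp (- inverse x) else 0)"

lemma flat_has_real_derivative:
  "(flat j has_real_derivative flat (j + 2) x - real j * flat (j + 1) x) (at x)"
proof -
  consider "x > 0" | "x < 0" | "x = 0" by linarith
  then show ?thesis
  proof cases
    case 1
    have "((\<lambda>x. inverse x ^ j * exp (- inverse x)) has_real_derivative
        real j * (- (inverse x)\<^sup>2) * inverse x ^ (j - 1) * exp (- inverse x) +
        inverse x ^ j * (exp (- inverse x) * (inverse x)\<^sup>2)) (at x)"
      using 1 by (auto intro!: derivative_eq_intros simp: power2_eq_square)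
    also have "real j * (- (inverse x)\<^sup>2) * inverse x ^ (j - 1) * exp (- inverse x) +
        inverse x ^ j * (exp (- inverse x) * (inverse x)\<^sup>2) = flat (j + 2) x - real j * flat (j + 1) x"
      using 1 by (cases j) (auto simp: flat_def power2_eq_square algebra_simps)
    finally have "((\<lambda>x. inverse x ^ j * exp (- inverse x)) has_real_derivative
        flat (j + 2) x - real j * flat (j + 1) x) (at x)" .
    then show ?thesis
      by (rule has_field_derivative_transform_within_open[where S="{0<..}"]) (use 1 in \<open>auto simp: flat_def\<close>)
  next
    case 2
    have "((\<lambda>x. 0) has_real_derivative flat (j + 2) x - real j * flat (j + 1) x) (at x)"
      using 2 by (auto simp: flat_def)
    then show ?thesis
      by (rule has_field_derivative_transform_within_open[where S="{..<0}"]) (use 2 in \<open>auto simp: flat_def\<close>)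
  next
    case 3
    have lim: "(flat (j + 1) \<longlongrightarrow> 0) (at 0)"
    proof -
      have "((\<lambda>z. z ^ (j + 1) / exp z) \<longlongrightarrow> (0::real)) at_top"
        by (rule tendsto_power_div_exp_0)
      then have "((\<lambda>x. inverse x ^ (j + 1) / exp (inverse x)) \<longlongrightarrow> (0::real)) (at_right 0)"
        using filterlim_compose[OF _ filterlim_inverse_at_top_right] by blast
      then have r: "(flat (j + 1) \<longlongrightarrow> 0) (at_right 0)"
        by (rule Lim_transform_eventually)
          (auto simp: flat_def exp_minus field_simps eventually_at_right_field intro!: exI[of _ 1])
      have l: "(flat (j + 1) \<longlongrightarrow> 0) (at_left 0)"
        by (rule Lim_transform_eventually[of "\<lambda>x. 0"])
          (auto simp: flat_def eventually_at_left_field intro!: exI[of _ "-1"])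
      show ?thesis using l r filterlim_split_at by blast
    qed
    \<comment> \<open>At zero the difference quotient of \<open>flat j\<close> is
      \<open>flat (j + 1)\<close> itself, whose limit has just been computed.\<close>
    have "((\<lambda>h. (flat j (0 + h) - flat j 0) / h) \<longlongrightarrow> 0) (at 0)"
      by (rule Lim_transform_eventually[OF lim]) (auto simp: flat_def eventually_at_filter field_simps)
    then show ?thesis
      using 3 by (simp add: DERIV_def flat_def)
  qed
qed

lemma smooth_on_flat: "smooth_on UNIV (flat j)"
proof -
  have "Ck_on k UNIV (flat j)" for k
  proof (induction k arbitrary: j)
    case 0
    show ?case
      by (metis Ck_on.simps(1) DERIV_isCont continuous_at_imp_continuous_on flat_has_real_derivative)
  next
    case (Suc k)
    have "Ck_on k UNIV (\<lambda>x. (flat (j + 2) x + (- real j) * flat (j + 1) x) * h)" for h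
      by (intro Ck_on_bilinear[OF _ bounded_bilinear_mult] Ck_on_const Ck_on_add Suc) auto
    then show ?case
      by (intro Ck_on_Suc_I[where f'="\<lambda>x h. (flat (j + 2) x + (- real j) * flat (j + 1) x) * h"])
        (auto intro!: flat_has_real_derivative[unfolded has_field_derivative_def, THEN has_derivative_eq_rhs])
  qed
  then show ?thesis by (simp add: smooth_on_def)
qed

lemma smooth_bump:
  fixes x0 :: "'a::euclidean_space"
  assumes "r > 0"
  obtains \<phi> :: "'a \<Rightarrow> real" where "smooth_on UNIV \<phi>" "\<And>x. \<phi> x \<ge> 0" "\<phi> x0 > 0"
    "\<And>x. x \<notin> ball x0 r \<Longrightarrow> \<phi> x = 0"
proof
  let ?\<phi> = "\<lambda>x. flat 0 (r^2 - (x - x0) \<bullet> (x - x0))"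
  show "smooth_on UNIV ?\<phi>"
    by (rule smooth_on_compose[OF smooth_on_flat[of 0]])
      (auto intro!: smooth_intros smooth_on_bilinear[OF bounded_bilinear_inner])
  show "?\<phi> x \<ge> 0" for x by (simp add: flat_def)
  show "?\<phi> x0 > 0" using assms by (simp add: flat_def)
  show "?\<phi> x = 0" if "x \<notin> ball x0 r" for x
  proof -
    have "r^2 \<le> norm (x - x0)^2"
      using that assms by (intro power_mono) (auto simp: dist_norm norm_minus_commute)
    then show ?thesis by (simp add: flat_def power2_norm_eq_inner)
  qed
qed

section \<open>Partial derivatives in the plane\<close>

definition pdiff :: "2 \<Rightarrow> (real^2 \<Rightarrow> 'b::real_normed_vector) \<Rightarrow> real^2 \<Rightarrow> 'b" where
  "pdiff i f x = frechet_derivative f (at x) (axis i 1)"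

lemma smooth_on_pdiff [smooth_intros]: "smooth_on S f \<Longrightarrow> smooth_on S (pdiff i f)"
  using smooth_on_frechet_derivative[of S f "axis i 1"] by (simp add: pdiff_def[abs_def])

lemma pdiff_eqI: "(f has_derivative f') (at x) \<Longrightarrow> pdiff i f x = f' (axis i 1)"
  unfolding pdiff_def using frechet_derivative_at by metis

lemma pdiff_cong:
  assumes "open S" "\<And>x. x \<in> S \<Longrightarrow> f x = g x" "smooth_on S f" "x \<in> S"
  shows "pdiff i f x = pdiff i g x"
  unfolding pdiff_def
  using frechet_derivative_transform_within_open[of f x S g] smooth_on_imp_differentiable[OF assms(3,4)] assms
  by auto

lemma pdiff_const [simp]: "pdiff i (\<lambda>x. c) = (\<lambda>x. 0)"
  by (simp add: pdiff_def[abs_def])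

lemma pdiff_const_on:
  assumes "open S" "\<And>x. x \<in> S \<Longrightarrow> f x = c" "x \<in> S"
  shows "pdiff i f x = 0"
  using pdiff_cong[of S "\<lambda>x. c" f x i] assms smooth_on_const by auto

context
  fixes S :: "(real^2) set" and x :: "real^2"
  assumes x: "x \<in> S"
begin

lemma pdiff_add: "smooth_on S f \<Longrightarrow> smooth_on S g \<Longrightarrow> pdiff i (\<lambda>x. f x + g x) x = pdiff i f x + pdiff i g x"
  using pdiff_eqI[OF has_derivative_add[OF smooth_on_has_derivative smooth_on_has_derivative]] x
  by (simp add: pdiff_def)

lemma pdiff_diff: "smooth_on S f \<Longrightarrow> smooth_on S g \<Longrightarrow> pdiff i (\<lambda>x. f x - g x) x = pdiff i f x - pdiff i g x"
  using pdiff_eqI[OF has_derivative_diff[OF smooth_on_has_derivative smooth_on_has_derivative]] x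
  by (simp add: pdiff_def)

lemma pdiff_bounded_linear: "bounded_linear L \<Longrightarrow> smooth_on S f \<Longrightarrow> pdiff i (\<lambda>x. L (f x)) x = L (pdiff i f x)"
  using pdiff_eqI[OF bounded_linear.has_derivative[OF _ smooth_on_has_derivative]] x
  by (simp add: pdiff_def)

lemma pdiff_bilinear:
  "bounded_bilinear B \<Longrightarrow> smooth_on S f \<Longrightarrow> smooth_on S g \<Longrightarrow>
    pdiff i (\<lambda>x. B (f x) (g x)) x = B (f x) (pdiff i g x) + B (pdiff i f x) (g x)"
  using pdiff_eqI[OF bounded_bilinear.FDERIV[OF _ smooth_on_has_derivative smooth_on_has_derivative]] x
  by (simp add: pdiff_def)

lemmas pdiff_scaleR = pdiff_bilinear[OF bounded_bilinear_scaleR]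

lemma pdiff_mult:
  fixes f g :: "real^2 \<Rightarrow> real"
  shows "smooth_on S f \<Longrightarrow> smooth_on S g \<Longrightarrow> pdiff i (\<lambda>x. f x * g x) x = f x * pdiff i g x + pdiff i f x * g x"
  by (rule pdiff_bilinear[OF bounded_bilinear_mult])

end

lemma frechet_derivative_2:
  fixes f :: "real^2 \<Rightarrow> 'b::real_normed_vector"
  assumes "smooth_on S f" "x \<in> S"
  shows "frechet_derivative f (at x) h = (\<Sum>i\<in>UNIV. h $ i *\<^sub>R pdiff i f x)"
proof -
  have lin: "linear (frechet_derivative f (at x))"
    using smooth_on_has_derivative[OF assms] has_derivative_linear by blast
  have "h = (\<Sum>i\<in>UNIV. h $ i *\<^sub>R axis i 1)"
    using basis_expansion[of h] by (simp add: scalar_mult_eq_scaleR)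
  then have "frechet_derivative f (at x) h = frechet_derivative f (at x) (\<Sum>i\<in>UNIV. h $ i *\<^sub>R axis i 1)"
    by simp
  then show ?thesis
    using lin by (simp add: linear_sum linear_scale pdiff_def)
qed

lemma pdiff_compose:
  fixes g :: "real^2 \<Rightarrow> 'b::real_normed_vector"
  assumes "smooth_on T g" "smooth_on S f" "x \<in> S" "f x \<in> T"
  shows "pdiff a (\<lambda>x. g (f x)) x = (\<Sum>i\<in>UNIV. pdiff a f x $ i *\<^sub>R pdiff i g (f x))"
proof -
  have "((\<lambda>x. g (f x)) has_derivative (\<lambda>h. frechet_derivative g (at (f x)) (frechet_derivative f (at x) h))) (at x)"
    by (rule has_derivative_compose[OF smooth_on_has_derivative[OF assms(2,3)] smooth_on_has_derivative[OF assms(1,4)]])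
  from pdiff_eqI[OF this, of a]
  have "pdiff a (\<lambda>x. g (f x)) x = frechet_derivative g (at (f x)) (pdiff a f x)"
    by (simp only: pdiff_def)
  also have "\<dots> = (\<Sum>i\<in>UNIV. pdiff a f x $ i *\<^sub>R pdiff i g (f x))"
    by (rule frechet_derivative_2[OF assms(1,4)])
  finally show ?thesis .
qed

text \<open>The last sum, with the second derivatives of \<open>f\<close>, contains only first
  derivatives of \<open>g\<close>; it drops out later when paired with a vector orthogonal to the
  tangent plane.\<close>

lemma pdiff_compose_2:
  fixes g :: "real^2 \<Rightarrow> 'b::real_normed_vector"
  assumes "smooth_on T g" "smooth_on S f" "x \<in> S" "open S" "open T" "f ` S \<subseteq> T"
  shows "pdiff a (pdiff b (\<lambda>x. g (f x))) x =
    (\<Sum>i\<in>UNIV. \<Sum>j\<in>UNIV. (pdiff a f x $ i * pdiff b f x $ j) *\<^sub>R pdiff i (pdiff j g) (f x)) +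
    (\<Sum>j\<in>UNIV. pdiff a (pdiff b f) x $ j *\<^sub>R pdiff j g (f x))"
proof -
  have comp: "smooth_on S (\<lambda>x. h (f x))" if "smooth_on T h" for h :: "real^2 \<Rightarrow> 'b"
    using smooth_on_compose[OF that] assms by blast
  have nth: "smooth_on S (\<lambda>x. pdiff b f x $ j)" for j
    by (intro smooth_on_bounded_linear[OF bounded_linear_vec_nth] assms smooth_intros)
  have pg: "smooth_on T (pdiff j g)" for j
    by (intro assms smooth_intros)
  have fx: "f x \<in> T" using assms by auto
  have "pdiff a (pdiff b (\<lambda>x. g (f x))) x = pdiff a (\<lambda>x. \<Sum>j\<in>UNIV. pdiff b f x $ j *\<^sub>R pdiff j g (f x)) x"
  proof (rule pdiff_cong[OF assms(4)])
    show "pdiff b (\<lambda>x. g (f x)) x = (\<Sum>j\<in>UNIV. pdiff b f x $ j *\<^sub>R pdiff j g (f x))" if "x \<in> S" for x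
      using pdiff_compose[OF assms(1,2) that] that assms(6) by blast
    show "smooth_on S (pdiff b (\<lambda>x. g (f x)))"
      by (intro smooth_intros comp assms)
  qed fact
  also have "\<dots> = (\<Sum>j\<in>UNIV. pdiff b f x $ j *\<^sub>R pdiff a (\<lambda>x. pdiff j g (f x)) x +
      pdiff a (pdiff b f) x $ j *\<^sub>R pdiff j g (f x))"
    using pdiff_bounded_linear[OF assms(3) bounded_linear_vec_nth smooth_on_pdiff[OF assms(2)]]
    unfolding sum_2
    by (subst pdiff_add[OF assms(3)] pdiff_scaleR[OF assms(3)]; (intro smooth_on_scaleR comp pg nth assms)?)+ simp
  finally show ?thesis
    using pdiff_compose[OF pg assms(2,3) fx]
    by (simp add: sum_2 algebra_simps)
qed

lemma line_has_real_derivative: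
  fixes f :: "real^2 \<Rightarrow> real"
  assumes "smooth_on S f" "p + s *\<^sub>R axis i 1 \<in> S"
  shows "((\<lambda>s. f (p + s *\<^sub>R axis i 1)) has_real_derivative pdiff i f (p + s *\<^sub>R axis i 1)) (at s)"
proof -
  let ?L = "\<lambda>s. p + s *\<^sub>R axis i 1"
  have lin: "linear (frechet_derivative f (at (?L s)))"
    using smooth_on_has_derivative[OF assms] has_derivative_linear by blast
  have "(?L has_derivative (\<lambda>h. h *\<^sub>R axis i 1)) (at s)"
    by (auto intro!: derivative_eq_intros)
  from has_derivative_compose[OF this smooth_on_has_derivative[OF assms]]
  show ?thesis
    unfolding has_field_derivative_def
    by (rule has_derivative_eq_rhs) (auto simp: fun_eq_iff pdiff_def linear_scale[OF lin])
qed

section \<open>Symmetry of second partial derivatives\<close>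

lemma second_difference:
  fixes f :: "real^2 \<Rightarrow> real"
  assumes f: "smooth_on S f" and t: "0 < t"
    and S: "\<And>s r. 0 \<le> s \<Longrightarrow> s \<le> t \<Longrightarrow> 0 \<le> r \<Longrightarrow> r \<le> t \<Longrightarrow> x + s *\<^sub>R axis i 1 + r *\<^sub>R axis j 1 \<in> S"
  obtains s r where "0 \<le> s" "s \<le> t" "0 \<le> r" "r \<le> t"
    "f (x + t *\<^sub>R axis i 1 + t *\<^sub>R axis j 1) - f (x + t *\<^sub>R axis i 1) - f (x + t *\<^sub>R axis j 1) + f x =
      t * t * pdiff j (pdiff i f) (x + s *\<^sub>R axis i 1 + r *\<^sub>R axis j 1)"
proof -
  have S0: "x + s *\<^sub>R axis i 1 \<in> S" if "0 \<le> s" "s \<le> t" for s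
    using S[OF that, of 0] t by auto
  have St: "(x + t *\<^sub>R axis j 1) + s *\<^sub>R axis i 1 \<in> S" if "0 \<le> s" "s \<le> t" for s
    using S[OF that, of t] t by (simp add: algebra_simps)
  define G where "G s = f ((x + t *\<^sub>R axis j 1) + s *\<^sub>R axis i 1) - f (x + s *\<^sub>R axis i 1)" for s
  have "\<exists>z>0. z < t \<and> G t - G 0 = (t - 0) *
      (pdiff i f ((x + t *\<^sub>R axis j 1) + z *\<^sub>R axis i 1) - pdiff i f (x + z *\<^sub>R axis i 1))"
    unfolding G_def
    by (rule MVT2[OF t]) (intro DERIV_diff line_has_real_derivative[OF f] S0 St)
  then obtain s where s: "0 < s" "s < t" and Gs: "G t - G 0 = t *
      (pdiff i f ((x + t *\<^sub>R axis j 1) + s *\<^sub>R axis i 1) - pdiff i f (x + s *\<^sub>R axis i 1))"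
    by auto
  define H where "H r = pdiff i f (x + s *\<^sub>R axis i 1 + r *\<^sub>R axis j 1)" for r
  have "\<exists>z>0. z < t \<and> H t - H 0 = (t - 0) * pdiff j (pdiff i f) (x + s *\<^sub>R axis i 1 + z *\<^sub>R axis j 1)"
    unfolding H_def
    by (rule MVT2[OF t]) (intro line_has_real_derivative[OF smooth_on_pdiff[OF f]] S, use s in auto)
  then obtain r where r: "0 < r" "r < t" and Hr: "H t - H 0 = t * pdiff j (pdiff i f) (x + s *\<^sub>R axis i 1 + r *\<^sub>R axis j 1)"
    by auto
  show ?thesis
  proof (rule that[of s r])
    have "G t - G 0 = t * (H t - H 0)"
      unfolding Gs H_def by (simp add: algebra_simps)
    then show "f (x + t *\<^sub>R axis i 1 + t *\<^sub>R axis j 1) - f (x + t *\<^sub>R axis i 1) - f (x + t *\<^sub>R axis j 1) + f x =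
      t * t * pdiff j (pdiff i f) (x + s *\<^sub>R axis i 1 + r *\<^sub>R axis j 1)"
      unfolding Hr by (simp add: G_def algebra_simps)
  qed (use s r in auto)
qed

text \<open>The second difference over a small square is symmetric in the two directions, and by two
  mean value theorems it is the area times either mixed derivative at some point of the square;
  continuity does the rest.\<close>

lemma pdiff_commute_real:
  fixes f :: "real^2 \<Rightarrow> real"
  assumes "open S" "smooth_on S f" "x \<in> S"
  shows "pdiff i (pdiff j f) x = pdiff j (pdiff i f) x"
proof (rule ccontr)
  let ?A = "pdiff i (pdiff j f)" and ?B = "pdiff j (pdiff i f)"
  assume "?A x \<noteq> ?B x"
  define \<epsilon> where "\<epsilon> = \<bar>?A x - ?B x\<bar> / 2"
  have "\<epsilon> > 0" using \<open>?A x \<noteq> ?B x\<close> by (simp add: \<epsilon>_def)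
  have "isCont ?A x" "isCont ?B x"
    using smooth_on_imp_continuous_on[OF smooth_on_pdiff[OF smooth_on_pdiff[OF assms(2)]]] assms
      continuous_on_eq_continuous_at by blast+
  then obtain d1 d2 where d1: "d1 > 0" "\<And>y. dist y x < d1 \<Longrightarrow> dist (?A y) (?A x) < \<epsilon>"
    and d2: "d2 > 0" "\<And>y. dist y x < d2 \<Longrightarrow> dist (?B y) (?B x) < \<epsilon>"
    using \<open>\<epsilon> > 0\<close> unfolding continuous_at by (metis Lim_at continuous_at continuous_at_eps_delta)
  obtain d3 where d3: "d3 > 0" "ball x d3 \<subseteq> S"
    using assms open_contains_ball by blast
  define d where "d = min d1 (min d2 d3)"
  \<comment> \<open>Two steps of length at most \<open>d / 4\<close> stay within distance
    \<open>d\<close> of \<open>x\<close>.\<close>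
  define t where "t = d / 4"
  have t: "t > 0" using d1 d2 d3 by (simp add: t_def d_def)
  have near: "dist (x + s *\<^sub>R axis i 1 + r *\<^sub>R axis j 1) x < d"
    if "0 \<le> s" "s \<le> t" "0 \<le> r" "r \<le> t" for s r and i j :: 2
  proof -
    have "norm (s *\<^sub>R axis i 1 + r *\<^sub>R axis j (1::real)) \<le> s + r"
      by (rule order_trans[OF norm_triangle_ineq]) (use that in \<open>simp add: norm_axis_1\<close>)
    then show ?thesis using that t by (simp add: dist_norm t_def add.assoc)
  qed
  then have inS: "x + s *\<^sub>R axis i 1 + r *\<^sub>R axis j 1 \<in> S"
    if "0 \<le> s" "s \<le> t" "0 \<le> r" "r \<le> t" for s r and i j :: 2
    using that d3 by (force simp: d_def dist_commute)
  obtain s r where sr: "0 \<le> s" "s \<le> t" "0 \<le> r" "r \<le> t"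
    and B: "f (x + t *\<^sub>R axis i 1 + t *\<^sub>R axis j 1) - f (x + t *\<^sub>R axis i 1) - f (x + t *\<^sub>R axis j 1) + f x =
      t * t * ?B (x + s *\<^sub>R axis i 1 + r *\<^sub>R axis j 1)"
    by (rule second_difference[OF assms(2) t, of x i j]) (use inS in blast)+
  obtain s' r' where sr': "0 \<le> s'" "s' \<le> t" "0 \<le> r'" "r' \<le> t"
    and A: "f (x + t *\<^sub>R axis j 1 + t *\<^sub>R axis i 1) - f (x + t *\<^sub>R axis j 1) - f (x + t *\<^sub>R axis i 1) + f x =
      t * t * ?A (x + s' *\<^sub>R axis j 1 + r' *\<^sub>R axis i 1)"
    by (rule second_difference[OF assms(2) t, of x j i]) (use inS in blast)+
  have "t * t * ?A (x + s' *\<^sub>R axis j 1 + r' *\<^sub>R axis i 1) = t * t * ?B (x + s *\<^sub>R axis i 1 + r *\<^sub>R axis j 1)"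
    unfolding A[symmetric] B[symmetric] by (simp add: algebra_simps)
  then have eq: "?A (x + s' *\<^sub>R axis j 1 + r' *\<^sub>R axis i 1) = ?B (x + s *\<^sub>R axis i 1 + r *\<^sub>R axis j 1)"
    using t by simp
  have "dist (?A (x + s' *\<^sub>R axis j 1 + r' *\<^sub>R axis i 1)) (?A x) < \<epsilon>"
    using d1(2) near[OF sr'] by (simp add: d_def)
  moreover have "dist (?B (x + s *\<^sub>R axis i 1 + r *\<^sub>R axis j 1)) (?B x) < \<epsilon>"
    using d2(2) near[OF sr] by (simp add: d_def)
  ultimately show False
    using dist_triangle_half_r[of _ "?A x" "\<bar>?A x - ?B x\<bar>" "?B x"]
    unfolding eq \<epsilon>_def by (auto simp: dist_real_def)
qed

lemma pdiff_commute:
  fixes f :: "real^2 \<Rightarrow> 'b::euclidean_space"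
  assumes "open S" "smooth_on S f" "x \<in> S"
  shows "pdiff i (pdiff j f) x = pdiff j (pdiff i f) x"
proof (rule euclidean_eqI)
  fix b :: 'b assume "b \<in> Basis"
  have sm: "smooth_on S (\<lambda>x. f x \<bullet> b)"
    by (intro smooth_on_bounded_linear[OF bounded_linear_inner_left] assms)
  have *: "pdiff i (pdiff j f) x \<bullet> b = pdiff i (pdiff j (\<lambda>x. f x \<bullet> b)) x" for i j
  proof -
    have "pdiff i (\<lambda>x. pdiff j f x \<bullet> b) x = pdiff i (pdiff j (\<lambda>x. f x \<bullet> b)) x"
      by (rule pdiff_cong[OF assms(1)])
        (use assms(3) pdiff_bounded_linear[OF _ bounded_linear_inner_left assms(2)]
         in \<open>auto intro!: smooth_on_bounded_linear[OF bounded_linear_inner_left] assms smooth_intros\<close>)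
    then show ?thesis
      using pdiff_bounded_linear[OF assms(3) bounded_linear_inner_left smooth_on_pdiff[OF assms(2)]] by simp
  qed
  show "pdiff i (pdiff j f) x \<bullet> b = pdiff j (pdiff i f) x \<bullet> b"
    unfolding * by (rule pdiff_commute_real[OF assms(1) sm assms(3)])
qed


section \<open>Pseudo-Euclidean linear algebra\<close>

lemma bounded_bilinear_sprod: "bounded_bilinear (sprod (N :: 'n::finite set))"
proof -
  have "sprod N = (\<lambda>x y. (\<chi> i. (if i \<in> N then - 1 else 1) * x $ i) \<bullet> y)"
    by (simp add: fun_eq_iff sprod_def inner_vec_def)
  moreover have "linear (\<lambda>x :: real^'n. \<chi> i. (if i \<in> N then - 1 else 1) * x $ i)"
    by (rule linearI) (auto simp: vec_eq_iff algebra_simps)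
  then have "bounded_linear (\<lambda>x :: real^'n. \<chi> i. (if i \<in> N then - 1 else 1) * x $ i)"
    by (rule linear_linear[THEN iffD2])
  ultimately show ?thesis
    using bounded_bilinear.comp1[OF bounded_bilinear_inner] by metis
qed

interpretation sprod: bounded_bilinear "sprod N" for N
  by (rule bounded_bilinear_sprod)

lemma sprod_commute: "sprod N x y = sprod N y x"
  by (simp add: sprod_def ac_simps)

lemmas sprod_simps = sprod.add_left sprod.add_right sprod.diff_left sprod.diff_right
  sprod.scaleR_left sprod.scaleR_right sprod.minus_left sprod.minus_right sprod.zero_left sprod.zero_right

lemma sprod_axis: "sprod N x (axis i 1) = (if i \<in> N then - 1 else 1) * x $ i"
  by (simp add: sprod_def axis_def if_distrib cong: if_cong)

lemma sprod_nondegenerate: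
  assumes "\<And>y. sprod N x y = 0"
  shows "x = 0"
proof -
  have "x $ i = 0" for i
    using assms[of "axis i 1"] by (simp add: sprod_axis split: if_splits)
  then show ?thesis by (simp add: vec_eq_iff)
qed

lemmas smooth_on_sprod [smooth_intros] = smooth_on_bilinear[OF bounded_bilinear_sprod]
lemmas pdiff_sprod = pdiff_bilinear[OF _ bounded_bilinear_sprod]

lemma exhaust_5:
  fixes x :: 5
  shows "x = 1 \<or> x = 2 \<or> x = 3 \<or> x = 4 \<or> x = 5"
proof (induct x)
  case (of_int z)
  then have "0 \<le> z" and "z < 5" by simp_all
  then have "z = 0 \<or> z = 1 \<or> z = 2 \<or> z = 3 \<or> z = 4" by arith
  then show ?case by auto
qed

lemma forall_5: "(\<forall>i::5. P i) \<longleftrightarrow> P 1 \<and> P 2 \<and> P 3 \<and> P 4 \<and> P 5"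
  by (metis exhaust_5)

lemma UNIV_5: "UNIV = {1, 2, 3, 4, 5::5}"
  using exhaust_5 by auto

lemma sum_5: "sum f (UNIV::5 set) = f 1 + f 2 + f 3 + f 4 + f 5"
  unfolding UNIV_5 by (simp add: ac_simps)

lemma prod_5: "prod f (UNIV::5 set) = f 1 * f 2 * f 3 * f 4 * f 5"
  unfolding UNIV_5 by (simp add: ac_simps)

text \<open>The Gram relations of \<open>Y, Y\<^sub>u, Y\<^sub>v, Y\<^sub>u\<^sub>v\<close> for a lift that is canonical at a point.\<close>

definition null_frame :: "real^5 \<Rightarrow> real^5 \<Rightarrow> real^5 \<Rightarrow> real^5 \<Rightarrow> bool" where
  "null_frame Y A B C \<longleftrightarrow> ip52 Y Y = 0 \<and> ip52 Y A = 0 \<and> ip52 Y B = 0 \<and> ip52 A A = 0 \<and>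
     ip52 B B = 0 \<and> ip52 A B = 1 / 2 \<and> ip52 Y C = - 1 / 2"

text \<open>Products with \<open>Y\<close>, \<open>A\<close>, \<open>B\<close>, \<open>C\<close>
  isolate the coefficients 4, 3, 2, 1 in this order, so the five vectors are independent, hence a
  basis of the space of dimension five.\<close>

lemma null_frame_basis:
  assumes fr: "null_frame Y A B C" and nu: "\<nu> \<noteq> 0"
    "ip52 \<nu> Y = 0" "ip52 \<nu> A = 0" "ip52 \<nu> B = 0" "ip52 \<nu> C = 0"
  shows "\<exists>a. w = a $ 1 *\<^sub>R Y + a $ 2 *\<^sub>R A + a $ 3 *\<^sub>R B + a $ 4 *\<^sub>R C + a $ (5::5) *\<^sub>R \<nu>"
proof -
  define L where "L a = a $ 1 *\<^sub>R Y + a $ 2 *\<^sub>R A + a $ 3 *\<^sub>R B + a $ 4 *\<^sub>R C + a $ (5::5) *\<^sub>R \<nu>" for a :: "real^5"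
  have lin: "linear L"
    by (rule linearI) (auto simp: L_def algebra_simps)
  have "a = 0" if "L a = 0" for a
  proof -
    have z: "ip52 (L a) w = 0" for w by (simp add: that sprod_simps)
    have a4: "a $ 4 = 0" using z[of Y] fr nu by (simp add: L_def sprod_simps null_frame_def sprod_commute)
    have a3: "a $ 3 = 0" using z[of A] a4 fr nu by (simp add: L_def sprod_simps null_frame_def sprod_commute)
    have a2: "a $ 2 = 0" using z[of B] a4 fr nu by (simp add: L_def sprod_simps null_frame_def sprod_commute)
    have a1: "a $ 1 = 0" using z[of C] a4 a3 a2 fr nu by (simp add: L_def sprod_simps null_frame_def sprod_commute)
    have "a $ 5 = 0" using that nu a1 a2 a3 a4 by (simp add: L_def)
    with a1 a2 a3 a4 show "a = 0" by (simp add: vec_eq_iff forall_5)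
  qed
  then have "inj L" using linear_injective_0[OF lin] by blast
  then have "surj L" using linear_injective_imp_surjective[OF lin] by blast
  then show ?thesis unfolding surj_def L_def by blast
qed

lemma null_frame_nondegenerate:
  assumes fr: "null_frame Y A B C" and nu: "\<nu> \<noteq> 0"
    "ip52 \<nu> Y = 0" "ip52 \<nu> A = 0" "ip52 \<nu> B = 0" "ip52 \<nu> C = 0"
    and w: "ip52 w Y = 0" "ip52 w A = 0" "ip52 w B = 0" "ip52 w C = 0" "ip52 w \<nu> = 0"
  shows "w = 0"
proof (rule sprod_nondegenerate)
  fix y show "ip52 w y = 0"
    using null_frame_basis[OF fr nu, of y] w by (auto simp: sprod_simps)
qed

text \<open>The sign is read off a determinant: the Gram determinant of any five vectors is a square
  times the determinant of the form, which is 1. The span of \<open>Y, A, B, C\<close> uses up both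
  negative directions, so \<open>\<nu>\<close> must be positive.\<close>

lemma null_frame_normal_pos:
  assumes fr: "null_frame Y A B C" and nu: "\<nu> \<noteq> 0"
    "ip52 \<nu> Y = 0" "ip52 \<nu> A = 0" "ip52 \<nu> B = 0" "ip52 \<nu> C = 0"
  shows "ip52 \<nu> \<nu> > 0"
proof -
  have ne: "ip52 \<nu> \<nu> \<noteq> 0"
    using null_frame_nondegenerate[OF fr nu, of \<nu>] nu by auto
  \<comment> \<open>\<open>N0\<close> is \<open>2 C\<close> made orthogonal to \<open>A\<close> and
    \<open>B\<close>, the factors 4 coming from \<open>ip52 A B = 1 / 2\<close>. Since
    \<open>ip52 N0 Y = - 1\<close>, a multiple of \<open>Y\<close> then makes it null.\<close>
  define N0 where "N0 = 2 *\<^sub>R C - (4 * ip52 C B) *\<^sub>R A - (4 * ip52 C A) *\<^sub>R B"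
  define N where "N = N0 + (ip52 N0 N0 / 2) *\<^sub>R Y"
  have N0: "ip52 N0 Y = - 1" "ip52 N0 A = 0" "ip52 N0 B = 0" "ip52 N0 \<nu> = 0"
    using fr nu by (simp_all add: N0_def null_frame_def sprod_simps sprod_commute)
  have N: "ip52 N Y = - 1" "ip52 N A = 0" "ip52 N B = 0" "ip52 N \<nu> = 0" "ip52 N N = 0"
    using fr nu N0 by (simp_all add: N_def null_frame_def sprod_simps sprod_commute)
  \<comment> \<open>The first four vectors are orthogonal with squares -1, -1, 1, 1, so the Gram
    determinant reduces to \<open>ip52 \<nu> \<nu>\<close>.\<close>
  define e where "e i = (if i = 1 then A - B else if i = 2 then Y + (1/2) *\<^sub>R N else if i = 3 then A + B
     else if i = 4 then Y - (1/2) *\<^sub>R N else \<nu>)" for i :: 5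
  define M where "M = (\<chi> i j. e i $ j)"
  define H where "H = (\<chi> i j. if i = j then (if i \<in> {4, 5} then - 1 else 1) else 0 :: real^5^5)"
  define G where "G = (\<chi> i j. ip52 (e i) (e j))"
  have "G = M ** H ** transpose M"
    by (simp add: vec_eq_iff G_def M_def H_def matrix_matrix_mult_def transpose_def sprod_def sum_5)
  then have "det G = det M * det H * det M"
    by (simp add: det_mul)
  also have "det H = 1"
    by (subst det_diagonal) (auto simp: H_def prod_5)
  finally have G0: "det G \<ge> 0" by simp
  have "det G = (\<Prod>i\<in>UNIV. G $ i $ i)"
  proof (rule det_diagonal)
    have "\<forall>i j. i \<noteq> j \<longrightarrow> G $ i $ j = 0"
      using fr nu N unfolding forall_5 by (simp add: G_def e_def null_frame_def sprod_simps sprod_commute)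
    then show "i \<noteq> j \<Longrightarrow> G $ i $ j = 0" for i j by blast
  qed
  also have "\<dots> = ip52 \<nu> \<nu>"
  proof -
    have F: "ip52 A A = 0" "ip52 B B = 0" "ip52 A B = 1 / 2" "ip52 B A = 1 / 2" "ip52 Y Y = 0" "ip52 Y N = - 1"
      using fr N(1) sprod_commute[of "{4, 5}" B A] sprod_commute[of "{4, 5}" Y N] by (simp_all add: null_frame_def)
    show ?thesis by (simp add: prod_5 G_def e_def sprod_simps F N)
  qed
  finally show ?thesis using G0 ne by simp
qed

section \<open>Changes of coordinates and of lifts\<close>

lemma is_chart_inj_on: "is_chart c \<Longrightarrow> inj_on (snd c) (fst c)"
  unfolding is_chart_def homeomorphism_def by (metis inj_on_inverseI)

lemma in_chart_apply: "is_chart c \<Longrightarrow> p \<in> fst c \<Longrightarrow> in_chart c f (snd c p) = f p"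
  by (simp add: in_chart_def inv_into_f_f is_chart_inj_on)

lemma is_chart_homeomorphism:
  assumes "is_chart c"
  shows "homeomorphism (fst c) (snd c ` fst c) (snd c) (inv_into (fst c) (snd c))"
proof -
  obtain g where g: "homeomorphism (fst c) (snd c ` fst c) (snd c) g"
    using assms by (auto simp: is_chart_def)
  have "inv_into (fst c) (snd c) x = g x" if "x \<in> snd c ` fst c" for x
    using that g is_chart_inj_on[OF assms] by (auto simp: inv_into_f_f homeomorphism_def)
  then show ?thesis by (intro homeomorphism_cong[OF g]) auto
qed

lemma chart_open_image:
  assumes "is_chart c" "open W"
  shows "open (snd c ` (fst c \<inter> W))"
proof -
  have "openin (top_of_set (fst c)) (fst c \<inter> W)"
    using assms by (auto simp: openin_open)
  then have "openin (top_of_set (snd c ` fst c)) (snd c ` (fst c \<inter> W))"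
    using homeomorphism_imp_open_map[OF is_chart_homeomorphism[OF assms(1)]] by blast
  moreover have "open (snd c ` fst c)" using assms by (simp add: is_chart_def)
  ultimately show ?thesis using openin_open_trans by blast
qed

lemma local_coords_is_chart: "local_coords A c \<Longrightarrow> is_chart c"
  by (simp add: local_coords_def)

lemma atlas_local_coords: "smooth_atlas A \<Longrightarrow> c \<in> A \<Longrightarrow> local_coords A c"
  by (auto simp: smooth_atlas_def local_coords_def)

lemma atlas_covers:
  assumes "smooth_atlas A"
  obtains d where "d \<in> A" "p \<in> fst d"
proof -
  have "p \<in> (\<Union>c\<in>A. fst c)" using assms by (simp add: smooth_atlas_def)
  then show ?thesis using that by blast
qed

text \<open>Smoothness is declared in atlas charts only; near each point the expression in
  \<open>c\<close> factors through such a chart and a smooth transition map.\<close>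

lemma smooth_on_in_chart:
  assumes A: "smooth_atlas A" and c: "local_coords A c" and W: "open W" and f: "smooth_map_on A W f"
  shows "smooth_on (snd c ` (fst c \<inter> W)) (in_chart c f)"
proof (rule smooth_on_local)
  fix x assume "x \<in> snd c ` (fst c \<inter> W)"
  then obtain p where p: "p \<in> fst c" "p \<in> W" "x = snd c p" by auto
  obtain d where d: "d \<in> A" "p \<in> fst d" using atlas_covers[OF A] .
  have ch: "is_chart c" "is_chart d"
    using local_coords_is_chart c atlas_local_coords[OF A d(1)] by blast+
  have od: "open (fst d)" using ch by (simp add: is_chart_def)
  let ?U = "snd c ` (fst c \<inter> (fst d \<inter> W))"
  have U: "open ?U" using chart_open_image[OF ch(1)] od W by (simp add: open_Int)
  have "smooth_on ?U (\<lambda>x. in_chart d f (in_chart c (snd d) x))"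
  proof (rule smooth_on_compose[OF _ U])
    show "smooth_on (snd d ` (fst d \<inter> W)) (in_chart d f)"
      using f d by (simp add: smooth_map_on_def)
    show "open (snd d ` (fst d \<inter> W))" using chart_open_image[OF ch(2) W] .
    show "smooth_on ?U (in_chart c (snd d))"
      by (rule smooth_on_subset[of "snd c ` (fst c \<inter> fst d)"])
        (use c d in \<open>auto simp: local_coords_def compatible_def\<close>)
    show "in_chart c (snd d) ` ?U \<subseteq> snd d ` (fst d \<inter> W)"
      by (auto simp: in_chart_apply[OF ch(1)])
  qed
  then have "smooth_on ?U (in_chart c f)"
    by (rule smooth_on_cong[OF U, rotated]) (auto simp: in_chart_apply[OF ch(1)] in_chart_apply[OF ch(2)])
  then show "\<exists>U. open U \<and> x \<in> U \<and> smooth_on U (in_chart c f)"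
    using U p d by blast
qed

lemma smooth_map_on_coords: "local_coords A c \<Longrightarrow> smooth_map_on A (fst c) (snd c)"
  by (auto simp: smooth_map_on_def local_coords_def compatible_def Int_commute)

lemma smooth_on_transition:
  assumes "smooth_atlas A" "local_coords A c" "local_coords A c'"
  shows "smooth_on (snd c' ` (fst c' \<inter> fst c)) (in_chart c' (snd c))"
proof -
  have "open (fst c)" using assms(2) by (simp add: local_coords_def is_chart_def)
  then show ?thesis
    using smooth_on_in_chart[OF assms(1,3) _ smooth_map_on_coords[OF assms(2)]] by blast
qed

lemma pd_eq_pdiff: "pd c i f p = pdiff i (in_chart c f) (snd c p)"
  by (simp add: pd_def differential_def pdiff_def)

lemma in_chart_pd:
  "x \<in> snd c ` fst c \<Longrightarrow> in_chart c (pd c i f) x = pdiff i (in_chart c f) x"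
  by (simp add: in_chart_def pd_eq_pdiff f_inv_into_f)

lemma pd_pd_eq_pdiff:
  assumes c: "is_chart c" and W: "open W" and f: "smooth_on (snd c ` (fst c \<inter> W)) (in_chart c f)"
    and p: "p \<in> fst c" "p \<in> W"
  shows "pd c j (pd c i f) p = pdiff j (pdiff i (in_chart c f)) (snd c p)"
proof -
  have U: "open (snd c ` (fst c \<inter> W))" by (rule chart_open_image[OF c W])
  have "pdiff j (pdiff i (in_chart c f)) (snd c p) = pdiff j (in_chart c (pd c i f)) (snd c p)"
    by (rule pdiff_cong[OF U]) (use p in \<open>auto simp: in_chart_pd intro!: smooth_on_pdiff f\<close>)
  then show ?thesis by (simp add: pd_eq_pdiff)
qed

text \<open>The chain rule for transition maps; through determinants it makes the Jacobian factor of
  the density consistent between charts.\<close>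

lemma differential_transition_cocycle:
  assumes A: "smooth_atlas A" and c: "local_coords A c" "local_coords A c'" "local_coords A d"
    and p: "p \<in> fst c" "p \<in> fst c'" "p \<in> fst d"
  shows "differential d (snd c) p = differential c' (snd c) p \<circ> differential d (snd c') p"
proof -
  have ch: "is_chart c" "is_chart c'" "is_chart d" using c local_coords_is_chart by blast+
  have op: "open (fst c)" "open (fst c')" using ch by (auto simp: is_chart_def)
  let ?U = "snd d ` (fst d \<inter> (fst c' \<inter> fst c))"
  have U: "open ?U" using chart_open_image[OF ch(3) open_Int[OF op(2,1)]] .
  have sm1: "smooth_on ?U (in_chart d (snd c'))"
    by (rule smooth_on_subset[OF smooth_on_transition[OF A c(2,3)]]) auto
  have sm2: "smooth_on (snd c' ` (fst c' \<inter> fst c)) (in_chart c' (snd c))"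
    by (rule smooth_on_transition[OF A c(1,2)])
  have sm3: "smooth_on ?U (in_chart d (snd c))"
    by (rule smooth_on_subset[OF smooth_on_transition[OF A c(1,3)]]) auto
  have x: "snd d p \<in> ?U" using p by auto
  have x': "in_chart d (snd c') (snd d p) = snd c' p" using in_chart_apply[OF ch(3) p(3)] .
  have "frechet_derivative (in_chart d (snd c)) (at (snd d p)) =
      frechet_derivative (in_chart c' (snd c) \<circ> in_chart d (snd c')) (at (snd d p))"
    by (rule frechet_derivative_transform_within_open[OF smooth_on_imp_differentiable[OF sm3 x] U x])
      (auto simp: in_chart_apply[OF ch(3)] in_chart_apply[OF ch(2)])
  also have "\<dots> = frechet_derivative (in_chart c' (snd c)) (at (in_chart d (snd c') (snd d p))) \<circ>
      frechet_derivative (in_chart d (snd c')) (at (snd d p))"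
    by (rule frechet_derivative_compose[OF smooth_on_imp_differentiable[OF sm1 x] smooth_on_imp_differentiable[OF sm2]])
      (use p x' in auto)
  finally show ?thesis by (simp add: differential_def x')
qed

lemma differential_self:
  assumes "is_chart c" "p \<in> fst c"
  shows "differential c (snd c) p = (\<lambda>h. h)"
proof -
  have U: "open (snd c ` fst c)" using assms by (simp add: is_chart_def)
  have "frechet_derivative (\<lambda>x. x) (at (snd c p)) = frechet_derivative (in_chart c (snd c)) (at (snd c p))"
    by (rule frechet_derivative_transform_within_open[OF _ U]) (use assms in \<open>auto simp: in_chart_apply\<close>)
  then show ?thesis by (simp add: differential_def)
qed

lemma linear_differential:
  assumes "smooth_atlas A" "local_coords A c" "local_coords A c'" "p \<in> fst c" "p \<in> fst c'"
  shows "linear (differential c' (snd c) p)"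
  unfolding differential_def
  by (rule linear_frechet_derivative smooth_on_imp_differentiable[OF smooth_on_transition[OF assms(1-3)]])+
    (use assms in auto)

lemma det_transition_cocycle:
  assumes "smooth_atlas A" "local_coords A c" "local_coords A c'" "local_coords A d"
    and "p \<in> fst c" "p \<in> fst c'" "p \<in> fst d"
  shows "det (matrix (differential d (snd c) p)) =
    det (matrix (differential c' (snd c) p)) * det (matrix (differential d (snd c') p))"
  unfolding differential_transition_cocycle[OF assms]
  by (simp add: matrix_compose[OF linear_differential[OF assms(1,3,4,6,7)] linear_differential[OF assms(1,2,3,5,6)]] det_mul)

lemma det_transition_inverse:
  assumes "smooth_atlas A" "local_coords A c" "local_coords A c'" "p \<in> fst c" "p \<in> fst c'"
  shows "det (matrix (differential c' (snd c) p)) * det (matrix (differential c (snd c') p)) = 1"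
proof -
  have "matrix (\<lambda>h::real^2. h) = mat 1" using matrix_id_mat_1 by (simp add: id_def)
  then show ?thesis
    using det_transition_cocycle[OF assms(1,2,3,2,4,5,4)]
    by (simp add: differential_self[OF local_coords_is_chart[OF assms(2)] assms(4)])
qed

subsection \<open>Lifts\<close>

definition gram :: "'m chart \<Rightarrow> ('m \<Rightarrow> real^5) \<Rightarrow> 'm \<Rightarrow> 2 \<Rightarrow> 2 \<Rightarrow> real" where
  "gram c Y p i j = ip52 (pd c i Y p) (pd c j Y p)"

text \<open>The vector \<open>m\<close> is left arbitrary: the expression transforms as a second
  fundamental form once \<open>m\<close> is orthogonal to \<open>Y\<close> and its first
  derivatives, and this freedom allows unnormalised normals and shifts by multiples of
  \<open>Y\<close>.\<close>

definition sff :: "'m chart \<Rightarrow> ('m \<Rightarrow> real^5) \<Rightarrow> 'm \<Rightarrow> real^5 \<Rightarrow> 2 \<Rightarrow> 2 \<Rightarrow> real" where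
  "sff c Y p m i j = ip52 (pd c i (pd c j Y) p) m"

lemma local_liftD:
  assumes "local_lift A y W Y"
  shows "open W" "smooth_map_on A W Y"
    "\<And>p. p \<in> W \<Longrightarrow> Y p \<noteq> 0" "\<And>p. p \<in> W \<Longrightarrow> ip52 (Y p) (Y p) = 0" "\<And>p. p \<in> W \<Longrightarrow> y p = span {Y p}"
  using assms by (auto simp: local_lift_def)

lemma null_lift_derivatives:
  fixes F :: "real^2 \<Rightarrow> real^5"
  assumes S: "open S" and F: "smooth_on S F" and null: "\<And>x. x \<in> S \<Longrightarrow> ip52 (F x) (F x) = 0" and x: "x \<in> S"
  shows "ip52 (pdiff i F x) (F x) = 0"
    and "ip52 (pdiff i (pdiff j F) x) (F x) = - ip52 (pdiff i F x) (pdiff j F x)"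
proof -
  have *: "ip52 (pdiff i F x) (F x) = 0" if x: "x \<in> S" for x i
  proof -
    have "pdiff i (\<lambda>x. ip52 (F x) (F x)) x = ip52 (F x) (pdiff i F x) + ip52 (pdiff i F x) (F x)"
      by (rule pdiff_sprod[OF x F F])
    moreover have "pdiff i (\<lambda>x. ip52 (F x) (F x)) x = 0"
      by (rule pdiff_const_on[OF S null x])
    ultimately show ?thesis by (simp add: sprod_commute)
  qed
  then show "ip52 (pdiff i F x) (F x) = 0" using x .
  have "pdiff i (\<lambda>x. ip52 (pdiff j F x) (F x)) x =
      ip52 (pdiff j F x) (pdiff i F x) + ip52 (pdiff i (pdiff j F) x) (F x)"
    by (rule pdiff_sprod[OF x smooth_on_pdiff[OF F] F])
  moreover have "pdiff i (\<lambda>x. ip52 (pdiff j F x) (F x)) x = 0"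
    by (rule pdiff_const_on[OF S * x])
  ultimately show "ip52 (pdiff i (pdiff j F) x) (F x) = - ip52 (pdiff i F x) (pdiff j F x)"
    by (simp add: sprod_commute)
qed

lemma lift_derivatives:
  assumes A: "smooth_atlas A" and c: "local_coords A c" and Y: "local_lift A y W Y"
    and p: "p \<in> fst c" "p \<in> W"
  shows "ip52 (pd c i Y p) (Y p) = 0"
    and "ip52 (pd c i (pd c j Y) p) (Y p) = - gram c Y p i j"
    and "pd c i (pd c j Y) p = pd c j (pd c i Y) p"
proof -
  have ch: "is_chart c" using c by (rule local_coords_is_chart)
  have S: "open (snd c ` (fst c \<inter> W))" by (rule chart_open_image[OF ch local_liftD(1)[OF Y]])
  have F: "smooth_on (snd c ` (fst c \<inter> W)) (in_chart c Y)"
    by (rule smooth_on_in_chart[OF A c local_liftD(1,2)[OF Y]])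
  have null: "\<And>x. x \<in> snd c ` (fst c \<inter> W) \<Longrightarrow> ip52 (in_chart c Y x) (in_chart c Y x) = 0"
    using local_liftD(4)[OF Y] by (auto simp: in_chart_apply[OF ch])
  have x: "snd c p \<in> snd c ` (fst c \<inter> W)" using p by auto
  note pp = pd_pd_eq_pdiff[OF ch local_liftD(1)[OF Y] F p]
  show "ip52 (pd c i Y p) (Y p) = 0"
    using null_lift_derivatives(1)[OF S F null x, of i] by (simp add: pd_eq_pdiff in_chart_apply[OF ch p(1)])
  show "ip52 (pd c i (pd c j Y) p) (Y p) = - gram c Y p i j"
    using null_lift_derivatives(2)[OF S F null x, of i j]
    by (simp add: pp gram_def pd_eq_pdiff[of c _ Y] in_chart_apply[OF ch p(1)])
  show "pd c i (pd c j Y) p = pd c j (pd c i Y) p"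
    unfolding pp by (rule pdiff_commute[OF S F x])
qed

lemma gram_commute: "gram c Y p i j = gram c Y p j i"
  by (simp add: gram_def sprod_commute)

lemma sff_commute:
  assumes "smooth_atlas A" "local_coords A c" "local_lift A y W Y" "p \<in> fst c" "p \<in> W"
  shows "sff c Y p m i j = sff c Y p m j i"
  unfolding sff_def using lift_derivatives(3)[OF assms] by metis

text \<open>Second derivatives of the coordinate change and all derivatives of the scale factor
  contribute only terms along \<open>Y\<close> and its first derivatives. They disappear for
  \<open>m\<close> orthogonal to these, and drop out of \<open>gram\<close> because \<open>Y\<close>
  is null and orthogonal to its derivatives.\<close>

lemma lift_change:
  fixes Y Y' :: "'m::topological_space \<Rightarrow> real^5"
  assumes A: "smooth_atlas A" and c: "local_coords A c" "local_coords A c'"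
    and Y: "local_lift A y W Y" and Y': "local_lift A y W' Y'"
    and p: "p \<in> fst c" "p \<in> W" "p \<in> fst c'" "p \<in> W'"
  defines "J \<equiv> matrix (differential c' (snd c) p)"
  obtains r where "r \<noteq> 0" "Y' p = r *\<^sub>R Y p"
    "\<And>a. \<exists>\<mu>. pd c' a Y' p = r *\<^sub>R (\<Sum>i\<in>UNIV. J $ i $ a *\<^sub>R pd c i Y p) + \<mu> *\<^sub>R Y p"
    "\<And>a b. gram c' Y' p a b = r\<^sup>2 * (\<Sum>i\<in>UNIV. \<Sum>j\<in>UNIV. J $ i $ a * J $ j $ b * gram c Y p i j)"
    "\<And>m a b. ip52 m (Y p) = 0 \<Longrightarrow> (\<And>i. ip52 m (pd c i Y p) = 0) \<Longrightarrow>
        ip52 m (pd c' a Y' p) = 0 \<and>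
        sff c' Y' p m a b = r * (\<Sum>i\<in>UNIV. \<Sum>j\<in>UNIV. J $ i $ a * J $ j $ b * sff c Y p m i j)"
proof -
  have ch: "is_chart c" "is_chart c'" using c local_coords_is_chart by blast+
  have opW: "open W" "open W'" using local_liftD(1) Y Y' by auto
  have op: "open (fst c \<inter> W \<inter> W')" "open (fst c \<inter> W)" using ch opW by (auto simp: is_chart_def)
  let ?U = "snd c' ` (fst c' \<inter> (fst c \<inter> W \<inter> W'))"
  have U: "open ?U" using chart_open_image[OF ch(2) op(1)] .
  let ?T = "snd c ` (fst c \<inter> W)"
  have T: "open ?T" using chart_open_image[OF ch(1) opW(1)] .
  define F where "F = in_chart c Y"
  define F' where "F' = in_chart c' Y'"
  define \<tau> where "\<tau> = in_chart c' (snd c)"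
  define H where "H x = F (\<tau> x)" for x
  \<comment> \<open>The factor between the lifts is known pointwise only, from equality of lines.
    The Euclidean inner product, which is definite, exhibits it as a smooth quotient.\<close>
  define l where "l x = (F' x \<bullet> H x) / (H x \<bullet> H x)" for x
  let ?x = "snd c' p"
  have x: "?x \<in> ?U" using p by auto
  have Fsm: "smooth_on ?T F" unfolding F_def by (rule smooth_on_in_chart[OF A c(1) local_liftD(1,2)[OF Y]])
  have F'sm0: "smooth_on (snd c' ` (fst c' \<inter> W')) F'"
    unfolding F'_def by (rule smooth_on_in_chart[OF A c(2) local_liftD(1,2)[OF Y']])
  then have F'sm: "smooth_on ?U F'" by (rule smooth_on_subset) auto
  have \<tau>sm: "smooth_on ?U \<tau>" unfolding \<tau>_def
    by (rule smooth_on_subset[OF smooth_on_transition[OF A c]]) auto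
  have \<tau>T: "\<tau> ` ?U \<subseteq> ?T" by (auto simp: \<tau>_def in_chart_apply[OF ch(2)])
  have \<tau>x: "\<tau> ?x = snd c p" by (simp add: \<tau>_def in_chart_apply[OF ch(2) p(3)])
  have Hsm: "smooth_on ?U H" unfolding H_def by (rule smooth_on_compose[OF Fsm U T \<tau>sm \<tau>T])
  have H: "H (snd c' q) = Y q" if "q \<in> fst c' \<inter> (fst c \<inter> W \<inter> W')" for q
    using that by (simp add: H_def F_def \<tau>_def in_chart_apply[OF ch(1)] in_chart_apply[OF ch(2)])
  have F': "F' (snd c' q) = Y' q" if "q \<in> fst c' \<inter> (fst c \<inter> W \<inter> W')" for q
    using that by (simp add: F'_def in_chart_apply[OF ch(2)])
  have Hne: "H x \<bullet> H x \<noteq> 0" if "x \<in> ?U" for x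
    using that H local_liftD(3)[OF Y] by auto
  have lsm: "smooth_on ?U l"
    unfolding l_def by (intro smooth_on_divide smooth_on_bilinear[OF bounded_bilinear_inner] U F'sm Hsm Hne)
  have eq: "F' x = l x *\<^sub>R H x" and lne: "l x \<noteq> 0" if xU: "x \<in> ?U" for x
  proof -
    from xU obtain q where q: "q \<in> fst c' \<inter> (fst c \<inter> W \<inter> W')" "x = snd c' q" by auto
    have "span {Y' q} = span {Y q}" using local_liftD(5)[OF Y] local_liftD(5)[OF Y'] q by auto
    then have "Y' q \<in> span {Y q}" using span_base by blast
    then obtain k where k: "Y' q = k *\<^sub>R Y q" by (auto simp: span_singleton)
    then have kx: "F' x = k *\<^sub>R H x" using q H F' by simp
    then have lk: "l x = k" using Hne[OF xU] by (simp add: l_def)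
    then show "F' x = l x *\<^sub>R H x" using kx by simp
    show "l x \<noteq> 0" using lk k local_liftD(3)[OF Y', of q] q by auto
  qed
  have J: "J $ i $ a = pdiff a \<tau> ?x $ i" for i a
    by (simp add: J_def matrix_def differential_def pdiff_def \<tau>_def)
  have pdF: "pd c i Y p = pdiff i F (\<tau> ?x)" for i by (simp add: pd_eq_pdiff F_def \<tau>x)
  have ppdF: "pd c i (pd c j Y) p = pdiff i (pdiff j F) (\<tau> ?x)" for i j
    using pd_pd_eq_pdiff[OF ch(1) opW(1) Fsm[unfolded F_def] p(1,2)] by (simp add: F_def \<tau>x)
  have pdF': "pd c' i Y' p = pdiff i F' ?x" for i by (simp add: pd_eq_pdiff F'_def)
  have ppdF': "pd c' i (pd c' j Y') p = pdiff i (pdiff j F') ?x" for i j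
    using pd_pd_eq_pdiff[OF ch(2) opW(2) F'sm0[unfolded F'_def] p(3,4)] by (simp add: F'_def)
  have lHsm: "smooth_on ?U (\<lambda>x. l x *\<^sub>R H x)" by (intro smooth_on_scaleR U lsm Hsm)
  have d1: "pdiff a F' x = l x *\<^sub>R pdiff a H x + pdiff a l x *\<^sub>R H x" if "x \<in> ?U" for a x
    using pdiff_cong[OF U eq F'sm that] pdiff_scaleR[OF that lsm Hsm] by simp
  have d2: "pdiff a (pdiff b F') ?x = l ?x *\<^sub>R pdiff a (pdiff b H) ?x + pdiff a l ?x *\<^sub>R pdiff b H ?x
      + (pdiff b l ?x *\<^sub>R pdiff a H ?x + pdiff a (pdiff b l) ?x *\<^sub>R H ?x)" for a b
  proof -
    have "pdiff a (pdiff b F') ?x = pdiff a (\<lambda>x. l x *\<^sub>R pdiff b H x + pdiff b l x *\<^sub>R H x) ?x"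
      by (rule pdiff_cong[OF U d1 smooth_on_pdiff[OF F'sm] x])
    also have "\<dots> = pdiff a (\<lambda>x. l x *\<^sub>R pdiff b H x) ?x + pdiff a (\<lambda>x. pdiff b l x *\<^sub>R H x) ?x"
      by (rule pdiff_add[OF x]) (intro smooth_on_scaleR smooth_on_pdiff U lsm Hsm)+
    finally show ?thesis
      by (simp add: pdiff_scaleR[OF x lsm smooth_on_pdiff[OF Hsm]] pdiff_scaleR[OF x smooth_on_pdiff[OF lsm] Hsm])
  qed
  have Hx: "H ?x = Y p" using H p by simp
  have dH: "pdiff a H ?x = (\<Sum>i\<in>UNIV. J $ i $ a *\<^sub>R pd c i Y p)" for a
    unfolding J pdF H_def[abs_def] by (rule pdiff_compose[OF Fsm \<tau>sm x]) (use x \<tau>T in auto)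
  have ddH: "pdiff a (pdiff b H) ?x = (\<Sum>i\<in>UNIV. \<Sum>j\<in>UNIV. (J $ i $ a * J $ j $ b) *\<^sub>R pd c i (pd c j Y) p) +
      (\<Sum>j\<in>UNIV. pdiff a (pdiff b \<tau>) ?x $ j *\<^sub>R pd c j Y p)" for a b
    unfolding J pdF ppdF H_def[abs_def] by (rule pdiff_compose_2[OF Fsm \<tau>sm x U T \<tau>T])
  have pdY': "pd c' a Y' p = l ?x *\<^sub>R (\<Sum>i\<in>UNIV. J $ i $ a *\<^sub>R pd c i Y p) + pdiff a l ?x *\<^sub>R Y p" for a
    unfolding pdF' d1[OF x] dH Hx ..
  show ?thesis
  proof (rule that[of "l ?x"])
    show "l ?x \<noteq> 0" using lne[OF x] .
    show "Y' p = l ?x *\<^sub>R Y p" using eq[OF x] H F' p by simp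
    show "\<exists>\<mu>. pd c' a Y' p = l ?x *\<^sub>R (\<Sum>i\<in>UNIV. J $ i $ a *\<^sub>R pd c i Y p) + \<mu> *\<^sub>R Y p" for a
      using pdY' by blast
    have perp: "ip52 (pd c i Y p) (Y p) = 0" "ip52 (Y p) (pd c i Y p) = 0" "ip52 (Y p) (Y p) = 0" for i
      using lift_derivatives(1)[OF A c(1) Y p(1,2)] local_liftD(4)[OF Y p(2)] by (simp_all add: sprod_commute)
    show "gram c' Y' p a b = (l ?x)\<^sup>2 * (\<Sum>i\<in>UNIV. \<Sum>j\<in>UNIV. J $ i $ a * J $ j $ b * gram c Y p i j)" for a b
      unfolding gram_def pdY' by (simp add: sum_2 sprod_simps perp algebra_simps power2_eq_square)
    fix m a b assume m: "ip52 m (Y p) = 0" "\<And>i. ip52 m (pd c i Y p) = 0"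
    have m': "ip52 (Y p) m = 0" "ip52 (pd c i Y p) m = 0" for i
      using m by (simp_all add: sprod_commute)
    have "ip52 m (pd c' a Y' p) = 0" unfolding pdY' by (simp add: sum_2 sprod_simps m)
    moreover have "sff c' Y' p m a b = l ?x * (\<Sum>i\<in>UNIV. \<Sum>j\<in>UNIV. J $ i $ a * J $ j $ b * sff c Y p m i j)"
      unfolding sff_def ppdF' d2 ddH dH Hx by (simp add: sum_2 sprod_simps m' algebra_simps)
    ultimately show "ip52 m (pd c' a Y' p) = 0 \<and>
      sff c' Y' p m a b = l ?x * (\<Sum>i\<in>UNIV. \<Sum>j\<in>UNIV. J $ i $ a * J $ j $ b * sff c Y p m i j)" ..
  qed
qed

section \<open>Linear changes of coordinates and the Gram matrix\<close>

text \<open>The null directions of a binary form with negative determinant are the real roots of a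
  quadratic equation; scaling one of the two null vectors adjusts their product.\<close>

lemma null_basis:
  fixes g :: "2 \<Rightarrow> 2 \<Rightarrow> real"
  defines "q h k \<equiv> \<Sum>i\<in>UNIV. \<Sum>j\<in>UNIV. h $ i * k $ j * g i j"
  assumes sym: "g 2 1 = g 1 2" and det: "g 1 1 * g 2 2 - (g 1 2)\<^sup>2 < 0"
  obtains \<alpha> \<beta> :: "real^2" where "q \<alpha> \<alpha> = 0" "q \<beta> \<beta> = 0" "q \<alpha> \<beta> = 1 / 2"
proof (cases "g 1 1 = 0")
  case True
  then have b: "g 1 2 \<noteq> 0" using det by auto
  let ?\<alpha> = "vector [1, 0] :: real^2" and ?\<beta> = "vector [- (g 2 2 / (4 * (g 1 2)\<^sup>2)), 1 / (2 * g 1 2)] :: real^2"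
  show ?thesis
  proof (rule that[of ?\<alpha> ?\<beta>])
    show "q ?\<alpha> ?\<alpha> = 0" using True by (simp add: q_def sum_2)
    show "q ?\<alpha> ?\<beta> = 1 / 2" using True b by (simp add: q_def sum_2)
    show "q ?\<beta> ?\<beta> = 0" using True b sym by (simp add: q_def sum_2 field_simps power2_eq_square)
  qed
next
  case False
  define a b c where "a = g 1 1" and "b = g 1 2" and "c = g 2 2"
  define D where "D = sqrt (b\<^sup>2 - a * c)"
  have D2: "D * D = b * b - a * c" using det by (simp add: D_def a_def b_def c_def power2_eq_square)
  have D0: "D \<noteq> 0" using det by (simp add: D_def a_def b_def c_def)
  have a0: "a \<noteq> 0" using False by (simp add: a_def)
  \<comment> \<open>Before scaling, the two null vectors have product
    \<open>- 2 * (D * D) / a\<close>; this factor turns it into 1/2.\<close>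
  define s where "s = - a / (4 * (D * D))"
  let ?\<alpha> = "vector [(- b + D) / a, 1] :: real^2" and ?\<beta> = "vector [s * ((- b - D) / a), s] :: real^2"
  have q: "q h k = a * h $ 1 * k $ 1 + b * (h $ 1 * k $ 2 + h $ 2 * k $ 1) + c * h $ 2 * k $ 2" for h k
    using sym by (simp add: q_def sum_2 a_def b_def c_def algebra_simps)
  have c: "c = (b * b - D * D) / a" using D2 a0 by (simp add: field_simps)
  show ?thesis
  proof (rule that[of ?\<alpha> ?\<beta>])
    show "q ?\<alpha> ?\<alpha> = 0" using a0 by (simp add: q c field_simps)
    show "q ?\<beta> ?\<beta> = 0" using a0 by (simp add: q c field_simps)
    have "q ?\<alpha> ?\<beta> = s * (- 2 * (D * D) / a)" using a0 by (simp add: q c field_simps)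
    also have "\<dots> = 1 / 2" using a0 D0 by (simp add: s_def field_simps)
    finally show "q ?\<alpha> ?\<beta> = 1 / 2" .
  qed
qed

text \<open>Linear changes suffice for everything that has to be canonical at one point only. The
  new coordinates apply the inverse of \<open>J\<close>, so that the old ones have differential
  \<open>J\<close> with respect to them.\<close>

lemma linear_chart:
  fixes c :: "'m::topological_space chart"
  assumes A: "smooth_atlas A" and c: "local_coords A c" and J: "invertible (J :: real^2^2)"
  obtains c' where "local_coords A c'" "fst c' = fst c"
    "\<And>p. p \<in> fst c \<Longrightarrow> matrix (differential c' (snd c) p) = J"
proof -
  obtain K where K: "J ** K = mat 1" "K ** J = mat 1" using J by (auto simp: invertible_def)
  have JK: "J *v (K *v x) = x" "K *v (J *v x) = x" for x
    by (simp_all add: matrix_vector_mul_assoc K)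
  define c' :: "'m chart" where "c' = (fst c, \<lambda>p. K *v snd c p)"
  have ch: "is_chart c" using c by (rule local_coords_is_chart)
  have blJ: "bounded_linear ((*v) J)" "bounded_linear ((*v) K)" by (rule matrix_vector_mul_bounded_linear)+
  have im: "snd c' ` (fst c \<inter> W) = (*v) J -` (snd c ` (fst c \<inter> W))" for W
  proof (intro set_eqI iffI)
    fix x assume "x \<in> (*v) J -` (snd c ` (fst c \<inter> W))"
    then obtain q where "q \<in> fst c \<inter> W" "J *v x = snd c q" by auto
    then show "x \<in> snd c' ` (fst c \<inter> W)"
      using JK(2)[of x] by (auto simp: c'_def intro!: image_eqI[of _ _ q])
  qed (auto simp: c'_def JK)
  have opim: "open (snd c' ` (fst c \<inter> W))" if "open W" for W
    unfolding im by (rule open_vimage[OF chart_open_image[OF ch that]])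
      (rule linear_continuous_on[OF blJ(1)])
  have "homeomorphism (snd c ` fst c) (snd c' ` fst c) ((*v) K) ((*v) J)"
    unfolding homeomorphism_def
    by (auto simp: JK c'_def image_image intro: linear_continuous_on blJ)
  from homeomorphism_compose[OF is_chart_homeomorphism[OF ch] this]
  have hom: "homeomorphism (fst c') (snd c' ` fst c') (snd c') (inv_into (fst c) (snd c) \<circ> (*v) J)"
    by (simp add: c'_def o_def)
  have ch': "is_chart c'"
    unfolding is_chart_def using hom opim[of UNIV] ch by (auto simp: c'_def is_chart_def)
  have in': "in_chart c' f x = in_chart c f (J *v x)" if "x \<in> snd c' ` fst c" for f :: "'m \<Rightarrow> 'b" and x
  proof -
    obtain p where p: "p \<in> fst c" "x = K *v snd c p" using \<open>x \<in> _\<close> by (auto simp: c'_def)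
    have "in_chart c' f x = f p" using in_chart_apply[OF ch', of p f] p by (simp add: c'_def)
    then show ?thesis using in_chart_apply[OF ch p(1), of f] by (simp add: p(2) JK)
  qed
  have loc: "local_coords A c'"
    unfolding local_coords_def
  proof (intro conjI ballI ch')
    fix d assume d: "d \<in> A"
    have od: "open (fst d)" using A d by (auto simp: smooth_atlas_def is_chart_def)
    have cd: "smooth_on (snd c ` (fst c \<inter> fst d)) (in_chart c (snd d))"
      "smooth_on (snd d ` (fst c \<inter> fst d)) (in_chart d (snd c))"
      using c d by (auto simp: local_coords_def compatible_def)
    let ?S = "snd c' ` (fst c \<inter> fst d)"
    have S: "open ?S" by (rule opim[OF od])
    have "smooth_on ?S (\<lambda>x. in_chart c (snd d) (J *v x))"
      by (rule smooth_on_compose[OF cd(1) S chart_open_image[OF ch od] smooth_on_linear[OF S blJ(1)]])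
        (auto simp: im)
    then have "smooth_on ?S (in_chart c' (snd d))"
      by (rule smooth_on_cong[OF S, rotated]) (subst in', auto)
    moreover have "smooth_on (snd d ` (fst c \<inter> fst d)) (\<lambda>x. K *v in_chart d (snd c) x)"
      using chart_open_image[of d "fst c"] A d ch
      by (intro smooth_on_bounded_linear[OF blJ(2)] cd) (auto simp: smooth_atlas_def is_chart_def Int_commute)
    ultimately show "compatible c' d"
      by (simp add: compatible_def c'_def in_chart_def o_def)
  qed
  show ?thesis
  proof (rule that[OF loc])
    show "fst c' = fst c" by (simp add: c'_def)
    fix p assume p: "p \<in> fst c"
    let ?x = "snd c' p"
    have x: "?x \<in> snd c' ` fst c" using p by auto
    have "in_chart c' (snd c) x = J *v x" if "x \<in> snd c' ` fst c" for x
    proof -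
      obtain q where "q \<in> fst c" "x = K *v snd c q" using \<open>x \<in> _\<close> by (auto simp: c'_def)
      then show ?thesis using in'[OF that, of "snd c"] in_chart_apply[OF ch, of q "snd c"] by (simp add: JK)
    qed
    then have "frechet_derivative ((*v) J) (at ?x) = frechet_derivative (in_chart c' (snd c)) (at ?x)"
      using opim[of UNIV] x
      by (intro frechet_derivative_transform_within_open[of _ _ "snd c' ` fst c"])
        (auto intro!: bounded_linear_imp_differentiable blJ)
    moreover have "frechet_derivative ((*v) J) (at ?x) = (*v) J"
      using frechet_derivative_at[OF bounded_linear_imp_has_derivative[OF blJ(1)]] by metis
    ultimately have "differential c' (snd c) p = (*v) J"
      by (simp only: differential_def)
    then show "matrix (differential c' (snd c) p) = J" by simp
  qed
qed

definition gdet :: "'m chart \<Rightarrow> ('m \<Rightarrow> real^5) \<Rightarrow> 'm \<Rightarrow> real" where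
  "gdet c Y p = gram c Y p 1 1 * gram c Y p 2 2 - (gram c Y p 1 2)\<^sup>2"

text \<open>The trace of the second fundamental form with respect to the metric \<open>g\<close>, multiplied by \<open>det g\<close>.\<close>

definition gtr :: "'m chart \<Rightarrow> ('m \<Rightarrow> real^5) \<Rightarrow> 'm \<Rightarrow> real^5 \<Rightarrow> real" where
  "gtr c Y p m = gram c Y p 2 2 * sff c Y p m 1 1 - gram c Y p 1 2 * (sff c Y p m 1 2 + sff c Y p m 2 1)
     + gram c Y p 1 1 * sff c Y p m 2 2"

definition sdet :: "'m chart \<Rightarrow> ('m \<Rightarrow> real^5) \<Rightarrow> 'm \<Rightarrow> real^5 \<Rightarrow> real" where
  "sdet c Y p m = sff c Y p m 1 1 * sff c Y p m 2 2 - sff c Y p m 1 2 * sff c Y p m 2 1"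

lemma canonical_gram:
  assumes "canonical_at c Y p"
  shows "gram c Y p 1 1 = 0" "gram c Y p 2 2 = 0" "gram c Y p 1 2 = 1 / 2" "gram c Y p 2 1 = 1 / 2"
    "gdet c Y p = - 1 / 4"
proof -
  show g: "gram c Y p 1 1 = 0" "gram c Y p 2 2 = 0" "gram c Y p 1 2 = 1 / 2"
    using assms by (simp_all add: canonical_at_def gram_def)
  show "gram c Y p 2 1 = 1 / 2" using g(3) gram_commute[of c Y p 2 1] by simp
  show "gdet c Y p = - 1 / 4" unfolding gdet_def g by (simp add: power2_eq_square)
qed

text \<open>Each quantity is a quadratic determinant-type invariant of the two forms, which gives
  the common factor \<open>\<delta>\<^sup>2\<close>; the power of \<open>r\<close> counts two for
  every \<open>gram\<close> and one for every \<open>sff\<close>.\<close>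

lemma lift_change_invariants:
  fixes Y Y' :: "'m::topological_space \<Rightarrow> real^5"
  assumes A: "smooth_atlas A" and c: "local_coords A c" "local_coords A c'"
    and Y: "local_lift A y W Y" and Y': "local_lift A y W' Y'"
    and p: "p \<in> fst c" "p \<in> W" "p \<in> fst c'" "p \<in> W'"
  defines "\<delta> \<equiv> det (matrix (differential c' (snd c) p))"
  obtains r where "r \<noteq> 0" "\<delta> \<noteq> 0" "Y' p = r *\<^sub>R Y p" "gdet c' Y' p = r ^ 4 * \<delta>\<^sup>2 * gdet c Y p"
    "\<And>m. ip52 m (Y p) = 0 \<Longrightarrow> (\<And>i. ip52 m (pd c i Y p) = 0) \<Longrightarrow>
      (\<forall>a. ip52 m (pd c' a Y' p) = 0) \<and> gtr c' Y' p m = r ^ 3 * \<delta>\<^sup>2 * gtr c Y p m \<and>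
      sdet c' Y' p m = r\<^sup>2 * \<delta>\<^sup>2 * sdet c Y p m"
proof -
  define J where "J = matrix (differential c' (snd c) p)"
  obtain r where r: "r \<noteq> 0" "Y' p = r *\<^sub>R Y p"
    and g: "\<And>a b. gram c' Y' p a b = r\<^sup>2 * (\<Sum>i\<in>UNIV. \<Sum>j\<in>UNIV. J $ i $ a * J $ j $ b * gram c Y p i j)"
    and s: "\<And>m a b. ip52 m (Y p) = 0 \<Longrightarrow> (\<And>i. ip52 m (pd c i Y p) = 0) \<Longrightarrow>
        ip52 m (pd c' a Y' p) = 0 \<and>
        sff c' Y' p m a b = r * (\<Sum>i\<in>UNIV. \<Sum>j\<in>UNIV. J $ i $ a * J $ j $ b * sff c Y p m i j)"
    by (rule lift_change[OF A c Y Y' p, folded J_def]) (rule that; (assumption | blast))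
  have d0: "\<delta> \<noteq> 0" using det_transition_inverse[OF A c p(1,3)] by (auto simp: \<delta>_def)
  have \<delta>: "\<delta> = J $ 1 $ 1 * J $ 2 $ 2 - J $ 1 $ 2 * J $ 2 $ 1" by (simp add: \<delta>_def J_def det_2)
  have g21: "gram c Y p 2 1 = gram c Y p 1 2" by (rule gram_commute)
  show ?thesis
  proof (rule that[OF r(1) d0 r(2)])
    show "gdet c' Y' p = r ^ 4 * \<delta>\<^sup>2 * gdet c Y p"
      unfolding gdet_def g \<delta> sum_2 g21 by algebra
    fix m assume "ip52 m (Y p) = 0" "\<And>i. ip52 m (pd c i Y p) = 0"
    note s = s[OF this]
    have s': "sff c' Y' p m a b = r * (\<Sum>i\<in>UNIV. \<Sum>j\<in>UNIV. J $ i $ a * J $ j $ b * sff c Y p m i j)" for a b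
      using s by blast
    have "gtr c' Y' p m = r ^ 3 * \<delta>\<^sup>2 * gtr c Y p m"
      unfolding gtr_def g \<delta> sum_2 g21 s' by algebra
    moreover have "sdet c' Y' p m = r\<^sup>2 * \<delta>\<^sup>2 * sdet c Y p m"
      unfolding sdet_def \<delta> sum_2 s' by algebra
    ultimately show "(\<forall>a. ip52 m (pd c' a Y' p) = 0) \<and> gtr c' Y' p m = r ^ 3 * \<delta>\<^sup>2 * gtr c Y p m \<and>
      sdet c' Y' p m = r\<^sup>2 * \<delta>\<^sup>2 * sdet c Y p m"
      using s by blast
  qed
qed

lemma differential_eq_pd:
  assumes "smooth_on S (in_chart c f)" "snd c p \<in> S"
  shows "differential c f p h = (\<Sum>i\<in>UNIV. h $ i *\<^sub>R pd c i f p)"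
  unfolding differential_def frechet_derivative_2[OF assms] pd_eq_pdiff ..

text \<open>\<open>timelike_surface\<close> quantifies over all lifts and all atlas charts. The sign
  of \<open>gdet\<close> is the same for all of them, so a single explicit lift decides.\<close>

lemma timelike_of_gdet:
  fixes Y Y' :: "'m::topological_space \<Rightarrow> real^5"
  assumes A: "smooth_atlas A" and c: "local_coords A c" "local_coords A c'"
    and Y: "local_lift A y W Y" and Y': "local_lift A y W' Y'"
    and p: "p \<in> fst c" "p \<in> W" "p \<in> fst c'" "p \<in> W'" and neg: "gdet c Y p < 0"
  shows "differential c' Y' p h \<in> span {Y' p} \<Longrightarrow> h = 0"
    and "lorentzian (\<lambda>h k. ip52 (differential c' Y' p h) (differential c' Y' p k))"
proof -
  define g where "g = gram c' Y' p"
  have neg': "g 1 1 * g 2 2 - (g 1 2)\<^sup>2 < 0"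
  proof -
    obtain r where "r \<noteq> 0" "det (matrix (differential c' (snd c) p)) \<noteq> 0"
      "gdet c' Y' p = r ^ 4 * (det (matrix (differential c' (snd c) p)))\<^sup>2 * gdet c Y p"
      by (rule lift_change_invariants[OF A c Y Y' p]) (rule that; (assumption | blast))
    moreover have "r ^ 4 * (det (matrix (differential c' (snd c) p)))\<^sup>2 > 0"
      using calculation by (simp add: zero_less_mult_iff zero_less_power_eq)
    ultimately show ?thesis using neg by (simp add: gdet_def g_def mult_pos_neg)
  qed
  have sym: "g 2 1 = g 1 2" unfolding g_def by (rule gram_commute)
  have dif: "differential c' Y' p h = (\<Sum>i\<in>UNIV. h $ i *\<^sub>R pd c' i Y' p)" for h
    by (rule differential_eq_pd[OF smooth_on_in_chart[OF A c(2) local_liftD(1,2)[OF Y']]]) (use p in auto)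
  have form: "ip52 (differential c' Y' p h) (differential c' Y' p k) =
      (\<Sum>i\<in>UNIV. \<Sum>j\<in>UNIV. h $ i * k $ j * g i j)" for h k
    unfolding dif g_def gram_def by (simp add: sum_2 sprod_simps algebra_simps)
  show "h = 0" if span: "differential c' Y' p h \<in> span {Y' p}"
  proof -
    obtain k where k: "differential c' Y' p h = k *\<^sub>R Y' p" using span by (auto simp: span_singleton)
    have "ip52 (differential c' Y' p h) (pd c' j Y' p) = 0" for j
      unfolding k using lift_derivatives(1)[OF A c(2) Y' p(3,4), of j] by (simp add: sprod_simps sprod_commute)
    then have e: "h $ 1 * g 1 j + h $ 2 * g 2 j = 0" for j
      unfolding dif by (simp add: sum_2 sprod_simps g_def gram_def)
    have "h $ 1 * (g 1 1 * g 2 2 - (g 1 2)\<^sup>2) = 0" "h $ 2 * (g 1 1 * g 2 2 - (g 1 2)\<^sup>2) = 0"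
      using e[of 1] e[of 2] sym by algebra+
    then show "h = 0" using neg' by (simp add: vec_eq_iff forall_2)
  qed
  obtain \<alpha> \<beta> :: "real^2" where ab: "(\<Sum>i\<in>UNIV. \<Sum>j\<in>UNIV. \<alpha> $ i * \<alpha> $ j * g i j) = 0"
    "(\<Sum>i\<in>UNIV. \<Sum>j\<in>UNIV. \<beta> $ i * \<beta> $ j * g i j) = 0" "(\<Sum>i\<in>UNIV. \<Sum>j\<in>UNIV. \<alpha> $ i * \<beta> $ j * g i j) = 1 / 2"
    by (rule null_basis[OF sym neg'])
  show "lorentzian (\<lambda>h k. ip52 (differential c' Y' p h) (differential c' Y' p k))"
    unfolding lorentzian_def form
    by (rule exI[of _ "\<alpha> + \<beta>"], rule exI[of _ "\<alpha> - \<beta>"])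
      (use ab sym in \<open>simp add: sum_2 algebra_simps\<close>)
qed

text \<open>Since \<open>willmore_density\<close> asks for canonical data at the point alone, no
  null directions have to be integrated: a linear change to a null basis is enough.\<close>

lemma canonical_coords_exist:
  assumes A: "smooth_atlas A" and c: "local_coords A c" and Y: "local_lift A y W Y"
    and p: "p \<in> fst c" "p \<in> W" and neg: "gdet c Y p < 0"
  obtains c' where "local_coords A c'" "p \<in> fst c'" "canonical_at c' Y p"
proof -
  obtain \<alpha> \<beta> :: "real^2" where ab: "(\<Sum>i\<in>UNIV. \<Sum>j\<in>UNIV. \<alpha> $ i * \<alpha> $ j * gram c Y p i j) = 0"
    "(\<Sum>i\<in>UNIV. \<Sum>j\<in>UNIV. \<beta> $ i * \<beta> $ j * gram c Y p i j) = 0"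
    "(\<Sum>i\<in>UNIV. \<Sum>j\<in>UNIV. \<alpha> $ i * \<beta> $ j * gram c Y p i j) = 1 / 2"
    by (rule null_basis[OF gram_commute neg[unfolded gdet_def]])
  define J :: "real^2^2" where "J = (\<chi> i a. if a = 1 then \<alpha> $ i else \<beta> $ i)"
  have g21: "gram c Y p 2 1 = gram c Y p 1 2" by (rule gram_commute)
  have "(det J)\<^sup>2 * gdet c Y p = - 1 / 4"
  proof -
    have "(det J)\<^sup>2 * gdet c Y p =
      (\<Sum>i\<in>UNIV. \<Sum>j\<in>UNIV. \<alpha> $ i * \<alpha> $ j * gram c Y p i j) * (\<Sum>i\<in>UNIV. \<Sum>j\<in>UNIV. \<beta> $ i * \<beta> $ j * gram c Y p i j)
      - (\<Sum>i\<in>UNIV. \<Sum>j\<in>UNIV. \<alpha> $ i * \<beta> $ j * gram c Y p i j)\<^sup>2"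
      by (simp add: J_def det_2 gdet_def sum_2 g21) algebra
    then show ?thesis unfolding ab by (simp add: power2_eq_square)
  qed
  then have "det J \<noteq> 0" by auto
  then have "invertible J" by (simp add: invertible_det_nz)
  then obtain c' where c': "local_coords A c'" "fst c' = fst c"
    "\<And>p. p \<in> fst c \<Longrightarrow> matrix (differential c' (snd c) p) = J"
    using linear_chart[OF A c] by metis
  have p': "p \<in> fst c'" using p c' by simp
  obtain r where r: "Y p = r *\<^sub>R Y p"
    and g: "\<And>a b. gram c' Y p a b = r\<^sup>2 * (\<Sum>i\<in>UNIV. \<Sum>j\<in>UNIV. J $ i $ a * J $ j $ b * gram c Y p i j)"
    by (rule lift_change[OF A c c'(1) Y Y p p' p(2), unfolded c'(3)[OF p(1)]]) (rule that; (assumption | blast))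
  \<comment> \<open>Only the coordinates were changed, so the factor between the lifts is 1.\<close>
  have "(r - 1) *\<^sub>R Y p = 0" using r by (simp add: algebra_simps)
  then have "r = 1" using local_liftD(3)[OF Y p(2)] by simp
  then have "gram c' Y p 1 1 = 0" "gram c' Y p 2 2 = 0" "gram c' Y p 1 2 = 1 / 2"
    using ab by (simp_all add: g J_def)
  then have "canonical_at c' Y p" by (simp add: canonical_at_def gram_def)
  then show ?thesis using that c' p' by blast
qed

section \<open>The Hopf differentials and the Willmore density\<close>

lemma V_perp_iff:
  "m \<in> V_perp c Y p \<longleftrightarrow> ip52 m (Y p) = 0 \<and> (\<forall>i. ip52 m (pd c i Y p) = 0) \<and> sff c Y p m 2 1 = 0"
proof
  assume m: "m \<in> V_perp c Y p"
  have *: "ip52 m w = 0" if "w \<in> {Y p, pd c 1 Y p, pd c 2 Y p, pd c 2 (pd c 1 Y) p}" for w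
    using m span_base[OF that] unfolding V_perp_def V_space_def by blast
  then show "ip52 m (Y p) = 0 \<and> (\<forall>i. ip52 m (pd c i Y p) = 0) \<and> sff c Y p m 2 1 = 0"
    by (simp add: sff_def sprod_commute[of "{4, 5}" "pd c 2 (pd c 1 Y) p" m] forall_2)
next
  assume m: "ip52 m (Y p) = 0 \<and> (\<forall>i. ip52 m (pd c i Y p) = 0) \<and> sff c Y p m 2 1 = 0"
  have "ip52 m w = 0" if "w \<in> span {Y p, pd c 1 Y p, pd c 2 Y p, pd c 2 (pd c 1 Y) p}" for w
    using that m
    by (induction rule: span_induct_alt)
      (auto simp: sprod_simps sff_def sprod_commute[of "{4, 5}" "pd c 2 (pd c 1 Y) p" m])
  then show "m \<in> V_perp c Y p" unfolding V_perp_def V_space_def by blast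
qed

lemma canonical_null_frame:
  assumes "smooth_atlas A" "local_coords A c" "local_lift A y W Y" "p \<in> fst c" "p \<in> W" "canonical_at c Y p"
  shows "null_frame (Y p) (pd c 1 Y p) (pd c 2 Y p) (pd c 2 (pd c 1 Y) p)"
  using lift_derivatives[OF assms(1-5)] local_liftD(4)[OF assms(3,5)] canonical_gram[OF assms(6)]
  by (simp add: null_frame_def gram_def sprod_commute)

text \<open>This nondegeneracy of \<open>V\<close> is what makes the definite description in
  \<open>hopf\<close> unique.\<close>

lemma null_frame_span_perp:
  assumes fr: "null_frame Y A B C" and d: "d \<in> span {Y, A, B, C}"
    "ip52 d Y = 0" "ip52 d A = 0" "ip52 d B = 0" "ip52 d C = 0"
  shows "d = 0"
proof -
  obtain a1 a2 a3 a4 where e: "d = a1 *\<^sub>R Y + a2 *\<^sub>R A + a3 *\<^sub>R B + a4 *\<^sub>R C"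
  proof -
    obtain a1 a2 a3 a4 where "d - a1 *\<^sub>R Y - a2 *\<^sub>R A - a3 *\<^sub>R B - a4 *\<^sub>R C = 0"
      using d(1) by (auto simp: span_insert)
    then show ?thesis by (intro that[of a1 a2 a3 a4]) (simp add: algebra_simps)
  qed
  have F: "ip52 Y Y = 0" "ip52 Y A = 0" "ip52 Y B = 0" "ip52 A A = 0" "ip52 B B = 0" "ip52 A B = 1 / 2"
    "ip52 Y C = - 1 / 2" "ip52 A Y = 0" "ip52 B Y = 0" "ip52 B A = 1 / 2" "ip52 C Y = - 1 / 2"
    using fr sprod_commute[of "{4, 5}" A Y] sprod_commute[of "{4, 5}" B Y] sprod_commute[of "{4, 5}" B A]
      sprod_commute[of "{4, 5}" C Y] by (simp_all add: null_frame_def)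
  have 4: "a4 = 0" using d(2) by (simp add: e sprod_simps F)
  have 3: "a3 = 0" using d(3) 4 by (simp add: e sprod_simps F)
  have 2: "a2 = 0" using d(4) 4 by (simp add: e sprod_simps F)
  have 1: "a1 = 0" using d(5) 4 3 2 by (simp add: e sprod_simps F)
  show ?thesis by (simp add: e 1 2 3 4)
qed

lemma hopf_eqI:
  assumes L: "smooth_atlas A" "local_coords A c" "local_lift A y W Y" "p \<in> fst c" "p \<in> W" "canonical_at c Y p"
    and k: "k \<in> V_perp c Y p" "pd c i (pd c i Y) p - k \<in> V_space c Y p"
  shows "hopf c Y i p = k"
  unfolding hopf_def
proof (rule the_equality)
  fix l assume l: "l \<in> V_perp c Y p \<and> pd c i (pd c i Y) p - l \<in> V_space c Y p"
  have "(pd c i (pd c i Y) p - k) - (pd c i (pd c i Y) p - l) \<in> V_space c Y p"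
    using k l span_diff unfolding V_space_def by blast
  then have "l - k \<in> V_space c Y p" by simp
  moreover have "l - k \<in> V_perp c Y p" using k l by (simp add: V_perp_def sprod_simps)
  ultimately have "l - k = 0"
    by (intro null_frame_span_perp[OF canonical_null_frame[OF L]])
      (auto simp: V_perp_def V_space_def span_base)
  then show "l = k" by simp
qed (use k in simp)

lemma hopf_eq:
  assumes L: "smooth_atlas A" "local_coords A c" "local_lift A y W Y" "p \<in> fst c" "p \<in> W" "canonical_at c Y p"
    and nu: "\<nu> \<in> V_perp c Y p" "\<nu> \<noteq> 0"
  shows "hopf c Y i p = (sff c Y p \<nu> i i / ip52 \<nu> \<nu>) *\<^sub>R \<nu>"
proof (rule hopf_eqI[OF L])
  note fr = canonical_null_frame[OF L]
  have perp: "ip52 \<nu> (Y p) = 0" "ip52 \<nu> (pd c 1 Y p) = 0" "ip52 \<nu> (pd c 2 Y p) = 0" "ip52 \<nu> (pd c 2 (pd c 1 Y) p) = 0"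
    using nu by (auto simp: V_perp_iff sff_def sprod_commute)
  have pos: "ip52 \<nu> \<nu> > 0" by (rule null_frame_normal_pos[OF fr nu(2) perp])
  let ?w = "pd c i (pd c i Y) p"
  obtain a where a: "?w = a $ 1 *\<^sub>R Y p + a $ 2 *\<^sub>R pd c 1 Y p + a $ 3 *\<^sub>R pd c 2 Y p +
      a $ 4 *\<^sub>R pd c 2 (pd c 1 Y) p + a $ (5::5) *\<^sub>R \<nu>"
    using null_frame_basis[OF fr nu(2) perp, of ?w] by blast
  have "ip52 \<nu> ?w = a $ 5 * ip52 \<nu> \<nu>" unfolding a by (simp add: sprod_simps perp)
  then have a5: "sff c Y p \<nu> i i / ip52 \<nu> \<nu> = a $ 5" using pos by (simp add: sff_def sprod_commute)
  have "?w - a $ 5 *\<^sub>R \<nu> = a $ 1 *\<^sub>R Y p + a $ 2 *\<^sub>R pd c 1 Y p + a $ 3 *\<^sub>R pd c 2 Y p + a $ 4 *\<^sub>R pd c 2 (pd c 1 Y) p"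
    unfolding a by simp
  also have "\<dots> \<in> V_space c Y p"
    unfolding V_space_def by (intro span_add span_scale span_base) auto
  finally have inV: "?w - a $ 5 *\<^sub>R \<nu> \<in> V_space c Y p" .
  moreover have "a $ 5 *\<^sub>R \<nu> \<in> V_perp c Y p"
    using nu(1) by (simp add: V_perp_def sprod_simps)
  ultimately show "(sff c Y p \<nu> i i / ip52 \<nu> \<nu>) *\<^sub>R \<nu> \<in> V_perp c Y p"
    "?w - (sff c Y p \<nu> i i / ip52 \<nu> \<nu>) *\<^sub>R \<nu> \<in> V_space c Y p"
    unfolding a5 by simp_all
qed

text \<open>For canonical data \<open>gtr\<close> equals minus the mixed coefficient of
  \<open>sff\<close>, so orthogonality to \<open>Y_uv\<close> is vanishing of the trace. In this
  form the condition is visibly independent of the coordinates and the lift.\<close>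

lemma V_perp_canonical_iff:
  assumes L: "smooth_atlas A" "local_coords A c" "local_lift A y W Y" "p \<in> fst c" "p \<in> W" "canonical_at c Y p"
  shows "m \<in> V_perp c Y p \<longleftrightarrow> ip52 m (Y p) = 0 \<and> (\<forall>i. ip52 m (pd c i Y p) = 0) \<and> gtr c Y p m = 0"
  using canonical_gram[OF L(6)] sff_commute[OF L(1-5), of m 1 2]
  by (simp add: V_perp_iff gtr_def)

lemma V_perp_change:
  assumes A: "smooth_atlas A" and c: "local_coords A c" "local_coords A c'"
    and Y: "local_lift A y W Y" and Y': "local_lift A y W' Y'"
    and p: "p \<in> fst c" "p \<in> W" "p \<in> fst c'" "p \<in> W'" and can: "canonical_at c Y p" "canonical_at c' Y' p"
    and m: "m \<in> V_perp c Y p"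
  shows "m \<in> V_perp c' Y' p"
proof -
  have m: "ip52 m (Y p) = 0" "\<And>i. ip52 m (pd c i Y p) = 0" "gtr c Y p m = 0"
    using m V_perp_canonical_iff[OF A c(1) Y p(1,2) can(1)] by auto
  obtain r where "Y' p = r *\<^sub>R Y p" "(\<forall>a. ip52 m (pd c' a Y' p) = 0)" "gtr c' Y' p m = 0"
  proof (rule lift_change_invariants[OF A c Y Y' p])
    fix r \<delta> assume r: "Y' p = r *\<^sub>R Y p"
      and m': "\<And>m. ip52 m (Y p) = 0 \<Longrightarrow> (\<And>i. ip52 m (pd c i Y p) = 0) \<Longrightarrow>
      (\<forall>a. ip52 m (pd c' a Y' p) = 0) \<and> gtr c' Y' p m = r ^ 3 * (det (matrix (differential c' (snd c) p)))\<^sup>2 * gtr c Y p m \<and>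
      sdet c' Y' p m = r\<^sup>2 * (det (matrix (differential c' (snd c) p)))\<^sup>2 * sdet c Y p m"
    show thesis using m'[OF m(1,2)] m(3) by (intro that[OF r]) auto
  qed
  then show ?thesis
    using V_perp_canonical_iff[OF A c(2) Y' p(3,4) can(2)] m by (simp add: sprod_simps)
qed

text \<open>\<open>det b\<^sub>0 / sqrt (- det g)\<close> for the trace-free part \<open>b\<^sub>0\<close> of the second fundamental form of the unit
  normal, where \<open>det b\<^sub>0 = det b - (tr b / 2)\<^sup>2 det g\<close>. It is invariant under \<open>\<nu> \<mapsto> \<nu> + a Y\<close>.\<close>

definition wdens :: "'m chart \<Rightarrow> ('m \<Rightarrow> real^5) \<Rightarrow> real^5 \<Rightarrow> 'm \<Rightarrow> real" where
  "wdens c Y \<nu> p = (sdet c Y p \<nu> - (gtr c Y p \<nu>)\<^sup>2 / (4 * gdet c Y p)) / (ip52 \<nu> \<nu> * sqrt (- gdet c Y p))"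

lemma hopf_product_eq_wdens:
  fixes Y Y' :: "'m::topological_space \<Rightarrow> real^5"
  assumes A: "smooth_atlas A" and c: "local_coords A c" "local_coords A c'"
    and Y: "local_lift A y W Y" and Y': "local_lift A y W' Y'"
    and p: "p \<in> fst c" "p \<in> W" "p \<in> fst c'" "p \<in> W'" and can: "canonical_at c' Y' p"
    and nu: "ip52 \<nu> (Y p) = 0" "\<And>i. ip52 \<nu> (pd c i Y p) = 0" "ip52 \<nu> \<nu> \<noteq> 0"
  shows "2 * ip52 (hopf c' Y' 1 p) (hopf c' Y' 2 p) * \<bar>det (matrix (differential c (snd c') p))\<bar> = wdens c Y \<nu> p"
proof -
  define \<delta> where "\<delta> = det (matrix (differential c' (snd c) p))"
  obtain r where r: "r \<noteq> 0" "\<delta> \<noteq> 0" "Y' p = r *\<^sub>R Y p" "gdet c' Y' p = r ^ 4 * \<delta>\<^sup>2 * gdet c Y p"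
    and nu': "\<forall>a. ip52 \<nu> (pd c' a Y' p) = 0" "gtr c' Y' p \<nu> = r ^ 3 * \<delta>\<^sup>2 * gtr c Y p \<nu>"
      "sdet c' Y' p \<nu> = r\<^sup>2 * \<delta>\<^sup>2 * sdet c Y p \<nu>"
  proof (rule lift_change_invariants[OF A c Y Y' p, folded \<delta>_def])
    fix r assume r: "r \<noteq> 0" "\<delta> \<noteq> 0" "Y' p = r *\<^sub>R Y p" "gdet c' Y' p = r ^ 4 * \<delta>\<^sup>2 * gdet c Y p"
      and m: "\<And>m. ip52 m (Y p) = 0 \<Longrightarrow> (\<And>i. ip52 m (pd c i Y p) = 0) \<Longrightarrow>
      (\<forall>a. ip52 m (pd c' a Y' p) = 0) \<and> gtr c' Y' p m = r ^ 3 * \<delta>\<^sup>2 * gtr c Y p m \<and>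
      sdet c' Y' p m = r\<^sup>2 * \<delta>\<^sup>2 * sdet c Y p m"
    show thesis using m[OF nu(1,2)] by (intro that[OF r]) auto
  qed
  have nuY': "ip52 \<nu> (Y' p) = 0" using nu r by (simp add: sprod_simps)
  have YY: "ip52 (Y' p) (Y' p) = 0" using local_liftD(4)[OF Y' p(4)] .
  note can_gram = canonical_gram[OF can]
  note ld = lift_derivatives[OF A c(2) Y' p(3,4)]
  \<comment> \<open>As \<open>ip52 (Y' p)\<close> of the mixed second derivative is -1/2, this
    multiple of \<open>Y'\<close> makes the normal orthogonal to it, without affecting the diagonal
    coefficients, because the diagonal of \<open>gram\<close> is zero.\<close>
  define \<nu>' where "\<nu>' = \<nu> + (2 * sff c' Y' p \<nu> 2 1) *\<^sub>R Y' p"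
  have sff': "sff c' Y' p \<nu>' i j = sff c' Y' p \<nu> i j - 2 * sff c' Y' p \<nu> 2 1 * gram c' Y' p i j" for i j
    using ld(2)[of i j] by (simp add: sff_def \<nu>'_def sprod_simps)
  have "\<nu>' \<in> V_perp c' Y' p"
    unfolding V_perp_iff using nuY' nu'(1) YY ld(1)
    by (simp add: sff' can_gram) (simp add: \<nu>'_def sprod_simps sprod_commute)
  moreover have norm: "ip52 \<nu>' \<nu>' = ip52 \<nu> \<nu>"
    using nuY' YY by (simp add: \<nu>'_def sprod_simps sprod_commute)
  moreover have "\<nu>' \<noteq> 0" using nu(3) norm by (auto simp: sprod_simps)
  ultimately have hopf: "hopf c' Y' i p = (sff c' Y' p \<nu> i i / ip52 \<nu> \<nu>) *\<^sub>R \<nu>'" for i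
    using hopf_eq[OF A c(2) Y' p(3,4) can, of \<nu>' i] can_gram exhaust_2[of i] by (auto simp: sff')
  have sym: "sff c' Y' p \<nu> 2 1 = sff c' Y' p \<nu> 1 2" by (rule sff_commute[OF A c(2) Y' p(3,4)])
  define G where "G = gdet c Y p"
  have G: "r ^ 4 * \<delta>\<^sup>2 * G = - 1 / 4" using r(4) can_gram(5) by (simp add: G_def)
  then have "G \<noteq> 0" by auto
  have "r ^ 4 * \<delta>\<^sup>2 > 0" using r by (simp add: zero_less_mult_iff zero_less_power_eq)
  then have Gneg: "G < 0" using G by (metis divide_neg_pos less_numeral_extra(1) mult_nonneg_nonneg neg_less_0_iff_less not_le order_less_imp_le zero_less_numeral)
  have "2 * ip52 (hopf c' Y' 1 p) (hopf c' Y' 2 p) = 2 * (sff c' Y' p \<nu> 1 1 * sff c' Y' p \<nu> 2 2) / ip52 \<nu> \<nu>"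
    unfolding hopf using nu(3) by (simp add: sprod_simps norm)
  \<comment> \<open>For canonical data \<open>gtr\<close> is minus the mixed coefficient, so its
    square restores what \<open>sdet\<close> subtracts.\<close>
  also have "sff c' Y' p \<nu> 1 1 * sff c' Y' p \<nu> 2 2 = sdet c' Y' p \<nu> + (gtr c' Y' p \<nu>)\<^sup>2"
    by (simp add: sdet_def gtr_def can_gram sym power2_eq_square)
  also have "\<dots> = r\<^sup>2 * \<delta>\<^sup>2 * (sdet c Y p \<nu> + r ^ 4 * \<delta>\<^sup>2 * (gtr c Y p \<nu>)\<^sup>2)"
    unfolding nu' by algebra
  also have "r ^ 4 * \<delta>\<^sup>2 = - 1 / (4 * G)" using G \<open>G \<noteq> 0\<close> by (simp add: field_simps)
  finally have 1: "2 * ip52 (hopf c' Y' 1 p) (hopf c' Y' 2 p) =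
      2 * (r\<^sup>2 * \<delta>\<^sup>2 * (sdet c Y p \<nu> - (gtr c Y p \<nu>)\<^sup>2 / (4 * G))) / ip52 \<nu> \<nu>" by simp
  \<comment> \<open>The relation between the two values of \<open>gdet\<close> ties the remaining
    powers of \<open>r\<close> and \<open>\<delta>\<close> to \<open>G\<close>; this is the origin
    of the square root in \<open>wdens\<close>.\<close>
  have "(2 * r\<^sup>2 * \<bar>\<delta>\<bar> * sqrt (- G))\<^sup>2 = 1\<^sup>2"
  proof -
    have "(2 * r\<^sup>2 * \<bar>\<delta>\<bar> * sqrt (- G))\<^sup>2 = - 4 * (r ^ 4 * \<delta>\<^sup>2 * G)"
      using Gneg by (simp add: power_mult_distrib flip: power_mult)
    then show ?thesis using G by simp
  qed
  then have "2 * r\<^sup>2 * \<bar>\<delta>\<bar> * sqrt (- G) = 1"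
    by (rule power2_eq_imp_eq) (use Gneg in auto)
  then have 2: "2 * r\<^sup>2 * \<bar>\<delta>\<bar> = 1 / sqrt (- G)" using Gneg by (simp add: field_simps)
  have "\<delta> * det (matrix (differential c (snd c') p)) = 1"
    using det_transition_inverse[OF A c p(1,3)] by (simp add: \<delta>_def)
  then have "det (matrix (differential c (snd c') p)) = 1 / \<delta>" using r by (simp add: field_simps)
  then have det_abs: "\<bar>det (matrix (differential c (snd c') p))\<bar> = 1 / \<bar>\<delta>\<bar>"
    by simp
  have abs\<delta>: "\<delta>\<^sup>2 * \<bar>det (matrix (differential c (snd c') p))\<bar> = \<bar>\<delta>\<bar>"
    using r(2) by (cases "\<delta> > 0") (simp_all add: det_abs power2_eq_square)
  have "2 * ip52 (hopf c' Y' 1 p) (hopf c' Y' 2 p) * \<bar>det (matrix (differential c (snd c') p))\<bar> =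
     (2 * r\<^sup>2 * \<bar>\<delta>\<bar>) * (sdet c Y p \<nu> - (gtr c Y p \<nu>)\<^sup>2 / (4 * G)) / ip52 \<nu> \<nu>"
    unfolding 1 abs\<delta>[symmetric] by simp
  also have "\<dots> = wdens c Y \<nu> p" unfolding 2 by (simp add: wdens_def G_def)
  finally show ?thesis .
qed

text \<open>All admissible choices in \<open>willmore_density\<close> give the same number by
  \<open>hopf_product_eq_wdens\<close> and the cocycle rule, and
  \<open>canonical_coords_exist\<close> provides one.\<close>

lemma willmore_density_eq:
  fixes Y :: "'m::topological_space \<Rightarrow> real^5"
  assumes A: "smooth_atlas A" and c: "local_coords A c" and d: "local_coords A d" and Y: "local_lift A y W Y"
    and p: "p \<in> fst c" "p \<in> W" "p \<in> fst d" and neg: "gdet c Y p < 0"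
    and nu: "ip52 \<nu> (Y p) = 0" "\<And>i. ip52 \<nu> (pd c i Y p) = 0" "ip52 \<nu> \<nu> \<noteq> 0"
  shows "willmore_density A y d p = wdens c Y \<nu> p * \<bar>det (matrix (differential d (snd c) p))\<bar>"
proof -
  have *: "2 * ip52 (hopf c' Y' 1 p) (hopf c' Y' 2 p) * \<bar>det (matrix (differential d (snd c') p))\<bar> =
      wdens c Y \<nu> p * \<bar>det (matrix (differential d (snd c) p))\<bar>"
    if "local_coords A c'" "local_lift A y W' Y'" "p \<in> fst c'" "p \<in> W'" "canonical_at c' Y' p" for c' W' Y'
    unfolding hopf_product_eq_wdens[OF A c that(1) Y that(2) p(1,2) that(3,4,5) nu, symmetric]
      det_transition_cocycle[OF A that(1) c d that(3) p(1,3)]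
    by (simp add: abs_mult)
  obtain c' where "local_coords A c'" "p \<in> fst c'" "canonical_at c' Y p"
    using canonical_coords_exist[OF A c Y p(1,2) neg] by metis
  with * Y p show ?thesis
    unfolding willmore_density_def by (intro the_equality) (metis IntI, metis IntE)
qed

section \<open>The moving frame of a canonical lift\<close>

lemma other_index: "i \<noteq> j \<Longrightarrow> l = i \<or> l = j" for i j l :: 2
  by (metis exhaust_2)

lemma ex_other: "\<exists>j::2. i \<noteq> j"
  by (cases "i = 1") (auto intro: exI[of _ 2])

text \<open>The surface read in asymptotic coordinates, as a map on the plane with metric
  \<open>du dv\<close>. Indices \<open>i \<noteq> j\<close> stand for \<open>u\<close> and
  \<open>v\<close> in either order, so that each identity is proved once for both.\<close>

locale canonical_param =
  fixes \<Omega> :: "(real^2) set" and Y :: "real^2 \<Rightarrow> real^5"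
  assumes open_\<Omega>: "open \<Omega>" and smooth_Y: "smooth_on \<Omega> Y"
    and YY: "x \<in> \<Omega> \<Longrightarrow> ip52 (Y x) (Y x) = 0"
    and dYdY: "x \<in> \<Omega> \<Longrightarrow> ip52 (pdiff i Y x) (pdiff i Y x) = 0"
    and dYdY': "x \<in> \<Omega> \<Longrightarrow> i \<noteq> j \<Longrightarrow> ip52 (pdiff i Y x) (pdiff j Y x) = 1 / 2"
begin

text \<open>These are the functions \<open>s\<^sub>1, s\<^sub>2\<close>, since \<open>\<langle>Y\<^sub>u\<^sub>u, Y\<^sub>u\<^sub>v\<rangle> = - (s\<^sub>1 / 2) \<langle>Y, Y\<^sub>u\<^sub>v\<rangle> = s\<^sub>1 / 4\<close>.\<close>

definition s :: "2 \<Rightarrow> real^2 \<Rightarrow> real" where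
  "s i x = 4 * ip52 (pdiff i (pdiff i Y) x) (pdiff 2 (pdiff 1 Y) x)"

lemma smooth_dY: "smooth_on \<Omega> (pdiff i Y)" and smooth_ddY: "smooth_on \<Omega> (pdiff i (pdiff j Y))"
  by (intro smooth_intros smooth_Y open_\<Omega>)+

lemma smooth_s: "smooth_on \<Omega> (s i)"
  unfolding s_def[abs_def] by (intro smooth_intros smooth_Y open_\<Omega>)

lemma mixed: "x \<in> \<Omega> \<Longrightarrow> i \<noteq> j \<Longrightarrow> pdiff i (pdiff j Y) x = pdiff 2 (pdiff 1 Y) x"
  using exhaust_2[of i] exhaust_2[of j] pdiff_commute[OF open_\<Omega> smooth_Y, of x 1 2] by auto

lemma D_sprod:
  "smooth_on \<Omega> f \<Longrightarrow> smooth_on \<Omega> g \<Longrightarrow> x \<in> \<Omega> \<Longrightarrow>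
    pdiff i (\<lambda>x. ip52 (f x) (g x)) x = ip52 (f x) (pdiff i g x) + ip52 (pdiff i f x) (g x)"
  by (rule pdiff_sprod)

lemma D_sprod_const:
  assumes "\<And>x. x \<in> \<Omega> \<Longrightarrow> ip52 (f x) (g x) = a" "smooth_on \<Omega> f" "smooth_on \<Omega> g" "x \<in> \<Omega>"
  shows "ip52 (pdiff i f x) (g x) = - ip52 (f x) (pdiff i g x)"
proof -
  have "pdiff i (\<lambda>x. ip52 (f x) (g x)) x = 0"
    by (rule pdiff_const_on[OF open_\<Omega> assms(1) assms(4)])
  then show ?thesis using D_sprod[OF assms(2-4)] by simp
qed

lemma dY_Y: "x \<in> \<Omega> \<Longrightarrow> ip52 (pdiff i Y x) (Y x) = 0"
  by (rule null_lift_derivatives(1)[OF open_\<Omega> smooth_Y YY])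

lemma ddY_Y: "x \<in> \<Omega> \<Longrightarrow> ip52 (pdiff i (pdiff j Y) x) (Y x) = - ip52 (pdiff i Y x) (pdiff j Y x)"
  by (rule null_lift_derivatives(2)[OF open_\<Omega> smooth_Y YY])

text \<open>The metric has constant coefficients in these coordinates, hence its Christoffel symbols
  vanish.\<close>

lemma ddY_dY: "x \<in> \<Omega> \<Longrightarrow> ip52 (pdiff i (pdiff j Y) x) (pdiff l Y x) = 0"
proof -
  have 1: "ip52 (pdiff i (pdiff j Y) x) (pdiff j Y x) = 0" if "x \<in> \<Omega>" for i j x
  proof -
    have "ip52 (pdiff i (pdiff j Y) x) (pdiff j Y x) = - ip52 (pdiff j Y x) (pdiff i (pdiff j Y) x)"
      by (rule D_sprod_const[OF dYdY smooth_dY smooth_dY that])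
    then show ?thesis by (simp add: sprod_commute)
  qed
  have 2: "ip52 (pdiff i (pdiff j Y) x) (pdiff i Y x) = 0" if "x \<in> \<Omega>" for i j x
    using 1[OF that, of j i] pdiff_commute[OF open_\<Omega> smooth_Y that, of i j] by simp
  have 3: "ip52 (pdiff i (pdiff i Y) x) (pdiff l Y x) = 0" if "x \<in> \<Omega>" "i \<noteq> l" for i l x
  proof -
    have "ip52 (pdiff i (pdiff i Y) x) (pdiff l Y x) = - ip52 (pdiff i Y x) (pdiff i (pdiff l Y) x)"
      by (rule D_sprod_const[OF dYdY'[OF _ that(2)] smooth_dY smooth_dY that(1)])
    then show ?thesis using 2[OF that(1), of i l] by (simp add: sprod_commute)
  qed
  show "x \<in> \<Omega> \<Longrightarrow> ip52 (pdiff i (pdiff j Y) x) (pdiff l Y x) = 0"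
    using 1[of x i j] 2[of x i j] 3[of x i l] other_index[of i j l] by (cases "i = j"; cases "i = l"; cases "j = l") auto
qed

lemma frame: "x \<in> \<Omega> \<Longrightarrow> i \<noteq> j \<Longrightarrow> null_frame (Y x) (pdiff i Y x) (pdiff j Y x) (pdiff i (pdiff j Y) x)"
  unfolding null_frame_def
  using YY dY_Y ddY_Y[of x i j] dYdY dYdY' by (simp add: sprod_commute)

lemma ddY_mixed: "x \<in> \<Omega> \<Longrightarrow> i \<noteq> j \<Longrightarrow> ip52 (pdiff l (pdiff l Y) x) (pdiff i (pdiff j Y) x) = s l x / 4"
  using mixed[of x i j] by (simp add: s_def)

end

locale canonical_patch = canonical_param +
  fixes n :: "real^2 \<Rightarrow> real^5"
  assumes smooth_n: "smooth_on \<Omega> n"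
    and nn: "x \<in> \<Omega> \<Longrightarrow> ip52 (n x) (n x) = 1"
    and nY: "x \<in> \<Omega> \<Longrightarrow> ip52 (n x) (Y x) = 0"
    and ndY: "x \<in> \<Omega> \<Longrightarrow> ip52 (n x) (pdiff i Y x) = 0"
    and nddY: "x \<in> \<Omega> \<Longrightarrow> i \<noteq> j \<Longrightarrow> ip52 (n x) (pdiff i (pdiff j Y) x) = 0"
begin

definition K :: "2 \<Rightarrow> real^2 \<Rightarrow> real" where
  "K i x = ip52 (pdiff i (pdiff i Y) x) (n x)"

lemmas smooth_patch = smooth_Y smooth_n open_\<Omega>

lemma smooth_K: "smooth_on \<Omega> (K i)"
  unfolding K_def[abs_def] by (intro smooth_intros smooth_patch)

lemma vector_eqI:
  assumes "x \<in> \<Omega>" "i \<noteq> j"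
    "ip52 a (Y x) = ip52 b (Y x)" "ip52 a (pdiff i Y x) = ip52 b (pdiff i Y x)"
    "ip52 a (pdiff j Y x) = ip52 b (pdiff j Y x)"
    "ip52 a (pdiff i (pdiff j Y) x) = ip52 b (pdiff i (pdiff j Y) x)" "ip52 a (n x) = ip52 b (n x)"
  shows "a = b"
proof -
  have "n x \<noteq> 0" using nn[OF assms(1)] by (auto simp: sprod_simps)
  then have "a - b = 0"
    using assms nY ndY nddY
    by (intro null_frame_nondegenerate[OF frame[OF assms(1,2)], of "n x"]) (auto simp: sprod_simps)
  then show ?thesis by simp
qed

section \<open>Structure equations and the Codazzi equation\<close>

lemma Y_ii:
  assumes x: "x \<in> \<Omega>"
  shows "pdiff i (pdiff i Y) x = - (s i x / 2) *\<^sub>R Y x + K i x *\<^sub>R n x"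
proof -
  obtain j where ij: "i \<noteq> j" using ex_other by blast
  have "ip52 (Y x) (n x) = 0" using nY[OF x] by (simp add: sprod_commute)
  moreover have "ip52 (Y x) (pdiff k Y x) = 0" for k using dY_Y[OF x, of k] by (simp add: sprod_commute)
  moreover have "ip52 (Y x) (pdiff i (pdiff j Y) x) = - 1 / 2"
    using ddY_Y[OF x, of i j] dYdY'[OF x ij] by (simp add: sprod_commute)
  ultimately show ?thesis
    using ddY_Y[OF x] dYdY[OF x] YY[OF x] ddY_dY[OF x] nn[OF x] nY[OF x] ndY[OF x] nddY[OF x ij] ddY_mixed[OF x ij]
    by (intro vector_eqI[OF x ij]) (simp_all add: sprod_simps K_def)
qed

lemma dn_perp: "x \<in> \<Omega> \<Longrightarrow> ip52 (pdiff i n x) (Y x) = 0" "x \<in> \<Omega> \<Longrightarrow> ip52 (pdiff i n x) (n x) = 0"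
proof -
  show "ip52 (pdiff i n x) (Y x) = 0" if x: "x \<in> \<Omega>"
  proof -
    have "ip52 (pdiff i n x) (Y x) = - ip52 (n x) (pdiff i Y x)"
      by (rule D_sprod_const[OF nY smooth_n smooth_Y x])
    then show ?thesis using ndY[OF x] by simp
  qed
  show "ip52 (pdiff i n x) (n x) = 0" if x: "x \<in> \<Omega>"
  proof -
    have "ip52 (pdiff i n x) (n x) = - ip52 (n x) (pdiff i n x)"
      by (rule D_sprod_const[OF nn smooth_n smooth_n x])
    then show ?thesis by (simp add: sprod_commute)
  qed
qed

lemma D_K: "x \<in> \<Omega> \<Longrightarrow> pdiff j (K i) x = ip52 (pdiff j (pdiff i (pdiff i Y)) x) (n x)"
proof -
  assume x: "x \<in> \<Omega>"
  have "pdiff j (K i) x = ip52 (pdiff i (pdiff i Y) x) (pdiff j n x) + ip52 (pdiff j (pdiff i (pdiff i Y)) x) (n x)"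
    unfolding K_def[abs_def] by (rule D_sprod[OF smooth_ddY smooth_n x])
  then show ?thesis
    using dn_perp[OF x, of j] by (simp add: Y_ii[OF x] sprod_simps sprod_commute)
qed

lemma dddY:
  assumes x: "x \<in> \<Omega>"
  shows "pdiff i (pdiff i (pdiff j Y)) x = pdiff j (pdiff i (pdiff i Y)) x"
proof -
  have "pdiff i (pdiff i (pdiff j Y)) x = pdiff i (pdiff j (pdiff i Y)) x"
    by (rule pdiff_cong[OF open_\<Omega> pdiff_commute[OF open_\<Omega> smooth_Y] smooth_ddY x])
  also have "\<dots> = pdiff j (pdiff i (pdiff i Y)) x"
    by (rule pdiff_commute[OF open_\<Omega> smooth_dY x])
  finally show ?thesis .
qed

text \<open>The Weingarten equation. The derivative of \<open>n\<close> has product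
  \<open>- K i x\<close> with \<open>Y_i\<close> and minus the derivative of \<open>K i\<close>
  along \<open>j\<close> with \<open>Y_ij\<close>; the factors 2 invert the products 1/2 and -1/2 of
  the frame.\<close>

lemma D_n:
  assumes x: "x \<in> \<Omega>" and ij: "i \<noteq> j"
  shows "pdiff i n x = (2 * pdiff j (K i) x) *\<^sub>R Y x - (2 * K i x) *\<^sub>R pdiff j Y x"
proof -
  have 1: "ip52 (pdiff i n x) (pdiff l Y x) = - ip52 (n x) (pdiff i (pdiff l Y) x)" for l
    by (rule D_sprod_const[OF ndY smooth_n smooth_dY x])
  have Ki: "ip52 (n x) (pdiff i (pdiff i Y) x) = K i x" by (simp add: K_def sprod_commute)
  have 2: "ip52 (pdiff i n x) (pdiff i (pdiff j Y) x) = - pdiff j (K i) x"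
  proof -
    have "ip52 (pdiff i n x) (pdiff i (pdiff j Y) x) = - ip52 (n x) (pdiff i (pdiff i (pdiff j Y)) x)"
      by (rule D_sprod_const[OF nddY[OF _ ij] smooth_n smooth_ddY x])
    then show ?thesis using D_K[OF x, of j i] dddY[OF x, of i j] by (simp add: sprod_commute)
  qed
  have "ip52 (Y x) (n x) = 0" using nY[OF x] by (simp add: sprod_commute)
  moreover have "ip52 (pdiff k Y x) (n x) = 0" for k using ndY[OF x] by (simp add: sprod_commute)
  moreover have "ip52 (Y x) (pdiff k Y x) = 0" for k using dY_Y[OF x, of k] by (simp add: sprod_commute)
  moreover have "ip52 (Y x) (pdiff i (pdiff j Y) x) = - 1 / 2"
    using ddY_Y[OF x, of i j] dYdY'[OF x ij] by (simp add: sprod_commute)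
  moreover have "ip52 (pdiff j Y x) (pdiff i (pdiff j Y) x) = 0"
    using ddY_dY[OF x, of i j j] by (simp add: sprod_commute)
  ultimately show ?thesis
    using dn_perp[OF x] 1 2 Ki YY[OF x] dY_Y[OF x] dYdY[OF x] dYdY'[OF x ij[symmetric]] nddY[OF x ij]
    by (intro vector_eqI[OF x ij]) (simp_all add: sprod_simps)
qed

lemma dddY_products:
  assumes x: "x \<in> \<Omega>" and ij: "i \<noteq> j"
  shows "ip52 (pdiff j (pdiff i (pdiff i Y)) x) (Y x) = 0"
    and "ip52 (pdiff j (pdiff i (pdiff i Y)) x) (pdiff i Y x) = - s i x / 4"
proof -
  have "ip52 (pdiff i (pdiff i Y) x) (Y x) = 0" if "x \<in> \<Omega>" for x
    using ddY_Y[OF that] dYdY[OF that] by simp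
  then have "ip52 (pdiff j (pdiff i (pdiff i Y)) x) (Y x) = - ip52 (pdiff i (pdiff i Y) x) (pdiff j Y x)"
    by (rule D_sprod_const[OF _ smooth_ddY smooth_Y x])
  then show "ip52 (pdiff j (pdiff i (pdiff i Y)) x) (Y x) = 0"
    using ddY_dY[OF x] by simp
  have "ip52 (pdiff j (pdiff i (pdiff i Y)) x) (pdiff i Y x) =
      - ip52 (pdiff i (pdiff i Y) x) (pdiff j (pdiff i Y) x)"
    by (rule D_sprod_const[OF ddY_dY smooth_ddY smooth_dY x])
  then show "ip52 (pdiff j (pdiff i (pdiff i Y)) x) (pdiff i Y x) = - s i x / 4"
    using ddY_mixed[OF x ij[symmetric], of i] by simp
qed

lemma DD_K:
  assumes x: "x \<in> \<Omega>" and ij: "i \<noteq> j"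
  shows "pdiff j (pdiff j (K i)) x =
    ip52 (pdiff j (pdiff j (pdiff i (pdiff i Y))) x) (n x) + s i x / 2 * K j x"
proof -
  have sm: "smooth_on \<Omega> (pdiff j (pdiff i (pdiff i Y)))" by (intro smooth_intros smooth_ddY)
  have "pdiff j (pdiff j (K i)) x = pdiff j (\<lambda>x. ip52 (pdiff j (pdiff i (pdiff i Y)) x) (n x)) x"
    by (rule pdiff_cong[OF open_\<Omega> D_K smooth_on_pdiff[OF smooth_K] x])
  also have "\<dots> = ip52 (pdiff j (pdiff i (pdiff i Y)) x) (pdiff j n x) +
      ip52 (pdiff j (pdiff j (pdiff i (pdiff i Y))) x) (n x)"
    by (rule D_sprod[OF sm smooth_n x])
  also have "ip52 (pdiff j (pdiff i (pdiff i Y)) x) (pdiff j n x) = s i x / 2 * K j x"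
    using dddY_products[OF x ij] by (simp add: D_n[OF x ij[symmetric]] sprod_simps)
  finally show ?thesis by simp
qed

text \<open>By \<open>DD_K\<close> each side is the product of \<open>n\<close> with a fourth
  derivative of \<open>Y\<close>, twice in each direction, plus
  \<open>s i x / 2 * K j x + s j x / 2 * K i x\<close>. Both parts are symmetric in \<open>i\<close>
  and \<open>j\<close>.\<close>

lemma codazzi:
  assumes x: "x \<in> \<Omega>" and ij: "i \<noteq> j"
  shows "pdiff j (pdiff j (K i)) x + s j x / 2 * K i x = pdiff i (pdiff i (K j)) x + s i x / 2 * K j x"
proof -
  have "pdiff j (pdiff j (pdiff i (pdiff i Y))) x = pdiff j (pdiff i (pdiff i (pdiff j Y))) x"
    by (rule pdiff_cong[OF open_\<Omega> dddY[symmetric] smooth_on_pdiff[OF smooth_ddY] x])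
  also have "\<dots> = pdiff i (pdiff j (pdiff i (pdiff j Y))) x"
    by (rule pdiff_commute[OF open_\<Omega> smooth_ddY x])
  also have "\<dots> = pdiff i (pdiff j (pdiff j (pdiff i Y))) x"
  proof (rule pdiff_cong[OF open_\<Omega> _ smooth_on_pdiff[OF smooth_ddY] x])
    show "pdiff j (pdiff i (pdiff j Y)) x = pdiff j (pdiff j (pdiff i Y)) x" if "x \<in> \<Omega>" for x
      by (rule pdiff_cong[OF open_\<Omega> pdiff_commute[OF open_\<Omega> smooth_Y] smooth_ddY that])
  qed
  also have "\<dots> = pdiff i (pdiff i (pdiff j (pdiff j Y))) x"
    by (rule pdiff_cong[OF open_\<Omega> dddY smooth_on_pdiff[OF smooth_ddY] x])
  finally show ?thesis using DD_K[OF x ij] DD_K[OF x ij[symmetric]] by simp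
qed

text \<open>A vector orthogonal to \<open>n\<close> is determined by the value of \<open>\<langle>Y, w\<rangle>\<close> at one point: \<open>\<langle>n\<^sub>u, w\<rangle> = 0\<close> is a
  first order linear equation for this function.\<close>

lemma perp_normal_zero:
  assumes x: "x \<in> \<Omega>" and w: "\<And>z. z \<in> \<Omega> \<Longrightarrow> ip52 (n z) w = 0" and Y0: "ip52 (Y x) w = 0"
    and K0: "\<And>i. K i x \<noteq> 0"
  shows "w = 0"
proof -
  define f where "f z = ip52 (Y z) w" for z
  note cw = smooth_on_const[of \<Omega> w]
  have D: "pdiff j (\<lambda>z. ip52 (g z) w) z = ip52 (pdiff j g z) w" if "smooth_on \<Omega> g" "z \<in> \<Omega>" for g z j
  proof -
    have "pdiff j (\<lambda>z. ip52 (g z) w) z = ip52 (g z) (pdiff j (\<lambda>z. w) z) + ip52 (pdiff j g z) w"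
      by (rule D_sprod[OF that(1) cw that(2)])
    then show ?thesis by (simp add: sprod_simps)
  qed
  have fsm: "smooth_on \<Omega> f" unfolding f_def[abs_def] by (intro smooth_intros smooth_patch)
  have df: "pdiff j f z = ip52 (pdiff j Y z) w" if "z \<in> \<Omega>" for j z
    unfolding f_def[abs_def] by (rule D[OF smooth_Y that])
  have ddf: "pdiff i (pdiff j f) x = ip52 (pdiff i (pdiff j Y) x) w" for i j
  proof -
    have "pdiff i (pdiff j f) x = pdiff i (\<lambda>z. ip52 (pdiff j Y z) w) x"
      by (rule pdiff_cong[OF open_\<Omega> df smooth_on_pdiff[OF fsm] x])
    then show ?thesis using D[OF smooth_dY x] by simp
  qed
  have ode: "pdiff j (K i) z * f z - K i z * pdiff j f z = 0" if z: "z \<in> \<Omega>" and ij: "i \<noteq> j" for i j z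
  proof -
    have "ip52 (pdiff i n z) w = 0"
    proof -
      have "pdiff i (\<lambda>z. ip52 (n z) w) z = 0" by (rule pdiff_const_on[OF open_\<Omega> w z])
      then show ?thesis using D[OF smooth_n z, of i] by simp
    qed
    then show ?thesis by (simp add: D_n[OF z ij] sprod_simps f_def df[OF z])
  qed
  have f0: "f x = 0" using Y0 by (simp add: f_def)
  have df0: "pdiff j f x = 0" for j
  proof -
    obtain i where "i \<noteq> j" using ex_other by metis
    then show ?thesis using ode[OF x, of i j] K0[of i] f0 by simp
  qed
  have ij: "(2::2) \<noteq> 1" by simp
  \<comment> \<open>The equation is differentiated once more: at \<open>x\<close>, where the
    function and its first derivatives vanish, only the term with its mixed derivative survives, and
    its factor \<open>K 2 x\<close> is nonzero.\<close>
  have "pdiff 2 (\<lambda>z. pdiff 1 (K 2) z * f z - K 2 z * pdiff 1 f z) x = 0"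
    by (rule pdiff_const_on[OF open_\<Omega> ode[OF _ ij] x])
  moreover have "pdiff 2 (\<lambda>z. pdiff 1 (K 2) z * f z - K 2 z * pdiff 1 f z) x =
    (pdiff 1 (K 2) x * pdiff 2 f x + pdiff 2 (pdiff 1 (K 2)) x * f x) -
    (K 2 x * pdiff 2 (pdiff 1 f) x + pdiff 2 (K 2) x * pdiff 1 f x)"
    by (subst pdiff_diff[OF x] pdiff_mult[OF x]; (intro smooth_on_mult smooth_on_pdiff smooth_K fsm open_\<Omega>)?)+ simp
  ultimately have "pdiff 2 (pdiff 1 f) x = 0" using f0 df0 K0[of 2] by simp
  then show "w = 0"
    using f0 df0 ddf df[OF x] w[OF x]
    by (intro vector_eqI[OF x ij]) (simp_all add: sprod_simps sprod_commute f_def)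
qed

text \<open>With \<open>k = \<langle>Y, c\<rangle>\<close>, the equations for \<open>k\<close> say that the vector with components \<open>k, k\<^sub>u, k\<^sub>v, k\<^sub>u\<^sub>v, 0\<close>
  along the frame has derivative zero.\<close>

lemma constant_vector:
  assumes conv: "convex \<Omega>" and ne: "\<Omega> \<noteq> {}"
    and k: "smooth_on \<Omega> k" and Kk: "\<And>i x. x \<in> \<Omega> \<Longrightarrow> K i x = \<sigma> i * k x"
    and eq: "\<And>i x. x \<in> \<Omega> \<Longrightarrow> pdiff i (pdiff i k) x + s i x / 2 * k x = 0"
  obtains c where "\<And>x. x \<in> \<Omega> \<Longrightarrow> ip52 (n x) c = 0" "\<And>x. x \<in> \<Omega> \<Longrightarrow> ip52 (Y x) c = k x"
proof -
  define q where "q x = pdiff 2 (pdiff 1 Y) x" for x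
  \<comment> \<open>The coefficients invert the Gram matrix of the frame, so that the products of
    \<open>C\<close> with \<open>Y, Y_u, Y_v, Y_uv\<close> are \<open>k, k_u, k_v, k_uv\<close>. The
    term with \<open>ip52 (q x) (q x)\<close> compensates for \<open>Y_uv\<close> not being
    null.\<close>
  define C where "C x = (- 2 * (pdiff 2 (pdiff 1 k) x + 2 * k x * ip52 (q x) (q x))) *\<^sub>R Y x
    + (2 * pdiff 2 k x) *\<^sub>R pdiff 1 Y x + (2 * pdiff 1 k x) *\<^sub>R pdiff 2 Y x - (2 * k x) *\<^sub>R q x" for x
  have qsm: "smooth_on \<Omega> q" unfolding q_def[abs_def] by (rule smooth_ddY)
  have Csm: "smooth_on \<Omega> C"
    unfolding C_def[abs_def] by (intro smooth_intros smooth_patch k qsm)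
  have kd: "smooth_on \<Omega> (pdiff i k)" "smooth_on \<Omega> (pdiff i (pdiff j k))" for i j by (intro smooth_intros k)+
  have CY: "ip52 (C x) (Y x) = k x" and CdY: "ip52 (C x) (pdiff i Y x) = pdiff i k x"
    and Cn: "ip52 (C x) (n x) = 0" and Cq: "ip52 (C x) (q x) = pdiff 2 (pdiff 1 k) x" if x: "x \<in> \<Omega>" for i x
  proof -
    have qY: "ip52 (q x) (Y x) = - 1 / 2" "ip52 (Y x) (q x) = - 1 / 2"
      using ddY_Y[OF x, of 2 1] dYdY'[OF x, of 2 1] by (simp_all add: q_def sprod_commute)
    have qdY: "ip52 (q x) (pdiff i Y x) = 0" "ip52 (pdiff i Y x) (q x) = 0" for i
      using ddY_dY[OF x] by (simp_all add: q_def sprod_commute)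
    have qn: "ip52 (q x) (n x) = 0" using nddY[OF x, of 2 1] by (simp add: q_def sprod_commute)
    have Yn: "ip52 (Y x) (n x) = 0" "ip52 (pdiff i Y x) (n x) = 0" "ip52 (Y x) (pdiff i Y x) = 0" for i
      using nY[OF x] ndY[OF x] dY_Y[OF x] by (simp_all add: sprod_commute)
    note F = qY qdY qn Yn YY[OF x] dY_Y[OF x] dYdY[OF x]
    have d12: "ip52 (pdiff 1 Y x) (pdiff 2 Y x) = 1 / 2" "ip52 (pdiff 2 Y x) (pdiff 1 Y x) = 1 / 2"
      using dYdY'[OF x] by auto
    show "ip52 (C x) (Y x) = k x" by (simp add: C_def sprod_simps F)
    show "ip52 (C x) (pdiff i Y x) = pdiff i k x"
      using exhaust_2[of i] by (auto simp: C_def sprod_simps F d12)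
    show "ip52 (C x) (n x) = 0" by (simp add: C_def sprod_simps F)
    show "ip52 (C x) (q x) = pdiff 2 (pdiff 1 k) x" by (simp add: C_def sprod_simps F algebra_simps)
  qed
  have Cmix: "ip52 (C x) (pdiff i (pdiff j Y) x) = pdiff i (pdiff j k) x" if "x \<in> \<Omega>" "i \<noteq> j" for x i j
    using Cq[OF that(1)] mixed[OF that] pdiff_commute[OF open_\<Omega> k that(1), of 1 2] that(2)
      exhaust_2[of i] exhaust_2[of j] by (auto simp: q_def)
  \<comment> \<open>Here the equations assumed for \<open>k\<close> are used: the product of
    \<open>C\<close> with \<open>Y_ii\<close> is \<open>- s i x / 2 * k x\<close>.\<close>
  have Cii: "ip52 (C x) (pdiff i (pdiff i Y) x) = pdiff i (pdiff i k) x" if "x \<in> \<Omega>" for x i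
    using eq[OF that, of i] by (simp add: Y_ii[OF that] sprod_simps CY[OF that] Cn[OF that])
  have dCY: "ip52 (pdiff i C x) (Y x) = 0" if x: "x \<in> \<Omega>" for i x
  proof -
    have "pdiff i (\<lambda>x. ip52 (C x) (Y x)) x = pdiff i k x"
      by (rule pdiff_cong[OF open_\<Omega> CY _ x]; (assumption | intro smooth_intros Csm smooth_patch))
    then show ?thesis using D_sprod[OF Csm smooth_Y x, of i] CdY[OF x] by simp
  qed
  have dCdY: "ip52 (pdiff i C x) (pdiff j Y x) = 0" if x: "x \<in> \<Omega>" for i j x
  proof -
    have "pdiff i (\<lambda>x. ip52 (C x) (pdiff j Y x)) x = pdiff i (pdiff j k) x"
      by (rule pdiff_cong[OF open_\<Omega> CdY _ x]; (assumption | intro smooth_intros Csm smooth_patch))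
    then show ?thesis using D_sprod[OF Csm smooth_dY[of j] x, of i] Cmix[OF x, of i j] Cii[OF x, of i]
      by (cases "i = j") auto
  qed
  \<comment> \<open>Proportionality with constant factors enters here: by \<open>D_n\<close> the
    product of \<open>C\<close> with the derivative of \<open>n\<close> is twice \<open>k\<close>
    times a derivative of \<open>K i\<close> minus \<open>K i\<close> times that of
    \<open>k\<close>, which vanishes if \<open>K i\<close> is a constant multiple of
    \<open>k\<close>.\<close>
  have dCn: "ip52 (pdiff i C x) (n x) = 0" if x: "x \<in> \<Omega>" for i x
  proof -
    obtain j where ij: "i \<noteq> j" using ex_other by blast
    have "pdiff j (K i) x = pdiff j (\<lambda>x. \<sigma> i * k x) x"
      by (rule pdiff_cong[OF open_\<Omega> Kk smooth_K x])
    also have "\<dots> = \<sigma> i * pdiff j k x"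
      using pdiff_mult[OF x smooth_on_const k] by simp
    finally have "ip52 (C x) (pdiff i n x) = 0"
      by (simp add: D_n[OF x ij] sprod_simps CY[OF x] CdY[OF x] Kk[OF x])
    moreover have "ip52 (pdiff i C x) (n x) = - ip52 (C x) (pdiff i n x)"
      by (rule D_sprod_const[OF Cn Csm smooth_n x])
    ultimately show ?thesis by simp
  qed
  \<comment> \<open>Differentiating \<open>Cii\<close> in the other direction evaluates
    \<open>C\<close> on the third derivative of \<open>Y\<close>; the symmetry of the third
    derivatives of \<open>Y\<close> and \<open>k\<close> then closes the argument.\<close>
  have dCmix: "ip52 (pdiff i C x) (pdiff i (pdiff j Y) x) = 0" if x: "x \<in> \<Omega>" and ij: "i \<noteq> j" for i j x
  proof -
    have "pdiff i (\<lambda>x. ip52 (C x) (pdiff i (pdiff j Y) x)) x = pdiff i (pdiff i (pdiff j k)) x"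
      by (rule pdiff_cong[OF open_\<Omega> Cmix[OF _ ij] _ x]; (assumption | intro smooth_intros Csm smooth_patch))
    then have 1: "ip52 (pdiff i C x) (pdiff i (pdiff j Y) x) =
        pdiff i (pdiff i (pdiff j k)) x - ip52 (C x) (pdiff j (pdiff i (pdiff i Y)) x)"
      using D_sprod[OF Csm smooth_ddY[of i j] x, of i] dddY[OF x, of i j] by simp
    have "pdiff j (\<lambda>x. ip52 (C x) (pdiff i (pdiff i Y) x)) x = pdiff j (pdiff i (pdiff i k)) x"
      by (rule pdiff_cong[OF open_\<Omega> Cii _ x]; (assumption | intro smooth_intros Csm smooth_patch))
    moreover have "ip52 (pdiff j C x) (pdiff i (pdiff i Y) x) = 0"
      by (simp add: Y_ii[OF x] sprod_simps dCY[OF x] dCn[OF x])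
    ultimately have 2: "ip52 (C x) (pdiff j (pdiff i (pdiff i Y)) x) = pdiff j (pdiff i (pdiff i k)) x"
      using D_sprod[OF Csm smooth_ddY[of i i] x, of j] by simp
    have "pdiff i (pdiff i (pdiff j k)) x = pdiff i (pdiff j (pdiff i k)) x"
      by (rule pdiff_cong[OF open_\<Omega> pdiff_commute[OF open_\<Omega> k] kd(2) x])
    also have "\<dots> = pdiff j (pdiff i (pdiff i k)) x"
      by (rule pdiff_commute[OF open_\<Omega> kd(1) x])
    finally show ?thesis using 1 2 by simp
  qed
  have dC: "pdiff i C x = 0" if x: "x \<in> \<Omega>" for i x
  proof -
    obtain j where ij: "i \<noteq> j" using ex_other by blast
    show ?thesis
      by (rule vector_eqI[OF x ij]) (simp_all add: dCY[OF x] dCdY[OF x] dCn[OF x] dCmix[OF x ij] sprod_simps)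
  qed
  have "\<exists>c. \<forall>x\<in>\<Omega>. C x = c"
  proof (rule has_derivative_zero_constant[OF conv])
    fix x assume x: "x \<in> \<Omega>"
    have "frechet_derivative C (at x) = (\<lambda>h. 0)"
      using frechet_derivative_2[OF Csm x] dC[OF x] by (simp add: fun_eq_iff)
    then show "(C has_derivative (\<lambda>h. 0)) (at x within \<Omega>)"
      using smooth_on_has_derivative[OF Csm x] has_derivative_at_withinI by metis
  qed
  then obtain c where c: "\<And>x. x \<in> \<Omega> \<Longrightarrow> C x = c" by auto
  show ?thesis
    by (rule that[of c]) (use Cn CY c in \<open>auto simp: sprod_commute\<close>)
qed

end

section \<open>Normal variations\<close>

text \<open>The correction term \<open>t\<^sup>2 \<phi>\<^sup>2 N / 2\<close>, where \<open>N\<close> is null, \<open>\<langle>Y, N\<rangle> = - 1\<close> and \<open>\<langle>n, N\<rangle> = 0\<close>, keeps the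
  variation \<open>Y + t \<phi> n\<close> in the light cone.\<close>

locale normal_variation = canonical_patch +
  fixes \<phi> :: "real^2 \<Rightarrow> real"
  assumes smooth_\<phi>: "smooth_on \<Omega> \<phi>"
begin

text \<open>Twice \<open>Y_uv\<close> has product -1 with \<open>Y\<close>; adding a multiple of
  \<open>Y\<close> keeps this, and the coefficient is the one that makes the sum null.\<close>

definition N :: "real^2 \<Rightarrow> real^5" where
  "N x = 2 *\<^sub>R pdiff 2 (pdiff 1 Y) x + (2 * ip52 (pdiff 2 (pdiff 1 Y) x) (pdiff 2 (pdiff 1 Y) x)) *\<^sub>R Y x"

definition P :: "real^2 \<Rightarrow> real^5" where "P x = \<phi> x *\<^sub>R n x"

definition R :: "real^2 \<Rightarrow> real^5" where "R x = ((\<phi> x)\<^sup>2 / 2) *\<^sub>R N x"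

definition Z :: "real \<times> (real^2) \<Rightarrow> real^5" where
  "Z z = Y (snd z) + fst z *\<^sub>R P (snd z) + (fst z)\<^sup>2 *\<^sub>R R (snd z)"

text \<open>Written out as a polynomial in \<open>t\<close> with coefficients depending on the
  point, so that joint smoothness is immediate; \<open>pdiff_Z\<close> identifies it as a partial
  derivative of \<open>Z\<close>.\<close>

definition dZ :: "2 \<Rightarrow> real \<times> (real^2) \<Rightarrow> real^5" where
  "dZ i z = pdiff i Y (snd z) + fst z *\<^sub>R pdiff i P (snd z) + (fst z)\<^sup>2 *\<^sub>R pdiff i R (snd z)"

definition ddZ :: "2 \<Rightarrow> 2 \<Rightarrow> real \<times> (real^2) \<Rightarrow> real^5" where
  "ddZ i j z = pdiff i (pdiff j Y) (snd z) + fst z *\<^sub>R pdiff i (pdiff j P) (snd z)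
     + (fst z)\<^sup>2 *\<^sub>R pdiff i (pdiff j R) (snd z)"

lemma smooth_N: "smooth_on \<Omega> N"
  unfolding N_def[abs_def] by (intro smooth_intros smooth_patch)

lemma smooth_P: "smooth_on \<Omega> P"
  unfolding P_def[abs_def] by (intro smooth_intros smooth_patch smooth_\<phi>)

lemma smooth_R: "smooth_on \<Omega> R"
  unfolding R_def[abs_def] divide_inverse by (intro smooth_intros smooth_patch smooth_\<phi> smooth_N)

lemma pdiff_Z:
  assumes x: "x \<in> \<Omega>"
  shows "pdiff i (\<lambda>x. Z (t, x)) x = dZ i (t, x)" and "pdiff i (pdiff j (\<lambda>x. Z (t, x))) x = ddZ i j (t, x)"
proof -
  have comb: "pdiff i (\<lambda>x. f x + t *\<^sub>R g x + t\<^sup>2 *\<^sub>R h x) x = pdiff i f x + t *\<^sub>R pdiff i g x + t\<^sup>2 *\<^sub>R pdiff i h x"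
    if "smooth_on \<Omega> f" "smooth_on \<Omega> g" "smooth_on \<Omega> h" "x \<in> \<Omega>" for f g h :: "real^2 \<Rightarrow> real^5" and i x
  proof -
    have "pdiff i (\<lambda>x. f x + t *\<^sub>R g x + t\<^sup>2 *\<^sub>R h x) x = pdiff i f x + pdiff i (\<lambda>x. t *\<^sub>R g x) x + pdiff i (\<lambda>x. t\<^sup>2 *\<^sub>R h x) x"
      by (subst pdiff_add[OF that(4)]; (intro smooth_intros that open_\<Omega>)?)+ simp
    then show ?thesis
      using pdiff_scaleR[OF that(4) smooth_on_const that(2)] pdiff_scaleR[OF that(4) smooth_on_const that(3)] by simp
  qed
  have 1: "pdiff i (\<lambda>x. Z (t, x)) x = dZ i (t, x)" if "x \<in> \<Omega>" for x i
    unfolding Z_def dZ_def fst_conv snd_conv by (rule comb[OF smooth_Y smooth_P smooth_R that])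
  then show "pdiff i (\<lambda>x. Z (t, x)) x = dZ i (t, x)" using x .
  have "smooth_on \<Omega> (\<lambda>x. Z (t, x))"
    unfolding Z_def fst_conv snd_conv by (intro smooth_intros smooth_patch smooth_P smooth_R)
  then have "pdiff i (pdiff j (\<lambda>x. Z (t, x))) x = pdiff i (\<lambda>x. dZ j (t, x)) x"
    by (intro pdiff_cong[OF open_\<Omega> 1 _ x] smooth_on_pdiff)
  also have "\<dots> = ddZ i j (t, x)"
    unfolding dZ_def ddZ_def fst_conv snd_conv by (intro comb x smooth_on_pdiff smooth_Y smooth_P smooth_R)
  finally show "pdiff i (pdiff j (\<lambda>x. Z (t, x))) x = ddZ i j (t, x)" .
qed

abbreviation "T\<Omega> \<equiv> UNIV \<times> \<Omega> :: (real \<times> (real^2)) set"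

lemma open_T\<Omega>: "open T\<Omega>"
  by (simp add: open_Times open_\<Omega>)

lemma smooth_snd: "smooth_on \<Omega> f \<Longrightarrow> smooth_on T\<Omega> (\<lambda>z. f (snd z))"
  by (rule smooth_on_compose[OF _ open_T\<Omega> open_\<Omega> smooth_on_linear[OF open_T\<Omega> bounded_linear_snd]]) auto

lemma smooth_fst: "smooth_on T\<Omega> fst"
  by (rule smooth_on_linear[OF open_T\<Omega> bounded_linear_fst])

lemmas smooth_T = open_T\<Omega> smooth_snd smooth_fst smooth_patch smooth_P smooth_R smooth_N smooth_\<phi>

lemma smooth_Z: "smooth_on T\<Omega> Z"
  unfolding Z_def[abs_def] by (intro smooth_intros smooth_T)

lemma smooth_dZ: "smooth_on T\<Omega> (dZ i)"
proof -
  have "smooth_on T\<Omega> (\<lambda>z. pdiff i f (snd z))" if "smooth_on \<Omega> f" for f :: "real^2 \<Rightarrow> real^5"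
    by (rule smooth_snd[OF smooth_on_pdiff[OF that]])
  then show ?thesis unfolding dZ_def[abs_def] by (intro smooth_intros smooth_T)
qed

lemma smooth_ddZ: "smooth_on T\<Omega> (ddZ i j)"
proof -
  have "smooth_on T\<Omega> (\<lambda>z. pdiff i (pdiff j f) (snd z))" if "smooth_on \<Omega> f" for f :: "real^2 \<Rightarrow> real^5"
    by (rule smooth_snd[OF smooth_on_pdiff[OF smooth_on_pdiff[OF that]]])
  then show ?thesis unfolding ddZ_def[abs_def] by (intro smooth_intros smooth_T)
qed

lemma N_products:
  assumes x: "x \<in> \<Omega>"
  shows "ip52 (N x) (Y x) = - 1" "ip52 (N x) (N x) = 0" "ip52 (N x) (n x) = 0" "ip52 (N x) (pdiff i Y x) = 0"
proof -
  have q: "ip52 (pdiff 2 (pdiff 1 Y) x) (Y x) = - 1 / 2" "ip52 (Y x) (pdiff 2 (pdiff 1 Y) x) = - 1 / 2"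
    using ddY_Y[OF x, of 2 1] dYdY'[OF x, of 2 1] by (simp_all add: sprod_commute)
  have qn: "ip52 (pdiff 2 (pdiff 1 Y) x) (n x) = 0" using nddY[OF x, of 2 1] by (simp add: sprod_commute)
  have Yn: "ip52 (Y x) (n x) = 0" "ip52 (Y x) (pdiff i Y x) = 0"
    using nY[OF x] dY_Y[OF x] by (simp_all add: sprod_commute)
  note F = q qn Yn YY[OF x] ddY_dY[OF x]
  show "ip52 (N x) (Y x) = - 1" "ip52 (N x) (N x) = 0" "ip52 (N x) (n x) = 0" "ip52 (N x) (pdiff i Y x) = 0"
    unfolding N_def by (simp_all add: sprod_simps F)
qed

lemma Z_products:
  assumes x: "x \<in> \<Omega>"
  shows "ip52 (Z (t, x)) (Z (t, x)) = 0" "ip52 (N x) (Z (t, x)) = - 1" "ip52 (n x) (Z (t, x)) = t * \<phi> x"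
proof -
  have YN: "ip52 (Y x) (N x) = - 1" "ip52 (n x) (N x) = 0" "ip52 (Y x) (n x) = 0"
    using N_products[OF x] nY[OF x] by (simp_all add: sprod_commute)
  note F = YN N_products[OF x] YY[OF x] nn[OF x] nY[OF x]
  show "ip52 (Z (t, x)) (Z (t, x)) = 0" "ip52 (N x) (Z (t, x)) = - 1" "ip52 (n x) (Z (t, x)) = t * \<phi> x"
    unfolding Z_def P_def R_def fst_conv snd_conv by (simp_all add: sprod_simps F power2_eq_square algebra_simps)
qed

lemma Z_nonzero: "x \<in> \<Omega> \<Longrightarrow> Z (t, x) \<noteq> 0"
  using Z_products(2)[of x t] by (auto simp: sprod_simps)

lemma dZ_Z: "x \<in> \<Omega> \<Longrightarrow> ip52 (dZ i (t, x)) (Z (t, x)) = 0"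
proof -
  assume x: "x \<in> \<Omega>"
  have "smooth_on \<Omega> (\<lambda>x. Z (t, x))"
    unfolding Z_def fst_conv snd_conv by (intro smooth_intros smooth_patch smooth_P smooth_R)
  then have "ip52 (pdiff i (\<lambda>x. Z (t, x)) x) (Z (t, x)) = 0"
    by (rule null_lift_derivatives(1)[OF open_\<Omega> _ Z_products(1) x])
  then show ?thesis by (simp add: pdiff_Z[OF x])
qed

section \<open>Normal field and Willmore density along the variation\<close>

definition m :: "real \<times> (real^2) \<Rightarrow> real^5" where
  "m z = n (snd z) + (fst z * \<phi> (snd z)) *\<^sub>R N (snd z)"

definition gZ :: "2 \<Rightarrow> 2 \<Rightarrow> real \<times> (real^2) \<Rightarrow> real" where "gZ i j z = ip52 (dZ i z) (dZ j z)"

definition G :: "real \<times> (real^2) \<Rightarrow> real" where "G z = gZ 1 1 z * gZ 2 2 z - (gZ 1 2 z)\<^sup>2"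

text \<open>\<open>m\<close> is orthogonal to \<open>Z\<close>; Cramer's rule removes its tangential part, up to the factor \<open>G\<close>.\<close>

definition \<nu> :: "real \<times> (real^2) \<Rightarrow> real^5" where
  "\<nu> z = G z *\<^sub>R m z
    - (gZ 2 2 z * ip52 (m z) (dZ 1 z) - gZ 1 2 z * ip52 (m z) (dZ 2 z)) *\<^sub>R dZ 1 z
    - (gZ 1 1 z * ip52 (m z) (dZ 2 z) - gZ 1 2 z * ip52 (m z) (dZ 1 z)) *\<^sub>R dZ 2 z"

definition bZ :: "2 \<Rightarrow> 2 \<Rightarrow> real \<times> (real^2) \<Rightarrow> real" where "bZ i j z = ip52 (ddZ i j z) (\<nu> z)"

definition trZ :: "real \<times> (real^2) \<Rightarrow> real" where
  "trZ z = gZ 2 2 z * bZ 1 1 z - gZ 1 2 z * (bZ 1 2 z + bZ 2 1 z) + gZ 1 1 z * bZ 2 2 z"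

text \<open>This is \<open>wdens\<close> of the varied lift as a function of time and point, see
  \<open>Zs_wdens\<close>. The normal \<open>\<nu>\<close> is not normalised, and division by its
  square makes up for that.\<close>

definition wd :: "real \<times> (real^2) \<Rightarrow> real" where
  "wd z = (bZ 1 1 z * bZ 2 2 z - bZ 1 2 z * bZ 2 1 z - (trZ z)\<^sup>2 / (4 * G z)) / (ip52 (\<nu> z) (\<nu> z) * sqrt (- G z))"

lemma smooth_m: "smooth_on T\<Omega> m"
  unfolding m_def[abs_def] by (intro smooth_intros smooth_T)

lemma smooth_gZ: "smooth_on T\<Omega> (gZ i j)"
  unfolding gZ_def[abs_def] by (intro smooth_intros smooth_dZ open_T\<Omega>)

lemma smooth_G: "smooth_on T\<Omega> G"
  unfolding G_def[abs_def] by (intro smooth_intros smooth_gZ open_T\<Omega>)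

lemma smooth_\<nu>: "smooth_on T\<Omega> \<nu>"
  unfolding \<nu>_def[abs_def] by (intro smooth_intros smooth_gZ smooth_G smooth_m smooth_dZ open_T\<Omega>)

lemma smooth_bZ: "smooth_on T\<Omega> (bZ i j)"
  unfolding bZ_def[abs_def] by (intro smooth_intros smooth_ddZ smooth_\<nu> open_T\<Omega>)

lemma smooth_trZ: "smooth_on T\<Omega> trZ"
  unfolding trZ_def[abs_def] by (intro smooth_intros smooth_gZ smooth_bZ open_T\<Omega>)

lemma \<nu>_Z: "x \<in> \<Omega> \<Longrightarrow> ip52 (\<nu> (t, x)) (Z (t, x)) = 0"
  using dZ_Z[of x _ t] Z_products[of x t] by (simp add: \<nu>_def m_def sprod_simps)

lemma \<nu>_dZ: "ip52 (\<nu> z) (dZ i z) = 0"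
proof -
  have sym: "gZ 2 1 z = gZ 1 2 z" by (simp add: gZ_def sprod_commute)
  have e: "ip52 (\<nu> z) (dZ i z) = G z * ip52 (m z) (dZ i z)
    - (gZ 2 2 z * ip52 (m z) (dZ 1 z) - gZ 1 2 z * ip52 (m z) (dZ 2 z)) * gZ 1 i z
    - (gZ 1 1 z * ip52 (m z) (dZ 2 z) - gZ 1 2 z * ip52 (m z) (dZ 1 z)) * gZ 2 i z" for i
    by (simp add: \<nu>_def sprod_simps gZ_def)
  have "ip52 (\<nu> z) (dZ 1 z) = 0" unfolding e sym G_def by algebra
  moreover have "ip52 (\<nu> z) (dZ 2 z) = 0" unfolding e sym G_def by algebra
  ultimately show ?thesis using exhaust_2[of i] by auto
qed

text \<open>The region where the varied lift is timelike and its normal is positive, so that the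
  quotients and the root in \<open>wd\<close> are smooth. It is open and contains the time zero
  slice.\<close>

definition good :: "(real \<times> (real^2)) set" where
  "good = {z \<in> T\<Omega>. G z < 0 \<and> ip52 (\<nu> z) (\<nu> z) > 0}"

lemma open_good: "open good"
proof -
  have "open (T\<Omega> \<inter> G -` {..<0})"
    by (rule continuous_open_preimage[OF smooth_on_imp_continuous_on[OF smooth_G] open_T\<Omega>]) simp
  moreover have "open (T\<Omega> \<inter> (\<lambda>z. ip52 (\<nu> z) (\<nu> z)) -` {0<..})"
    by (rule continuous_open_preimage[OF smooth_on_imp_continuous_on open_T\<Omega>])
      (intro smooth_intros smooth_\<nu> open_T\<Omega>, simp)
  moreover have "good = (T\<Omega> \<inter> G -` {..<0}) \<inter> (T\<Omega> \<inter> (\<lambda>z. ip52 (\<nu> z) (\<nu> z)) -` {0<..})"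
    by (auto simp: good_def)
  ultimately show ?thesis by auto
qed

lemma smooth_wd: "smooth_on good wd"
proof -
  have sub: "good \<subseteq> T\<Omega>" by (auto simp: good_def)
  note sm = smooth_on_subset[OF smooth_gZ sub] smooth_on_subset[OF smooth_bZ sub] smooth_on_subset[OF smooth_G sub]
    smooth_on_subset[OF smooth_\<nu> sub] smooth_on_subset[OF smooth_trZ sub]
  show ?thesis
    unfolding wd_def[abs_def]
    by (intro smooth_intros sm open_good) (auto simp: good_def)
qed

text \<open>The factors -1/4 are the value of \<open>G\<close>, which the definition of
  \<open>\<nu>\<close> leaves in place of a division.\<close>

lemma at_zero:
  assumes x: "x \<in> \<Omega>"
  shows "dZ i (0, x) = pdiff i Y x" "ddZ i j (0, x) = pdiff i (pdiff j Y) x" "m (0, x) = n x"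
    "gZ 1 1 (0, x) = 0" "gZ 2 2 (0, x) = 0" "gZ 1 2 (0, x) = 1 / 2" "G (0, x) = - 1 / 4"
    "\<nu> (0, x) = (- 1 / 4) *\<^sub>R n x" "bZ i i (0, x) = - K i x / 4" "bZ 1 2 (0, x) = 0" "bZ 2 1 (0, x) = 0"
    "trZ (0, x) = 0" "(0, x) \<in> good"
proof -
  show 1: "dZ i (0, x) = pdiff i Y x" "ddZ i j (0, x) = pdiff i (pdiff j Y) x" "m (0, x) = n x" for i j
    by (simp_all add: dZ_def ddZ_def m_def)
  show g: "gZ 1 1 (0, x) = 0" "gZ 2 2 (0, x) = 0" "gZ 1 2 (0, x) = 1 / 2"
    using dYdY[OF x] dYdY'[OF x, of 1 2] by (simp_all add: gZ_def 1)
  show G: "G (0, x) = - 1 / 4" unfolding G_def g by (simp add: power2_eq_square)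
  show \<nu>: "\<nu> (0, x) = (- 1 / 4) *\<^sub>R n x"
    unfolding \<nu>_def 1 by (simp add: ndY[OF x] G)
  show b: "bZ i i (0, x) = - K i x / 4" for i by (simp add: bZ_def 1 \<nu> K_def sprod_simps)
  show b': "bZ 1 2 (0, x) = 0" "bZ 2 1 (0, x) = 0"
    using nddY[OF x, of 1 2] nddY[OF x, of 2 1] by (simp_all add: bZ_def 1 \<nu> sprod_simps sprod_commute)
  show "trZ (0, x) = 0" by (simp add: trZ_def g b')
  show "(0, x) \<in> good" using x by (simp add: good_def G \<nu> sprod_simps nn[OF x])
qed

text \<open>Differentiating \<open>\<phi> n\<close> twice produces no term of order zero in
  \<open>\<phi>\<close>: by \<open>D_n\<close> the derivative of \<open>n\<close> in a coordinate
  direction lies in a totally null plane, so its square vanishes.\<close>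

lemma ddP_n:
  assumes x: "x \<in> \<Omega>"
  shows "ip52 (pdiff i (pdiff i P) x) (n x) = pdiff i (pdiff i \<phi>) x"
proof -
  obtain j where ij: "i \<noteq> j" using ex_other by blast
  have ndn: "ip52 (n x) (pdiff i n x) = 0" if "x \<in> \<Omega>" for x
    using dn_perp(2)[OF that, of i] by (simp add: sprod_commute)
  have dndn: "ip52 (pdiff i n x) (pdiff i n x) = 0" if x: "x \<in> \<Omega>" for x
  proof -
    have "ip52 (Y x) (pdiff j Y x) = 0" using dY_Y[OF x, of j] by (simp add: sprod_commute)
    then show ?thesis by (simp add: D_n[OF x ij] sprod_simps YY[OF x] dYdY[OF x] dY_Y[OF x])
  qed
  have Pd: "pdiff i P x = \<phi> x *\<^sub>R pdiff i n x + pdiff i \<phi> x *\<^sub>R n x" if "x \<in> \<Omega>" for x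
    unfolding P_def[abs_def] by (rule pdiff_scaleR[OF that smooth_\<phi> smooth_n])
  have 1: "ip52 (pdiff i P x) (n x) = pdiff i \<phi> x" if "x \<in> \<Omega>" for x
    by (simp add: Pd[OF that] sprod_simps dn_perp[OF that] nn[OF that])
  have "pdiff i (\<lambda>x. ip52 (pdiff i P x) (n x)) x = pdiff i (pdiff i \<phi>) x"
    by (rule pdiff_cong[OF open_\<Omega> 1 _ x]; (assumption | intro smooth_intros smooth_P smooth_patch))
  moreover have "pdiff i (\<lambda>x. ip52 (pdiff i P x) (n x)) x =
      ip52 (pdiff i P x) (pdiff i n x) + ip52 (pdiff i (pdiff i P) x) (n x)"
    by (rule D_sprod[OF smooth_on_pdiff[OF smooth_P] smooth_n x])
  moreover have "ip52 (pdiff i P x) (pdiff i n x) = 0"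
    by (simp add: Pd[OF x] sprod_simps dndn[OF x] ndn[OF x])
  ultimately show ?thesis by simp
qed

lemma dY_dP:
  assumes x: "x \<in> \<Omega>"
  shows "ip52 (pdiff i Y x) (pdiff j P x) = \<phi> x * ip52 (pdiff i Y x) (pdiff j n x)"
proof -
  have "pdiff j P x = \<phi> x *\<^sub>R pdiff j n x + pdiff j \<phi> x *\<^sub>R n x"
    unfolding P_def[abs_def] by (rule pdiff_scaleR[OF x smooth_\<phi> smooth_n])
  then show ?thesis using ndY[OF x, of i] by (simp add: sprod_simps sprod_commute)
qed

text \<open>The component \<open>\<omega>\<close> of the derivative of \<open>\<nu>\<close> along
  \<open>n\<close> need not be known: \<open>wd\<close> is homogeneous of degree zero in
  \<open>\<nu>\<close>, so it cancels. The determinant \<open>G\<close> and the trace term are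
  stationary and the mixed coefficients vanish at time zero, so only the diagonal coefficients
  \<open>bZ 1 1\<close> and \<open>bZ 2 2\<close> contribute.\<close>

lemma wd_has_derivative:
  assumes x: "x \<in> \<Omega>"
  shows "((\<lambda>t. wd (t, x)) has_real_derivative
    2 * (K 2 x * (pdiff 1 (pdiff 1 \<phi>) x + s 1 x / 2 * \<phi> x) + K 1 x * (pdiff 2 (pdiff 2 \<phi>) x + s 2 x / 2 * \<phi> x))) (at 0)"
proof -
  have dZ': "((\<lambda>t. dZ i (t, x)) has_vector_derivative pdiff i P x) (at 0)" for i
    unfolding dZ_def fst_conv snd_conv by (auto intro!: derivative_eq_intros)
  have ddZ': "((\<lambda>t. ddZ i j (t, x)) has_vector_derivative pdiff i (pdiff j P) x) (at 0)" for i j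
    unfolding ddZ_def fst_conv snd_conv by (auto intro!: derivative_eq_intros)
  have Z': "((\<lambda>t. Z (t, x)) has_vector_derivative P x) (at 0)"
    unfolding Z_def fst_conv snd_conv by (auto intro!: derivative_eq_intros)
  have Z0: "Z (0, x) = Y x" by (simp add: Z_def)
  note bil = bounded_bilinear.has_vector_derivative[OF bounded_bilinear_sprod]
  have "((\<lambda>t. (t, x)) has_derivative (\<lambda>h. (h, 0))) (at 0)" by (auto intro!: derivative_eq_intros)
  from has_derivative_compose[OF this smooth_on_has_derivative[OF smooth_\<nu>, of "(0, x)"]] x
  have "((\<lambda>t. \<nu> (t, x)) has_derivative (\<lambda>h. frechet_derivative \<nu> (at (0, x)) (h, 0))) (at 0)" by simp
  then have "(\<lambda>t. \<nu> (t, x)) differentiable (at 0)" by (auto simp: differentiable_def)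
  then obtain \<nu>' where \<nu>': "((\<lambda>t. \<nu> (t, x)) has_vector_derivative \<nu>') (at 0)"
    using vector_derivative_works by blast
  define \<omega> where "\<omega> = ip52 (n x) \<nu>'"
  \<comment> \<open>Differentiating \<open>ip52 (\<nu> z) (Z z) = 0\<close> gives the one component
    of the derivative of \<open>\<nu>\<close>, besides \<open>\<omega>\<close>, that enters.\<close>
  have Y\<nu>': "ip52 (Y x) \<nu>' = \<phi> x / 4"
  proof -
    have "((\<lambda>t. ip52 (\<nu> (t, x)) (Z (t, x))) has_vector_derivative
        ip52 (\<nu> (0, x)) (P x) + ip52 \<nu>' (Z (0, x))) (at 0)"
      by (rule bil[OF \<nu>' Z'])
    moreover have "((\<lambda>t. ip52 (\<nu> (t, x)) (Z (t, x))) has_vector_derivative 0) (at 0)"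
      by (simp add: \<nu>_Z[OF x])
    ultimately have "ip52 (\<nu> (0, x)) (P x) + ip52 \<nu>' (Z (0, x)) = 0"
      by (rule vector_derivative_unique_at)
    then show ?thesis by (simp add: at_zero[OF x] Z0 P_def sprod_simps nn[OF x] sprod_commute)
  qed
  have g': "((\<lambda>t. gZ i j (t, x)) has_vector_derivative
      ip52 (pdiff i Y x) (pdiff j P x) + ip52 (pdiff i P x) (pdiff j Y x)) (at 0)" for i j
    using bil[OF dZ'[of i] dZ'[of j], of "{4, 5}"] by (simp add: gZ_def at_zero[OF x])
  \<comment> \<open>By \<open>D_n\<close> the derivative of \<open>n\<close> along \<open>j\<close>
    is a combination of \<open>Y\<close> and \<open>Y_i\<close>, and both are orthogonal to
    \<open>Y_i\<close>.\<close>
  have cross: "ip52 (pdiff i Y x) (pdiff j P x) = 0" if "i \<noteq> j" for i j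
  proof -
    have "ip52 (pdiff i Y x) (Y x) = 0" by (rule dY_Y[OF x])
    then show ?thesis by (simp add: dY_dP[OF x] D_n[OF x that[symmetric]] sprod_simps dYdY[OF x])
  qed
  have g12: "((\<lambda>t. gZ 1 2 (t, x)) has_real_derivative 0) (at 0)"
    using g'[of 1 2] cross[of 1 2] cross[of 2 1] by (simp add: has_real_derivative_iff_has_vector_derivative sprod_commute)
  obtain g11 where g11: "((\<lambda>t. gZ 1 1 (t, x)) has_real_derivative g11) (at 0)"
    using g'[of 1 1] by (auto simp: has_real_derivative_iff_has_vector_derivative)
  obtain g22 where g22: "((\<lambda>t. gZ 2 2 (t, x)) has_real_derivative g22) (at 0)"
    using g'[of 2 2] by (auto simp: has_real_derivative_iff_has_vector_derivative)
  \<comment> \<open>The diagonal entries of the metric vanish at time zero and the mixed entry is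
    stationary, so the derivatives of the diagonal entries are irrelevant.\<close>
  have G': "((\<lambda>t. G (t, x)) has_real_derivative 0) (at 0)"
    unfolding G_def power2_eq_square
    by (rule DERIV_cong[OF DERIV_diff[OF DERIV_mult[OF g11 g22] DERIV_mult[OF g12 g12]]])
      (simp add: at_zero[OF x])
  have b'0: "((\<lambda>t. bZ i j (t, x)) has_real_derivative
      ip52 (pdiff i (pdiff j Y) x) \<nu>' - ip52 (pdiff i (pdiff j P) x) (n x) / 4) (at 0)" for i j
    using bil[OF ddZ'[of i j] \<nu>', of "{4, 5}"]
    by (simp add: has_real_derivative_iff_has_vector_derivative bZ_def at_zero[OF x] sprod_simps)
  have b': "((\<lambda>t. bZ i i (t, x)) has_real_derivative
      K i x * \<omega> - (pdiff i (pdiff i \<phi>) x + s i x / 2 * \<phi> x) / 4) (at 0)" for i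
    by (rule DERIV_cong[OF b'0[of i i]]) (simp add: Y_ii[OF x] sprod_simps Y\<nu>' ddP_n[OF x] \<omega>_def add_divide_distrib)
  obtain t' where t': "((\<lambda>t. trZ (t, x)) has_real_derivative t') (at 0)"
    unfolding trZ_def
    using DERIV_add[OF DERIV_diff[OF DERIV_mult[OF g22 b'[of 1]] DERIV_mult[OF g12 DERIV_add[OF b'0[of 1 2] b'0[of 2 1]]]]
        DERIV_mult[OF g11 b'[of 2]]] by blast
  have num1: "((\<lambda>t. bZ 1 1 (t, x) * bZ 2 2 (t, x) - bZ 1 2 (t, x) * bZ 2 1 (t, x)) has_real_derivative
      (K 1 x * \<omega> - (pdiff 1 (pdiff 1 \<phi>) x + s 1 x / 2 * \<phi> x) / 4) * (- K 2 x / 4) +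
      (K 2 x * \<omega> - (pdiff 2 (pdiff 2 \<phi>) x + s 2 x / 2 * \<phi> x) / 4) * (- K 1 x / 4)) (at 0)"
    by (rule DERIV_cong[OF DERIV_diff[OF DERIV_mult[OF b' b'] DERIV_mult[OF b'0 b'0]]]) (simp add: at_zero[OF x])
  \<comment> \<open>The trace vanishes at time zero, so its square is stationary whatever its own
    derivative is.\<close>
  have num2: "((\<lambda>t. (trZ (t, x))\<^sup>2 / (4 * G (t, x))) has_real_derivative 0) (at 0)"
    unfolding power2_eq_square
    by (rule DERIV_cong[OF DERIV_divide[OF DERIV_mult[OF t' t'] DERIV_cmult[OF G']]]) (simp_all add: at_zero[OF x])
  have norm': "((\<lambda>t. ip52 (\<nu> (t, x)) (\<nu> (t, x))) has_real_derivative - \<omega> / 2) (at 0)"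
    using bil[OF \<nu>' \<nu>', of "{4, 5}"]
    by (simp add: has_real_derivative_iff_has_vector_derivative at_zero[OF x] sprod_simps \<omega>_def sprod_commute)
  have sqrt4: "sqrt (1 / 4) = 1 / 2" by (simp add: real_sqrt_divide)
  have root': "((\<lambda>t. sqrt (- G (t, x))) has_real_derivative 0) (at 0)"
  proof -
    have "(sqrt has_real_derivative inverse (sqrt (- G (0, x))) / 2) (at (- G (0, x)))"
      by (rule DERIV_real_sqrt) (simp add: at_zero[OF x])
    from DERIV_chain2[OF this DERIV_minus[OF G']] show ?thesis by simp
  qed
  have den: "((\<lambda>t. ip52 (\<nu> (t, x)) (\<nu> (t, x)) * sqrt (- G (t, x))) has_real_derivative - \<omega> / 4) (at 0)"
    by (rule DERIV_cong[OF DERIV_mult[OF norm' root']]) (simp add: at_zero[OF x] sqrt4)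
  have v: "ip52 (\<nu> (0, x)) (\<nu> (0, x)) * sqrt (- G (0, x)) = 1 / 32"
    by (simp add: at_zero[OF x] sqrt4 sprod_simps nn[OF x])
  show ?thesis
    unfolding wd_def
    by (rule DERIV_cong[OF DERIV_divide[OF DERIV_diff[OF num1 num2] den]])
      (simp_all only: v, simp_all add: at_zero[OF x] field_simps)
qed

end

section \<open>Integration in coordinates\<close>

text \<open>The integral of a translate is constant; differentiate it with respect to the translation.\<close>

lemma integral_pdiff_eq_0:
  fixes h :: "real^2 \<Rightarrow> real"
  assumes \<Omega>: "open \<Omega>" and h: "smooth_on \<Omega> h" and h0: "\<And>x. x \<in> \<Omega> \<Longrightarrow> x \<notin> cball x0 r \<Longrightarrow> h x = 0"
    and r: "r > 0" and sub: "cball x0 (2 * r) \<subseteq> cbox a b" "cbox a b \<subseteq> \<Omega>"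
  shows "integral (cbox a b) (pdiff i h) = 0"
proof -
  \<comment> \<open>Extension by zero makes all translates available; it is smooth because the
    closed ball lies inside the open set \<open>\<Omega>\<close>.\<close>
  define H where "H x = (if x \<in> cball x0 r then h x else 0)" for x
  have ball: "cball x0 r \<subseteq> cball x0 (2 * r)" using r by auto
  have Hh: "H x = h x" if "x \<in> \<Omega>" for x using h0[OF that] by (auto simp: H_def)
  have Hsm: "smooth_on UNIV H"
  proof (rule smooth_on_local)
    fix x :: "real^2"
    show "\<exists>U. open U \<and> x \<in> U \<and> smooth_on U H"
    proof (cases "x \<in> \<Omega>")
      case True
      then show ?thesis using smooth_on_cong[OF \<Omega> Hh[symmetric] h] \<Omega> by blast
    next
      case False
      then have "x \<in> - cball x0 r" using ball sub by blast
      moreover have "open (- cball x0 r)" by (simp add: open_Compl)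
      moreover have "smooth_on (- cball x0 r) H"
        by (rule smooth_on_cong[OF _ _ smooth_on_const[of _ 0]]) (auto simp: H_def open_Compl)
      ultimately show ?thesis by blast
    qed
  qed
  let ?e = "axis i 1 :: real^2" and ?U = "{- r <..< r}"
  have dHcont: "continuous_on UNIV (pdiff i H)"
    by (rule smooth_on_imp_continuous_on[OF smooth_on_pdiff[OF Hsm]])
  have Hcont: "continuous_on UNIV H" by (rule smooth_on_imp_continuous_on[OF Hsm])
  have "((\<lambda>t. integral (cbox a b) (\<lambda>x. H (x + t *\<^sub>R ?e))) has_real_derivative
      integral (cbox a b) (\<lambda>x. pdiff i H (x + 0 *\<^sub>R ?e))) (at 0 within ?U)"
  proof (rule leibniz_rule_field_derivative)
    show "((\<lambda>t. H (x + t *\<^sub>R ?e)) has_real_derivative pdiff i H (x + t *\<^sub>R ?e)) (at t within ?U)" for t x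
      by (rule has_field_derivative_at_within[OF line_has_real_derivative[OF Hsm]]) simp
    show "(\<lambda>x. H (x + t *\<^sub>R ?e)) integrable_on cbox a b" for t
      by (intro integrable_continuous continuous_on_compose2[OF Hcont] continuous_intros) auto
    show "continuous_on (?U \<times> cbox a b) (\<lambda>(t, x). pdiff i H (x + t *\<^sub>R ?e))"
      unfolding split_beta by (intro continuous_on_compose2[OF dHcont] continuous_intros) auto
  qed (use r in auto)
  then have der: "((\<lambda>t. integral (cbox a b) (\<lambda>x. H (x + t *\<^sub>R ?e))) has_real_derivative
      integral (cbox a b) (pdiff i H)) (at 0)"
    using r by (simp add: at_within_open[of 0 ?U])
  have const: "integral (cbox a b) (\<lambda>x. H (x + t *\<^sub>R ?e)) = integral UNIV H" if t: "t \<in> ?U" for t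
  proof -
    let ?c = "t *\<^sub>R ?e"
    have "integral (cbox a b) (\<lambda>x. H (x + ?c)) = integral (cbox (a + ?c) (b + ?c)) H"
      using integral_shift_cbox[of "a + ?c" ?c "b + ?c" H] by simp
    also have "\<dots> = integral UNIV (\<lambda>x. if x \<in> cbox (a + ?c) (b + ?c) then H x else 0)"
      by (simp add: integral_restrict_UNIV)
    also have "(\<lambda>x. if x \<in> cbox (a + ?c) (b + ?c) then H x else 0) = H"
    proof (rule ext)
      fix x
      \<comment> \<open>A shift by less than \<open>r\<close> moves the ball of radius
        \<open>r\<close> inside the ball of radius \<open>2 * r\<close>, so the shifted box still
        contains the support.\<close>
      have "x \<in> cbox (a + ?c) (b + ?c)" if x: "x \<in> cball x0 r"
      proof -
        have "dist x0 (x - ?c) \<le> dist x0 x + dist x (x - ?c)" by (rule dist_triangle)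
        also have "dist x (x - ?c) = \<bar>t\<bar>" by (simp add: dist_norm norm_axis_1)
        finally have "x - ?c \<in> cball x0 (2 * r)" using x t by auto
        then have "x - ?c \<in> cbox a b" using sub by blast
        then have "?c + (x - ?c) \<in> cbox (?c + a) (?c + b)"
          unfolding cbox_translation by (rule imageI)
        then show ?thesis by (simp add: add.commute)
      qed
      then show "(if x \<in> cbox (a + ?c) (b + ?c) then H x else 0) = H x" by (auto simp: H_def)
    qed
    finally show ?thesis .
  qed
  have "((\<lambda>t. integral (cbox a b) (\<lambda>x. H (x + t *\<^sub>R ?e))) has_real_derivative 0) (at 0)"
    by (rule has_field_derivative_transform_within_open[of "\<lambda>t. integral UNIV H" _ _ ?U])
      (use const r in auto)
  then have "integral (cbox a b) (pdiff i H) = 0" using der DERIV_unique by blast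
  moreover have "integral (cbox a b) (pdiff i h) = integral (cbox a b) (pdiff i H)"
  proof (rule integral_cong)
    fix x assume "x \<in> cbox a b"
    then show "pdiff i h x = pdiff i H x"
      using pdiff_cong[OF \<Omega> Hh[symmetric] h] sub by blast
  qed
  ultimately show ?thesis by simp
qed

text \<open>The difference of the integrands is the derivative along \<open>i\<close> of
  \<open>k x * pdiff i \<phi> x - pdiff i k x * \<phi> x\<close>, which vanishes off the
  ball.\<close>

lemma integral_by_parts_twice:
  fixes k \<phi> :: "real^2 \<Rightarrow> real"
  assumes \<Omega>: "open \<Omega>" and k: "smooth_on \<Omega> k" and \<phi>: "smooth_on \<Omega> \<phi>"
    and \<phi>0: "\<And>x. x \<in> \<Omega> \<Longrightarrow> x \<notin> cball x0 r \<Longrightarrow> \<phi> x = 0"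
    and r: "r > 0" and sub: "cball x0 (2 * r) \<subseteq> cbox a b" "cbox a b \<subseteq> \<Omega>"
  shows "integral (cbox a b) (\<lambda>x. k x * pdiff i (pdiff i \<phi>) x) = integral (cbox a b) (\<lambda>x. pdiff i (pdiff i k) x * \<phi> x)"
proof -
  define h where "h x = k x * pdiff i \<phi> x - pdiff i k x * \<phi> x" for x
  have hsm: "smooth_on \<Omega> h" unfolding h_def[abs_def] by (intro smooth_intros \<Omega> k \<phi>)
  have d\<phi>0: "pdiff i \<phi> x = 0" if "x \<in> \<Omega>" "x \<notin> cball x0 r" for x
  proof (rule pdiff_const_on[of "\<Omega> - cball x0 r"])
    show "open (\<Omega> - cball x0 r)" using \<Omega> by (simp add: open_Diff)
  qed (use that \<phi>0 in auto)
  have "integral (cbox a b) (pdiff i h) = 0"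
    by (rule integral_pdiff_eq_0[OF \<Omega> hsm _ r sub]) (simp add: h_def \<phi>0 d\<phi>0)
  moreover have "pdiff i h x = k x * pdiff i (pdiff i \<phi>) x - pdiff i (pdiff i k) x * \<phi> x" if "x \<in> \<Omega>" for x
  proof -
    have "pdiff i h x = pdiff i (\<lambda>x. k x * pdiff i \<phi> x) x - pdiff i (\<lambda>x. pdiff i k x * \<phi> x) x"
      unfolding h_def[abs_def] by (rule pdiff_diff[OF that]) (intro smooth_intros \<Omega> k \<phi>)+
    then show ?thesis
      by (simp add: pdiff_mult[OF that k smooth_on_pdiff[OF \<phi>]] pdiff_mult[OF that smooth_on_pdiff[OF k] \<phi>])
  qed
  then have "integral (cbox a b) (pdiff i h) =
      integral (cbox a b) (\<lambda>x. k x * pdiff i (pdiff i \<phi>) x - pdiff i (pdiff i k) x * \<phi> x)"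
    using sub by (intro integral_cong) blast
  moreover have "(\<lambda>x. k x * pdiff i (pdiff i \<phi>) x) integrable_on cbox a b"
    "(\<lambda>x. pdiff i (pdiff i k) x * \<phi> x) integrable_on cbox a b"
    by (rule integrable_continuous[OF continuous_on_subset[OF smooth_on_imp_continuous_on sub(2)]],
      intro smooth_intros \<Omega> k \<phi>)+
  ultimately show ?thesis by (simp add: integral_diff)
qed

lemma set_integral_chart_change:
  fixes \<tau> :: "real^2 \<Rightarrow> real^2" and f :: "real^2 \<Rightarrow> real"
  assumes S: "compact S" and U: "open U" "S \<subseteq> U" and \<tau>: "smooth_on U \<tau>" and inj: "inj_on \<tau> S"
    and im: "\<tau> ` S = cbox a b" and f: "continuous_on (cbox a b) f"
  shows "(LINT x : S | lborel. f (\<tau> x) * \<bar>det (matrix (frechet_derivative \<tau> (at x)))\<bar>) = integral (cbox a b) f"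
proof -
  let ?D = "\<lambda>x. \<bar>det (matrix (frechet_derivative \<tau> (at x)))\<bar>"
  have comp: "continuous_on S (\<lambda>x. pdiff j \<tau> x $ i)" for i j
    by (intro continuous_intros continuous_on_subset[OF smooth_on_imp_continuous_on[OF smooth_on_pdiff[OF \<tau>]] U(2)])
  have det: "det (matrix (frechet_derivative \<tau> (at x))) =
      pdiff 1 \<tau> x $ 1 * pdiff 2 \<tau> x $ 2 - pdiff 2 \<tau> x $ 1 * pdiff 1 \<tau> x $ 2" for x
    by (simp add: det_2 matrix_def pdiff_def)
  have \<tau>c: "continuous_on S \<tau>"
    by (rule continuous_on_subset[OF smooth_on_imp_continuous_on[OF \<tau>] U(2)])
  have cont: "continuous_on S (\<lambda>x. f (\<tau> x) * ?D x)"
    unfolding det by (intro continuous_intros comp continuous_on_compose2[OF f \<tau>c]) (use im in auto)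
  have "set_integrable lborel S (\<lambda>x. f (\<tau> x) * ?D x)"
    unfolding set_integrable_def by (rule borel_integrable_compact[OF S cont])
  then have 1: "(LINT x : S | lborel. f (\<tau> x) * ?D x) = integral S (\<lambda>x. f (\<tau> x) * ?D x)"
    by (rule set_borel_integral_eq_integral)
  \<comment> \<open>The change of variables rule applied below takes integrands with values in a
    Cartesian power, so the scalar function is wrapped into \<open>real^1\<close>.\<close>
  define F :: "real^2 \<Rightarrow> real^1" where "F x = vec (f x)" for x
  have "continuous_on (cbox a b) F"
    unfolding F_def[abs_def] vec_def by (intro continuous_on_vec_lambda f)
  then have "F absolutely_integrable_on \<tau> ` S"
    unfolding im by (rule absolutely_integrable_continuous)
  moreover have "S \<in> sets lebesgue" using S by (simp add: compact_imp_closed lmeasurable_compact fmeasurableD)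
  moreover have "(\<tau> has_derivative frechet_derivative \<tau> (at x)) (at x within S)" if "x \<in> S" for x
    using smooth_on_has_derivative[OF \<tau>] that U has_derivative_at_withinI by blast
  ultimately have "integral S (\<lambda>x. ?D x *\<^sub>R F (\<tau> x)) = integral (cbox a b) F"
    using has_absolute_integral_change_of_variables[of S \<tau> "\<lambda>x. frechet_derivative \<tau> (at x)" F "integral (\<tau> ` S) F"] inj im
    by simp
  then have "integral S (\<lambda>x. ?D x * f (\<tau> x)) = integral (cbox a b) f"
    unfolding integral_on_1_eq by (simp add: F_def)
  then show ?thesis unfolding 1 by (simp add: mult.commute)
qed

section \<open>The normal field of an isothermic surface\<close>

context canonical_param
begin

text \<open>The Hopf differential in coordinates, written without a normal field so that it can
  serve to construct one.\<close>

definition kap :: "2 \<Rightarrow> real^2 \<Rightarrow> real^5" where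
  "kap i x = pdiff i (pdiff i Y) x + (s i x / 2) *\<^sub>R Y x"

lemma smooth_kap: "smooth_on \<Omega> (kap i)"
  unfolding kap_def[abs_def] divide_inverse by (intro smooth_intros smooth_Y smooth_s open_\<Omega>)

lemma kap_perp:
  assumes x: "x \<in> \<Omega>"
  shows "ip52 (kap l x) (Y x) = 0" "ip52 (kap l x) (pdiff i Y x) = 0"
    "i \<noteq> j \<Longrightarrow> ip52 (kap l x) (pdiff i (pdiff j Y) x) = 0"
proof -
  have "ip52 (Y x) (pdiff i Y x) = 0" using dY_Y[OF x, of i] by (simp add: sprod_commute)
  then show "ip52 (kap l x) (Y x) = 0" "ip52 (kap l x) (pdiff i Y x) = 0"
    using ddY_Y[OF x, of l l] by (simp_all add: kap_def sprod_simps dYdY[OF x] YY[OF x] ddY_dY[OF x])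
  assume ij: "i \<noteq> j"
  have "ip52 (Y x) (pdiff i (pdiff j Y) x) = - 1 / 2"
    using ddY_Y[OF x, of i j] dYdY'[OF x ij] by (simp add: sprod_commute)
  then show "ip52 (kap l x) (pdiff i (pdiff j Y) x) = 0"
    by (simp add: kap_def sprod_simps ddY_mixed[OF x ij])
qed

text \<open>The first Hopf differential spans the normal line wherever it is nonzero, and its square
  is positive by \<open>null_frame_normal_pos\<close>, so it can be normalised smoothly.\<close>

lemma normal_field:
  assumes ne: "\<And>x. x \<in> \<Omega> \<Longrightarrow> kap 1 x \<noteq> 0"
  obtains n where "canonical_patch \<Omega> Y n" "\<And>x. x \<in> \<Omega> \<Longrightarrow> canonical_patch.K Y n 1 x \<noteq> 0"
    "\<And>i x. x \<in> \<Omega> \<Longrightarrow> canonical_patch.K Y n i x = ip52 (kap i x) (n x)"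
proof -
  define q where "q x = ip52 (kap 1 x) (kap 1 x)" for x
  have q: "q x > 0" if x: "x \<in> \<Omega>" for x
  proof -
    have ij: "(2::2) \<noteq> 1" by simp
    show ?thesis
      unfolding q_def by (rule null_frame_normal_pos[OF frame[OF x ij] ne[OF x]]) (simp_all add: kap_perp[OF x])
  qed
  define n where "n x = inverse (sqrt (q x)) *\<^sub>R kap 1 x" for x
  have qsm: "smooth_on \<Omega> q" unfolding q_def[abs_def] by (intro smooth_intros smooth_kap open_\<Omega>)
  have cp: "canonical_patch \<Omega> Y n"
  proof
    show "smooth_on \<Omega> n"
      unfolding n_def[abs_def]
      by (intro smooth_on_scaleR smooth_on_inverse smooth_on_sqrt smooth_kap qsm open_\<Omega>) (use q in force)+
    fix x i j assume x: "x \<in> \<Omega>"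
    show "ip52 (n x) (n x) = 1"
      using q[OF x] by (simp add: n_def sprod_simps field_simps flip: q_def)
    show "ip52 (n x) (Y x) = 0" "ip52 (n x) (pdiff i Y x) = 0"
      "i \<noteq> j \<Longrightarrow> ip52 (n x) (pdiff i (pdiff j Y) x) = 0"
      by (simp_all add: n_def sprod_simps kap_perp[OF x])
  qed
  have K: "canonical_patch.K Y n i x = ip52 (kap i x) (n x)" if x: "x \<in> \<Omega>" for i x
    using canonical_patch.nY[OF cp x]
    by (simp add: canonical_patch.K_def[OF cp] kap_def sprod_simps sprod_commute)
  show ?thesis
  proof (rule that[OF cp _ K])
    fix x assume x: "x \<in> \<Omega>"
    show "canonical_patch.K Y n 1 x \<noteq> 0"
      using q[OF x] by (simp add: K[OF x] n_def sprod_simps flip: q_def)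
  qed
qed

end

lemma canonical_liftD:
  assumes "canonical_lift A y c Y"
  shows "local_coords A c" "local_lift A y (fst c) Y" "\<And>p. p \<in> fst c \<Longrightarrow> canonical_at c Y p"
  using assms by (auto simp: canonical_lift_def)

lemma canonical_lift_param:
  assumes A: "smooth_atlas A" and L: "canonical_lift A y c Y"
  shows "canonical_param (snd c ` fst c) (in_chart c Y)"
proof
  note D = canonical_liftD[OF L]
  have ch: "is_chart c" using D(1) by (rule local_coords_is_chart)
  show "open (snd c ` fst c)" using ch by (simp add: is_chart_def)
  show "smooth_on (snd c ` fst c) (in_chart c Y)"
    using smooth_on_in_chart[OF A D(1) local_liftD(1,2)[OF D(2)]] by simp
  fix x i j assume "x \<in> snd c ` fst c"
  then obtain p where p: "p \<in> fst c" "x = snd c p" by auto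
  note g = canonical_gram[OF D(3)[OF p(1)], unfolded gram_def pd_eq_pdiff, folded p(2)]
  show "ip52 (in_chart c Y x) (in_chart c Y x) = 0"
    using local_liftD(4)[OF D(2) p(1)] by (simp add: p(2) in_chart_apply[OF ch p(1)])
  show "ip52 (pdiff i (in_chart c Y) x) (pdiff i (in_chart c Y) x) = 0"
    using g exhaust_2[of i] by auto
  show "i \<noteq> j \<Longrightarrow> ip52 (pdiff i (in_chart c Y) x) (pdiff j (in_chart c Y) x) = 1 / 2"
    using g exhaust_2[of i] exhaust_2[of j] by auto
qed

lemma canonical_lift_pd:
  assumes A: "smooth_atlas A" and L: "canonical_lift A y c Y" and p: "p \<in> fst c"
  shows "pd c i (pd c j Y) p = pdiff i (pdiff j (in_chart c Y)) (snd c p)" "in_chart c Y (snd c p) = Y p"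
proof -
  note D = canonical_liftD[OF L]
  have ch: "is_chart c" using D(1) by (rule local_coords_is_chart)
  show "pd c i (pd c j Y) p = pdiff i (pdiff j (in_chart c Y)) (snd c p)"
    by (rule pd_pd_eq_pdiff[OF ch local_liftD(1)[OF D(2)] smooth_on_in_chart[OF A D(1) local_liftD(1,2)[OF D(2)]] p p])
  show "in_chart c Y (snd c p) = Y p" by (rule in_chart_apply[OF ch p])
qed

lemma hopf_eq_kap:
  assumes A: "smooth_atlas A" and L: "canonical_lift A y c Y" and p: "p \<in> fst c"
  shows "hopf c Y i p = canonical_param.kap (in_chart c Y) i (snd c p)"
proof -
  note D = canonical_liftD[OF L]
  interpret canonical_param "snd c ` fst c" "in_chart c Y" by (rule canonical_lift_param[OF A L])
  have x: "snd c p \<in> snd c ` fst c" using p by blast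
  note e = canonical_lift_pd[OF A L p]
  have kp: "kap i (snd c p) \<in> V_perp c Y p"
    using kap_perp(1,2)[OF x, of i] kap_perp(3)[OF x, of 2 1 i] by (simp add: V_perp_iff sff_def e pd_eq_pdiff[of c _ Y] sprod_commute)
  have "pd c i (pd c i Y) p - kap i (snd c p) = (- (s i (snd c p) / 2)) *\<^sub>R Y p"
    by (simp add: kap_def e)
  also have "\<dots> \<in> V_space c Y p" unfolding V_space_def by (intro span_scale span_base) simp
  finally have kV: "pd c i (pd c i Y) p - kap i (snd c p) \<in> V_space c Y p" .
  show ?thesis by (rule hopf_eqI[OF A D(1,2) p p D(3)[OF p] kp kV])
qed

text \<open>Proportionality with factor \<open>\<sigma>\<close> of absolute value 1 means that both
  Hopf differentials vanish as soon as one does; absence of umbilics then keeps the first one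
  nonzero.\<close>

lemma isothermic_patch:
  assumes A: "smooth_atlas A" and L: "canonical_lift A y c Y" and um: "\<And>p. \<not> umbilic A y p"
    and iso: "\<And>q. q \<in> fst c \<Longrightarrow> hopf c Y 1 q = \<sigma> *\<^sub>R hopf c Y 2 q" and \<sigma>: "\<sigma> = 1 \<or> \<sigma> = - 1"
  obtains n where "canonical_patch (snd c ` fst c) (in_chart c Y) n"
    "\<And>x. x \<in> snd c ` fst c \<Longrightarrow> canonical_patch.K (in_chart c Y) n 1 x \<noteq> 0"
    "\<And>x. x \<in> snd c ` fst c \<Longrightarrow> canonical_patch.K (in_chart c Y) n 1 x = \<sigma> * canonical_patch.K (in_chart c Y) n 2 x"
proof -
  interpret canonical_param "snd c ` fst c" "in_chart c Y" by (rule canonical_lift_param[OF A L])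
  have kap: "kap 1 x = \<sigma> *\<^sub>R kap 2 x" and kap0: "kap 1 x \<noteq> 0" if x: "x \<in> snd c ` fst c" for x
  proof -
    obtain p where p: "p \<in> fst c" "x = snd c p" using x by auto
    show e: "kap 1 x = \<sigma> *\<^sub>R kap 2 x" using iso[OF p(1)] hopf_eq_kap[OF A L p(1)] p(2) by simp
    have "hopf c Y 1 p \<noteq> 0 \<or> hopf c Y 2 p \<noteq> 0"
      using um[of p] L p(1) unfolding umbilic_def by blast
    then show "kap 1 x \<noteq> 0" using hopf_eq_kap[OF A L p(1)] p(2) e \<sigma> by auto
  qed
  obtain n where n: "canonical_patch (snd c ` fst c) (in_chart c Y) n"
    "\<And>x. x \<in> snd c ` fst c \<Longrightarrow> canonical_patch.K (in_chart c Y) n 1 x \<noteq> 0"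
    "\<And>i x. x \<in> snd c ` fst c \<Longrightarrow> canonical_patch.K (in_chart c Y) n i x = ip52 (kap i x) (n x)"
    using normal_field[OF kap0] by blast
  show ?thesis
    by (rule that[OF n(1,2)]) (simp_all add: n(3) kap sprod_simps)
qed

lemma patch_V_perp:
  assumes A: "smooth_atlas A" and L: "canonical_lift A y c Y"
    and cp: "canonical_patch (snd c ` fst c) (in_chart c Y) n" and p: "p \<in> fst c"
  shows "n (snd c p) \<in> V_perp c Y p"
    and "m \<in> V_perp c Y p \<Longrightarrow> m = ip52 m (n (snd c p)) *\<^sub>R n (snd c p)"
proof -
  interpret canonical_patch "snd c ` fst c" "in_chart c Y" n by (rule cp)
  have x: "snd c p \<in> snd c ` fst c" using p by blast
  note e = canonical_lift_pd[OF A L p]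
  show np: "n (snd c p) \<in> V_perp c Y p"
    using nY[OF x] ndY[OF x] nddY[OF x, of 2 1]
    by (simp add: V_perp_iff sff_def e pd_eq_pdiff[of c _ Y] sprod_commute)
  assume m: "m \<in> V_perp c Y p"
  have ij: "(2::2) \<noteq> 1" by simp
  show "m = ip52 m (n (snd c p)) *\<^sub>R n (snd c p)"
    using m np nn[OF x] unfolding V_perp_iff
    by (intro vector_eqI[OF x ij]) (simp_all add: sprod_simps sff_def e pd_eq_pdiff[of c _ Y] sprod_commute)
qed

section \<open>The Euler--Lagrange equation\<close>

text \<open>Two charts occur because the energy is integrated in charts of the atlas, while the
  asymptotic coordinates \<open>c\<close> are merely compatible with it. The box supporting
  \<open>\<phi>\<close> is therefore placed in the common domain of \<open>c\<close> and an atlas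
  chart \<open>d\<close>.\<close>

locale surface_variation =
  normal_variation "snd c ` fst c" "in_chart c Y" n \<phi>
  for c :: "'m::t2_space chart" and Y :: "'m \<Rightarrow> real^5" and n :: "real^2 \<Rightarrow> real^5" and \<phi> :: "real^2 \<Rightarrow> real" +
  fixes A :: "'m chart set" and y :: "'m \<Rightarrow> (real^5) set" and d :: "'m chart" and a b :: "real^2"
  assumes atlas: "smooth_atlas A" and surface: "timelike_surface A y" and canonical: "canonical_lift A y c Y"
    and d: "d \<in> A" and box: "cbox a b \<subseteq> snd c ` (fst c \<inter> fst d)"
    and support: "\<And>x. x \<in> snd c ` fst c \<Longrightarrow> x \<notin> cbox a b \<Longrightarrow> \<phi> x = 0"
begin

definition Zs :: "real \<Rightarrow> 'm \<Rightarrow> real^5" where "Zs t p = Z (t, snd c p)"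

definition eta :: "real \<Rightarrow> 'm \<Rightarrow> (real^5) set" where
  "eta t p = (if p \<in> fst c then span {Zs t p} else y p)"

definition Kb :: "'m set" where "Kb = {p \<in> fst c. snd c p \<in> cbox a b}"

lemma c_coords: "local_coords A c" and c_lift: "local_lift A y (fst c) Y"
  using canonical_liftD[OF canonical] by auto

lemma c_chart: "is_chart c" and d_chart: "is_chart d" and d_coords: "local_coords A d"
  using local_coords_is_chart c_coords atlas_local_coords[OF atlas d] by blast+

lemma open_c: "open (fst c)" and open_d: "open (fst d)"
  using c_chart d_chart by (auto simp: is_chart_def)

lemma compact_Kb: "compact Kb"
proof -
  have sub: "cbox a b \<subseteq> snd c ` fst c" using box by blast
  have "Kb = inv_into (fst c) (snd c) ` cbox a b"
  proof (intro set_eqI iffI)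
    fix p assume "p \<in> Kb"
    then show "p \<in> inv_into (fst c) (snd c) ` cbox a b"
      using is_chart_inj_on[OF c_chart] by (auto simp: Kb_def intro!: image_eqI[of _ _ "snd c p"])
  next
    fix p assume "p \<in> inv_into (fst c) (snd c) ` cbox a b"
    then obtain x where "x \<in> cbox a b" "p = inv_into (fst c) (snd c) x" by auto
    then show "p \<in> Kb" using sub by (auto simp: Kb_def inv_into_into f_inv_into_f subsetD)
  qed
  moreover have "continuous_on (cbox a b) (inv_into (fst c) (snd c))"
    using is_chart_homeomorphism[OF c_chart] sub by (auto simp: homeomorphism_def intro: continuous_on_subset)
  ultimately show ?thesis by (simp add: compact_continuous_image)
qed

lemma Kb_sub: "Kb \<subseteq> fst c \<inter> fst d"
proof
  fix p assume p: "p \<in> Kb"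
  then obtain q where q: "q \<in> fst c \<inter> fst d" "snd c q = snd c p" using box by (auto simp: Kb_def)
  then have "q = p" using p is_chart_inj_on[OF c_chart] by (auto simp: Kb_def inj_on_def)
  then show "p \<in> fst c \<inter> fst d" using q by blast
qed

lemma closed_Kb: "closed Kb"
  by (rule compact_imp_closed[OF compact_Kb])

lemma Zs_smooth_joint:
  assumes "c' \<in> A"
  shows "smooth_on (UNIV \<times> snd c' ` (fst c' \<inter> fst c)) (\<lambda>(s, x). in_chart c' (Zs s) x)"
proof -
  let ?S = "snd c' ` (fst c' \<inter> fst c)"
  have ch': "is_chart c'" using atlas_local_coords[OF atlas assms] by (rule local_coords_is_chart)
  have S: "open ?S" by (rule chart_open_image[OF ch' open_c])
  then have US: "open (UNIV \<times> ?S :: (real \<times> (real^2)) set)" by (simp add: open_Times)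
  have "smooth_on (UNIV \<times> ?S) (\<lambda>z :: real \<times> (real^2). in_chart c' (snd c) (snd z))"
    by (rule smooth_on_compose[OF smooth_on_transition[OF atlas c_coords atlas_local_coords[OF atlas assms]] US S
          smooth_on_linear[OF US bounded_linear_snd]]) auto
  then have "smooth_on (UNIV \<times> ?S) (\<lambda>z :: real \<times> (real^2). (fst z, in_chart c' (snd c) (snd z)))"
    by (rule smooth_on_Pair[OF US smooth_on_linear[OF US bounded_linear_fst]])
  then have "smooth_on (UNIV \<times> ?S) (\<lambda>z. Z (fst z, in_chart c' (snd c) (snd z)))"
    by (rule smooth_on_compose[OF smooth_Z US open_T\<Omega>]) (auto simp: in_chart_apply[OF ch'])
  then show ?thesis by (simp add: in_chart_def Zs_def o_def case_prod_unfold)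
qed

lemma Zs_smooth: "smooth_map_on A (fst c) (Zs t)"
  unfolding smooth_map_on_def
proof
  fix c' assume c': "c' \<in> A"
  let ?S = "snd c' ` (fst c' \<inter> fst c)"
  have ch': "is_chart c'" using atlas_local_coords[OF atlas c'] by (rule local_coords_is_chart)
  have S: "open ?S" by (rule chart_open_image[OF ch' open_c])
  then have US: "open (UNIV \<times> ?S :: (real \<times> (real^2)) set)" by (simp add: open_Times)
  have "smooth_on ?S (\<lambda>x. (t, x))" by (intro smooth_on_Pair smooth_intros S)
  from smooth_on_compose[OF Zs_smooth_joint[OF c'] S US this]
  show "smooth_on ?S (in_chart c' (Zs t))" by auto
qed

lemma Zs_lift: "local_lift A (eta t) (fst c) (Zs t)"
  unfolding local_lift_def
  using open_c Zs_smooth Z_nonzero Z_products(1) by (auto simp: Zs_def eta_def)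

lemma Zs_pd:
  assumes p: "p \<in> fst c"
  shows "pd c i (Zs t) p = dZ i (t, snd c p)" "pd c i (pd c j (Zs t)) p = ddZ i j (t, snd c p)"
proof -
  have x: "snd c p \<in> snd c ` fst c" using p by blast
  have e: "in_chart c (Zs t) x = Z (t, x)" if "x \<in> snd c ` fst c" for x
    using that by (auto simp: in_chart_apply[OF c_chart] Zs_def)
  have sm: "smooth_on (snd c ` fst c) (in_chart c (Zs t))"
    using smooth_on_in_chart[OF atlas c_coords open_c Zs_smooth] by simp
  have e1: "pdiff i (in_chart c (Zs t)) x = pdiff i (\<lambda>x. Z (t, x)) x" if "x \<in> snd c ` fst c" for x i
    by (rule pdiff_cong[OF open_\<Omega> e sm that])
  show "pd c i (Zs t) p = dZ i (t, snd c p)" by (simp add: pd_eq_pdiff e1[OF x] pdiff_Z[OF x])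
  have "pd c i (pd c j (Zs t)) p = pdiff i (pdiff j (in_chart c (Zs t))) (snd c p)"
    using pd_pd_eq_pdiff[OF c_chart open_c _ p p] sm by simp
  also have "\<dots> = pdiff i (pdiff j (\<lambda>x. Z (t, x))) (snd c p)"
    by (rule pdiff_cong[OF open_\<Omega> e1 smooth_on_pdiff[OF sm] x])
  finally show "pd c i (pd c j (Zs t)) p = ddZ i j (t, snd c p)" by (simp add: pdiff_Z[OF x])
qed

lemma Zs_gdet: "p \<in> fst c \<Longrightarrow> gdet c (Zs t) p = G (t, snd c p)"
  by (simp add: gdet_def gram_def Zs_pd G_def gZ_def)

lemma Zs_wdens: "p \<in> fst c \<Longrightarrow> wdens c (Zs t) (\<nu> (t, snd c p)) p = wd (t, snd c p)"
  by (simp add: wdens_def wd_def Zs_gdet sdet_def gtr_def trZ_def sff_def gram_def Zs_pd bZ_def gZ_def)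

lemma eta_outside: "p \<notin> Kb \<Longrightarrow> eta t p = y p"
proof (cases "p \<in> fst c")
  case True
  assume "p \<notin> Kb"
  then have "\<phi> (snd c p) = 0" using True support[of "snd c p"] by (auto simp: Kb_def)
  then have "Zs t p = Y p" by (simp add: Zs_def Z_def P_def R_def in_chart_apply[OF c_chart True])
  then show ?thesis using True local_liftD(5)[OF c_lift True] by (simp add: eta_def)
qed (simp add: eta_def)

lemma eta_zero: "eta 0 = y"
proof
  fix p show "eta 0 p = y p"
  proof (cases "p \<in> fst c")
    case True
    then have "Zs 0 p = Y p" by (simp add: Zs_def Z_def in_chart_apply[OF c_chart True])
    then show ?thesis using True local_liftD(5)[OF c_lift True] by (simp add: eta_def)
  qed (simp add: eta_def)
qed

text \<open>Points off the compact set inherit all conditions on lifts from the unvaried surface;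
  \<open>Kb\<close> is closed, so the smaller domain is still open.\<close>

lemma local_lift_outside:
  assumes "local_lift A y1 W Y1" "\<And>p. p \<notin> Kb \<Longrightarrow> y1 p = y2 p"
  shows "local_lift A y2 (W - Kb) Y1"
proof -
  have "smooth_map_on A (W - Kb) Y1"
    using assms(1) smooth_on_subset[of _ _ "snd _ ` (fst _ \<inter> (W - Kb))"]
    unfolding local_lift_def smooth_map_on_def by (meson Diff_subset Int_mono image_mono order_refl smooth_on_subset)
  then show ?thesis using assms closed_Kb by (auto simp: local_lift_def open_Diff)
qed

text \<open>Uniformity over the box comes from compactness: an open set containing the time zero
  slice of the box contains a tube around it.\<close>

lemma obtain_\<epsilon>:
  obtains \<epsilon> where "\<epsilon> > 0" "\<And>t x. t \<in> {- \<epsilon><..<\<epsilon>} \<Longrightarrow> x \<in> cbox a b \<Longrightarrow> (t, x) \<in> good"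
proof -
  have "{0} \<times> cbox a b \<subseteq> good" using at_zero(13) box by auto
  from Elementary_Topology.tube_lemma[OF compact_cbox open_good this]
  obtain X where X: "0 \<in> X" "open X" "X \<times> cbox a b \<subseteq> good" by blast
  then obtain \<epsilon> where "\<epsilon> > 0" "ball 0 \<epsilon> \<subseteq> X" using open_contains_ball by blast
  then show ?thesis using X by (intro that[of \<epsilon>]) (auto simp: dist_norm subset_eq)
qed

context
  fixes \<epsilon> :: real
  assumes \<epsilon>: "\<epsilon> > 0" and good_\<epsilon>: "\<And>t x. t \<in> {- \<epsilon><..<\<epsilon>} \<Longrightarrow> x \<in> cbox a b \<Longrightarrow> (t, x) \<in> good"
begin

lemma eta_timelike:
  assumes t: "t \<in> {- \<epsilon><..<\<epsilon>}"
  shows "timelike_surface A (eta t)"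
  unfolding timelike_surface_def
proof (intro conjI allI impI ballI)
  fix p
  show "eta t p \<in> Q31"
  proof (cases "p \<in> fst c")
    case True
    then show ?thesis using Z_nonzero Z_products(1) by (force simp: eta_def Zs_def Q31_def)
  next
    case False
    then show ?thesis using surface by (simp add: eta_def timelike_surface_def)
  qed
  show "\<exists>W Y. p \<in> W \<and> local_lift A (eta t) W Y"
  proof (cases "p \<in> fst c")
    case True
    then show ?thesis using Zs_lift by blast
  next
    case False
    obtain W Y1 where "p \<in> W" "local_lift A y W Y1" using surface unfolding timelike_surface_def by blast
    then have "local_lift A (eta t) (W - Kb) Y1" using local_lift_outside eta_outside by metis
    moreover have "p \<in> W - Kb" using \<open>p \<in> W\<close> False by (auto simp: Kb_def)
    ultimately show ?thesis by blast
  qed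
next
  fix W Y1 c' p assume Y1: "local_lift A (eta t) W Y1" and c': "c' \<in> A" and p: "p \<in> fst c' \<inter> W"
  note c'_coords = atlas_local_coords[OF atlas c']
  have *: "(\<forall>h. differential c' Y1 p h \<in> span {Y1 p} \<longrightarrow> h = 0) \<and>
      lorentzian (\<lambda>h k. ip52 (differential c' Y1 p h) (differential c' Y1 p k))"
  \<comment> \<open>On \<open>Kb\<close> the sign of \<open>gdet\<close> for the explicit lift
    decides; elsewhere the given lift also lifts \<open>y\<close>.\<close>
  proof (cases "p \<in> Kb")
    case True
    then have pc: "p \<in> fst c" "snd c p \<in> cbox a b" by (auto simp: Kb_def)
    then have "gdet c (Zs t) p < 0" using good_\<epsilon>[OF t pc(2)] by (simp add: Zs_gdet good_def)
    then show ?thesis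
      using timelike_of_gdet[OF atlas c_coords c'_coords Zs_lift Y1 pc(1) pc(1)] p by blast
  next
    case False
    have "local_lift A y (W - Kb) Y1" by (rule local_lift_outside[OF Y1 eta_outside])
    moreover have "p \<in> fst c' \<inter> (W - Kb)" using p False by blast
    ultimately show ?thesis using surface c' unfolding timelike_surface_def by blast
  qed
  then show "lorentzian (\<lambda>h k. ip52 (differential c' Y1 p h) (differential c' Y1 p k))" by blast
  show "h = 0" if "differential c' Y1 p h \<in> span {Y1 p}" for h using * that by blast
qed

lemma eta_variation: "timelike_variation A y Kb \<epsilon> eta"
  unfolding timelike_variation_def
proof (intro conjI ballI allI impI compact_Kb \<epsilon> eta_zero eta_timelike eta_outside)
  fix t p assume t: "t \<in> {- \<epsilon><..<\<epsilon>}"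
  have I: "open {- \<epsilon><..<\<epsilon>}" by simp
  have sub: "{- \<epsilon><..<\<epsilon>} \<times> S \<subseteq> UNIV \<times> S" for S :: "(real^2) set" by auto
  show "\<exists>I W Y. t \<in> I \<and> open I \<and> p \<in> W \<and> open W \<and>
       (\<forall>s\<in>I. \<forall>q\<in>W. Y s q \<noteq> 0 \<and> eta s q = span {Y s q}) \<and>
       (\<forall>c\<in>A. smooth_on (I \<times> snd c ` (fst c \<inter> W)) (\<lambda>(s, x). in_chart c (Y s) x))"
  proof (cases "p \<in> fst c")
    case True
    have "(\<forall>s\<in>{- \<epsilon><..<\<epsilon>}. \<forall>q\<in>fst c. Zs s q \<noteq> 0 \<and> eta s q = span {Zs s q})"
      using Z_nonzero by (auto simp: Zs_def eta_def)
    moreover have "(\<forall>c'\<in>A. smooth_on ({- \<epsilon><..<\<epsilon>} \<times> snd c' ` (fst c' \<inter> fst c)) (\<lambda>(s, x). in_chart c' (Zs s) x))"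
      using smooth_on_subset[OF Zs_smooth_joint sub] by blast
    ultimately show ?thesis
      using t I True open_c by (intro exI[of _ "{- \<epsilon><..<\<epsilon>}"] exI[of _ "fst c"] exI[of _ Zs] conjI)
  next
    case False
    obtain W Y1 where W: "p \<in> W" "local_lift A y W Y1" using surface unfolding timelike_surface_def by blast
    have L: "local_lift A (eta s) (W - Kb) Y1" for s
      by (rule local_lift_outside[OF W(2)]) (simp add: eta_outside)
    note D = local_liftD[OF L]
    have "p \<in> W - Kb" using W False by (auto simp: Kb_def)
    moreover have "\<forall>s\<in>{- \<epsilon><..<\<epsilon>}. \<forall>q\<in>W - Kb. Y1 q \<noteq> 0 \<and> eta s q = span {Y1 q}" using D(3,5) by blast
    moreover have "smooth_on ({- \<epsilon><..<\<epsilon>} \<times> snd c' ` (fst c' \<inter> (W - Kb))) (\<lambda>(s, x). in_chart c' Y1 x)" if c': "c' \<in> A" for c'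
    proof -
      let ?S = "snd c' ` (fst c' \<inter> (W - Kb))"
      have S: "open ?S"
        by (rule chart_open_image[OF local_coords_is_chart[OF atlas_local_coords[OF atlas c']] D(1)])
      then have IS: "open ({- \<epsilon><..<\<epsilon>} \<times> ?S)" by (simp add: open_Times)
      have "smooth_on ?S (in_chart c' Y1)" using D(2) c' by (simp add: smooth_map_on_def)
      then have "smooth_on ({- \<epsilon><..<\<epsilon>} \<times> ?S) (\<lambda>z. in_chart c' Y1 (snd z))"
        by (rule smooth_on_compose[OF _ IS S smooth_on_linear[OF IS bounded_linear_snd]]) auto
      then show ?thesis by (simp add: case_prod_unfold)
    qed
    ultimately show ?thesis
      using t I D(1) by (intro exI[of _ "{- \<epsilon><..<\<epsilon>}"] exI[of _ "W - Kb"] exI[of _ "\<lambda>s. Y1"] conjI) auto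
  qed
qed

text \<open>The density is explicit in the coordinates \<open>c\<close> but integrated in the atlas
  chart \<open>d\<close>; the Jacobian in \<open>willmore_density_eq\<close> is exactly the one that
  the change of variables absorbs.\<close>

lemma eta_energy:
  assumes t: "t \<in> {- \<epsilon><..<\<epsilon>}"
  shows "willmore_energy A {(d, Kb)} (eta t) = integral (cbox a b) (\<lambda>x. wd (t, x))"
proof -
  let ?\<tau> = "in_chart d (snd c)" and ?S = "snd d ` Kb"
  let ?U = "snd d ` (fst d \<inter> fst c)"
  have U: "open ?U" by (rule chart_open_image[OF d_chart open_c])
  have SU: "?S \<subseteq> ?U" using Kb_sub by blast
  have \<tau>: "smooth_on ?U ?\<tau>" by (rule smooth_on_transition[OF atlas c_coords d_coords])
  have \<tau>d: "?\<tau> (snd d p) = snd c p" if "p \<in> Kb" for p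
    using that Kb_sub in_chart_apply[OF d_chart] by blast
  have "continuous_on Kb (snd d)"
    using is_chart_homeomorphism[OF d_chart] Kb_sub by (auto simp: homeomorphism_def intro: continuous_on_subset)
  then have S: "compact ?S" by (rule compact_continuous_image[OF _ compact_Kb])
  have inj: "inj_on ?\<tau> ?S"
  proof (rule inj_onI)
    fix x x' assume "x \<in> ?S" "x' \<in> ?S" "?\<tau> x = ?\<tau> x'"
    then obtain p q where pq: "p \<in> Kb" "q \<in> Kb" "x = snd d p" "x' = snd d q" "?\<tau> (snd d p) = ?\<tau> (snd d q)"
      by blast
    then have "snd c p = snd c q" using \<tau>d[OF pq(1)] \<tau>d[OF pq(2)] by simp
    then have "p = q" using inj_onD[OF is_chart_inj_on[OF c_chart]] pq(1,2) by (auto simp: Kb_def)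
    then show "x = x'" using pq by simp
  qed
  have im: "?\<tau> ` ?S = cbox a b"
  proof -
    have "?\<tau> ` ?S = snd c ` Kb" unfolding image_image by (rule image_cong[OF refl \<tau>d])
    also have "\<dots> = cbox a b" using box by (auto simp: Kb_def)
    finally show ?thesis .
  qed
  have cont: "continuous_on (cbox a b) (\<lambda>x. wd (t, x))"
    by (rule continuous_on_compose2[OF smooth_on_imp_continuous_on[OF smooth_wd]])
      (use good_\<epsilon>[OF t] in \<open>auto intro!: continuous_intros\<close>)
  have "willmore_energy A {(d, Kb)} (eta t) = (LINT x : ?S | lborel. in_chart d (willmore_density A (eta t) d) x)"
    by (simp add: willmore_energy_def)
  also have "\<dots> = (LINT x : ?S | lborel. wd (t, ?\<tau> x) * \<bar>det (matrix (frechet_derivative ?\<tau> (at x)))\<bar>)"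
  proof (rule set_lebesgue_integral_cong)
    show "?S \<in> sets lborel" using S by (simp add: borel_compact)
    show "\<forall>x. x \<in> ?S \<longrightarrow> in_chart d (willmore_density A (eta t) d) x =
        wd (t, ?\<tau> x) * \<bar>det (matrix (frechet_derivative ?\<tau> (at x)))\<bar>"
    proof (intro allI impI)
      fix x assume "x \<in> ?S"
      then obtain p where p: "p \<in> Kb" "x = snd d p" by blast
      then have pc: "p \<in> fst c" "snd c p \<in> cbox a b" and pd: "p \<in> fst d" using Kb_sub by (auto simp: Kb_def)
      have xc: "snd c p \<in> snd c ` fst c" using pc by blast
      have g: "G (t, snd c p) < 0" "ip52 (\<nu> (t, snd c p)) (\<nu> (t, snd c p)) \<noteq> 0"
        using good_\<epsilon>[OF t pc(2)] by (auto simp: good_def)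
      have "willmore_density A (eta t) d p =
          wdens c (Zs t) (\<nu> (t, snd c p)) p * \<bar>det (matrix (differential d (snd c) p))\<bar>"
        by (rule willmore_density_eq[OF atlas c_coords d_coords Zs_lift pc(1) pc(1) pd])
          (use g \<nu>_Z[OF xc, of t] \<nu>_dZ in \<open>simp_all add: Zs_gdet[OF pc(1)] Zs_pd[OF pc(1)] Zs_def\<close>)
      then show "in_chart d (willmore_density A (eta t) d) x =
          wd (t, ?\<tau> x) * \<bar>det (matrix (frechet_derivative ?\<tau> (at x)))\<bar>"
        by (simp add: p(2) in_chart_apply[OF d_chart pd] Zs_wdens[OF pc(1)] differential_def)
    qed
  qed
  also have "\<dots> = integral (cbox a b) (\<lambda>x. wd (t, x))"
    by (rule set_integral_chart_change[OF S U SU \<tau> inj im cont])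
  finally show ?thesis .
qed

lemma integral_wd_derivative:
  "((\<lambda>t. integral (cbox a b) (\<lambda>x. wd (t, x))) has_real_derivative integral (cbox a b) (\<lambda>x.
    2 * (K 2 x * (pdiff 1 (pdiff 1 \<phi>) x + s 1 x / 2 * \<phi> x) + K 1 x * (pdiff 2 (pdiff 2 \<phi>) x + s 2 x / 2 * \<phi> x)))) (at 0)"
proof -
  let ?U = "{- \<epsilon><..<\<epsilon>}"
  \<comment> \<open>This abstract derivative is continuous in time and point together, as
    differentiation under the integral requires; the explicit formula is available at time zero
    only.\<close>
  let ?f' = "\<lambda>t x. frechet_derivative wd (at (t, x)) (1, 0)"
  have der: "((\<lambda>t. wd (t, x)) has_real_derivative ?f' t x) (at t)" if "t \<in> ?U" "x \<in> cbox a b" for t x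
  proof -
    have "((\<lambda>t. (t, x)) has_derivative (\<lambda>h. (h, 0))) (at t)" by (auto intro!: derivative_eq_intros)
    from has_derivative_compose[OF this smooth_on_has_derivative[OF smooth_wd good_\<epsilon>[OF that]]]
    have D: "((\<lambda>t. wd (t, x)) has_derivative (\<lambda>h. frechet_derivative wd (at (t, x)) (h, 0))) (at t)" .
    have lin: "linear (frechet_derivative wd (at (t, x)))"
      by (rule has_derivative_linear[OF smooth_on_has_derivative[OF smooth_wd good_\<epsilon>[OF that]]])
    have "frechet_derivative wd (at (t, x)) (h, 0) = ?f' t x * h" for h
      using linear_scale[OF lin, of h "(1, 0)"] by simp
    then show ?thesis
      unfolding has_field_derivative_def by (intro has_derivative_eq_rhs[OF D] ext)
  qed
  have "((\<lambda>t. integral (cbox a b) (\<lambda>x. wd (t, x))) has_real_derivative integral (cbox a b) (?f' 0)) (at 0 within ?U)"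
  proof (rule leibniz_rule_field_derivative)
    show "((\<lambda>t. wd (t, x)) has_real_derivative ?f' t x) (at t within ?U)" if "t \<in> ?U" "x \<in> cbox a b" for t x
      by (rule has_field_derivative_at_within[OF der[OF that]])
    show "(\<lambda>x. wd (t, x)) integrable_on cbox a b" if "t \<in> ?U" for t
      by (intro integrable_continuous continuous_on_compose2[OF smooth_on_imp_continuous_on[OF smooth_wd]])
        (use good_\<epsilon>[OF that] in \<open>auto intro!: continuous_intros\<close>)
    show "continuous_on (?U \<times> cbox a b) (\<lambda>(t, x). ?f' t x)"
    proof -
      have "?U \<times> cbox a b \<subseteq> good" using good_\<epsilon> by blast
      from continuous_on_subset[OF smooth_on_imp_continuous_on[OF smooth_on_frechet_derivative[OF smooth_wd]] this]
      show ?thesis by (simp add: case_prod_unfold)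
    qed
  qed (use \<epsilon> in auto)
  moreover have "integral (cbox a b) (?f' 0) = integral (cbox a b) (\<lambda>x.
    2 * (K 2 x * (pdiff 1 (pdiff 1 \<phi>) x + s 1 x / 2 * \<phi> x) + K 1 x * (pdiff 2 (pdiff 2 \<phi>) x + s 2 x / 2 * \<phi> x)))"
  proof (rule integral_cong)
    fix x assume x: "x \<in> cbox a b"
    then have "x \<in> snd c ` fst c" using box by blast
    from wd_has_derivative[OF this] der[OF _ x, of 0]
    show "?f' 0 x = 2 * (K 2 x * (pdiff 1 (pdiff 1 \<phi>) x + s 1 x / 2 * \<phi> x) + K 1 x * (pdiff 2 (pdiff 2 \<phi>) x + s 2 x / 2 * \<phi> x))"
      using \<epsilon> DERIV_unique by force
  qed
  ultimately show ?thesis using \<epsilon> by (simp add: at_within_open[of 0 ?U])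
qed

lemma first_variation:
  assumes "willmore A y"
  shows "integral (cbox a b) (\<lambda>x. 2 * (K 2 x * (pdiff 1 (pdiff 1 \<phi>) x + s 1 x / 2 * \<phi> x) +
    K 1 x * (pdiff 2 (pdiff 2 \<phi>) x + s 2 x / 2 * \<phi> x))) = 0"
proof -
  have "chart_partition A Kb {(d, Kb)}"
    unfolding chart_partition_def
    using d closed_Kb Kb_sub by (auto simp: disjoint_family_on_def)
  then have "((\<lambda>t. willmore_energy A {(d, Kb)} (eta t)) has_real_derivative 0) (at 0)"
    using assms eta_variation unfolding willmore_def by blast
  then have "((\<lambda>t. integral (cbox a b) (\<lambda>x. wd (t, x))) has_real_derivative 0) (at 0)"
    by (rule has_field_derivative_transform_within_open[where S="{- \<epsilon><..<\<epsilon>}"]) (use \<epsilon> eta_energy in auto)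
  then show ?thesis using integral_wd_derivative DERIV_unique by blast
qed

end

end

text \<open>The test function is a bump \<open>\<beta>\<close> times the Euler-Lagrange expression
  \<open>E\<close> itself. After integration by parts the first variation is the integral of
  \<open>2 * (\<beta> x * (E x)\<^sup>2)\<close>, which is continuous and nonnegative, hence zero at
  \<open>x0\<close>.\<close>

theorem willmore_euler_lagrange:
  fixes c :: "'m::t2_space chart"
  assumes A: "smooth_atlas A" and T: "timelike_surface A y" and W: "willmore A y" and L: "canonical_lift A y c Y"
    and cp: "canonical_patch (snd c ` fst c) (in_chart c Y) n"
    and x0: "x0 \<in> snd c ` fst c"
  defines "K \<equiv> canonical_patch.K (in_chart c Y) n" and "s \<equiv> canonical_param.s (in_chart c Y)"
  shows "pdiff 1 (pdiff 1 (K 2)) x0 + s 1 x0 / 2 * K 2 x0 + (pdiff 2 (pdiff 2 (K 1)) x0 + s 2 x0 / 2 * K 1 x0) = 0"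
proof -
  interpret cp: canonical_patch "snd c ` fst c" "in_chart c Y" n by (rule cp)
  let ?\<Omega> = "snd c ` fst c"
  note D = canonical_liftD[OF L]
  have ch: "is_chart c" using D(1) by (rule local_coords_is_chart)
  define E where "E x = pdiff 1 (pdiff 1 (K 2)) x + s 1 x / 2 * K 2 x + (pdiff 2 (pdiff 2 (K 1)) x + s 2 x / 2 * K 1 x)" for x
  have Ksm: "smooth_on ?\<Omega> (K i)" for i unfolding K_def by (rule cp.smooth_K)
  have ssm: "smooth_on ?\<Omega> (s i)" for i unfolding s_def by (rule cp.smooth_s)
  have Esm: "smooth_on ?\<Omega> E"
    unfolding E_def[abs_def] divide_inverse by (intro smooth_intros cp.open_\<Omega> Ksm ssm)
  obtain p0 where p0: "p0 \<in> fst c" "x0 = snd c p0" using x0 by auto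
  obtain d where d: "d \<in> A" "p0 \<in> fst d" using atlas_covers[OF A] .
  have "open (fst d)" using A d by (auto simp: smooth_atlas_def is_chart_def)
  then have "open (snd c ` (fst c \<inter> fst d))" by (rule chart_open_image[OF ch])
  moreover have "x0 \<in> snd c ` (fst c \<inter> fst d)" using p0 d by blast
  ultimately obtain a b where ab: "x0 \<in> box a b" "cbox a b \<subseteq> snd c ` (fst c \<inter> fst d)"
    using open_contains_cbox by metis
  have sub: "cbox a b \<subseteq> ?\<Omega>" using ab(2) by blast
  obtain \<rho> where \<rho>: "\<rho> > 0" "ball x0 \<rho> \<subseteq> box a b" using ab(1) open_contains_ball open_box by blast
  \<comment> \<open>A third of the radius leaves room for the ball of radius \<open>2 * r\<close>
    that the integration by parts requires.\<close>
  define r where "r = \<rho> / 3"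
  have r: "r > 0" using \<rho> by (simp add: r_def)
  have "cball x0 (2 * r) \<subseteq> ball x0 \<rho>" using \<rho> by (auto simp: r_def)
  then have cb: "cball x0 (2 * r) \<subseteq> cbox a b" using \<rho> box_subset_cbox by blast
  obtain \<beta> :: "real^2 \<Rightarrow> real" where \<beta>: "smooth_on UNIV \<beta>" "\<And>x. \<beta> x \<ge> 0" "\<beta> x0 > 0" "\<And>x. x \<notin> ball x0 r \<Longrightarrow> \<beta> x = 0"
    using smooth_bump[OF r] by blast
  define \<phi> where "\<phi> x = \<beta> x * E x" for x
  have \<phi>sm: "smooth_on ?\<Omega> \<phi>"
    unfolding \<phi>_def[abs_def] by (intro smooth_intros cp.open_\<Omega> Esm smooth_on_subset[OF \<beta>(1)]) simp
  have \<phi>0: "\<phi> x = 0" if "x \<notin> cball x0 r" for x using \<beta>(4)[of x] that by (auto simp: \<phi>_def)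
  have "cball x0 r \<subseteq> cbox a b" using cb r by (auto simp: subset_eq)
  then have \<phi>1: "\<phi> x = 0" if "x \<notin> cbox a b" for x using \<phi>0 that by blast
  interpret sv: surface_variation c Y n \<phi> A y d a b
    by unfold_locales (use \<phi>sm A T L d ab \<phi>1 in auto)
  obtain \<epsilon> where \<epsilon>: "\<epsilon> > 0" "\<And>t x. t \<in> {- \<epsilon><..<\<epsilon>} \<Longrightarrow> x \<in> cbox a b \<Longrightarrow> (t, x) \<in> sv.good"
    using sv.obtain_\<epsilon> by blast
  have int0: "integral (cbox a b) (\<lambda>x. 2 * (K 2 x * (pdiff 1 (pdiff 1 \<phi>) x + s 1 x / 2 * \<phi> x) +
    K 1 x * (pdiff 2 (pdiff 2 \<phi>) x + s 2 x / 2 * \<phi> x))) = 0"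
    unfolding K_def s_def by (rule sv.first_variation[OF \<epsilon> W])
  have intg: "f integrable_on cbox a b" if "smooth_on ?\<Omega> f" for f :: "real^2 \<Rightarrow> real"
    by (rule integrable_continuous[OF continuous_on_subset[OF smooth_on_imp_continuous_on[OF that] sub]])
  have parts: "integral (cbox a b) (\<lambda>x. K l x * pdiff j (pdiff j \<phi>) x) =
      integral (cbox a b) (\<lambda>x. pdiff j (pdiff j (K l)) x * \<phi> x)" for j l
    by (rule integral_by_parts_twice[OF cp.open_\<Omega> Ksm \<phi>sm _ r cb sub]) (rule \<phi>0)
  have i: "(\<lambda>x. K l x * pdiff j (pdiff j \<phi>) x) integrable_on cbox a b"
    "(\<lambda>x. pdiff j (pdiff j (K l)) x * \<phi> x) integrable_on cbox a b"
    "(\<lambda>x. s j x / 2 * K l x * \<phi> x) integrable_on cbox a b" for j l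
    unfolding divide_inverse by (rule intg, intro smooth_intros cp.open_\<Omega> Ksm ssm \<phi>sm)+
  have "0 = integral (cbox a b) (\<lambda>x. 2 * ((K 2 x * pdiff 1 (pdiff 1 \<phi>) x + s 1 x / 2 * K 2 x * \<phi> x) +
      (K 1 x * pdiff 2 (pdiff 2 \<phi>) x + s 2 x / 2 * K 1 x * \<phi> x)))"
    unfolding int0[symmetric] by (rule integral_cong) (simp add: algebra_simps)
  also have "\<dots> = 2 * ((integral (cbox a b) (\<lambda>x. K 2 x * pdiff 1 (pdiff 1 \<phi>) x) + integral (cbox a b) (\<lambda>x. s 1 x / 2 * K 2 x * \<phi> x)) +
      (integral (cbox a b) (\<lambda>x. K 1 x * pdiff 2 (pdiff 2 \<phi>) x) + integral (cbox a b) (\<lambda>x. s 2 x / 2 * K 1 x * \<phi> x)))"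
    using i by (simp only: integral_mult_right integral_add integrable_add)
  also have "\<dots> = 2 * ((integral (cbox a b) (\<lambda>x. pdiff 1 (pdiff 1 (K 2)) x * \<phi> x) + integral (cbox a b) (\<lambda>x. s 1 x / 2 * K 2 x * \<phi> x)) +
      (integral (cbox a b) (\<lambda>x. pdiff 2 (pdiff 2 (K 1)) x * \<phi> x) + integral (cbox a b) (\<lambda>x. s 2 x / 2 * K 1 x * \<phi> x)))"
    unfolding parts ..
  also have "\<dots> = integral (cbox a b) (\<lambda>x. 2 * ((pdiff 1 (pdiff 1 (K 2)) x * \<phi> x + s 1 x / 2 * K 2 x * \<phi> x) +
      (pdiff 2 (pdiff 2 (K 1)) x * \<phi> x + s 2 x / 2 * K 1 x * \<phi> x)))"
    using i by (simp only: integral_mult_right integral_add integrable_add)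
  also have "\<dots> = integral (cbox a b) (\<lambda>x. 2 * (\<beta> x * (E x)\<^sup>2))"
    by (rule integral_cong) (simp add: \<phi>_def E_def power2_eq_square algebra_simps)
  finally have "integral (cbox a b) (\<lambda>x. 2 * (\<beta> x * (E x)\<^sup>2)) = 0" by simp
  moreover have sm: "smooth_on ?\<Omega> (\<lambda>x. 2 * (\<beta> x * (E x)\<^sup>2))"
    by (intro smooth_intros cp.open_\<Omega> Esm smooth_on_subset[OF \<beta>(1)]) simp
  ultimately have "((\<lambda>x. 2 * (\<beta> x * (E x)\<^sup>2)) has_integral 0) (cbox a b)"
    using intg[OF sm] by (metis integrable_integral)
  then have "2 * (\<beta> x0 * (E x0)\<^sup>2) = 0"
    using \<beta>(2) ab(1) subsetD[OF box_subset_cbox ab(1)]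
    by (intro has_integral_0_cbox_imp_0[OF continuous_on_subset[OF smooth_on_imp_continuous_on[OF sm] sub],
          where x=x0]) auto
  then have "E x0 = 0" using \<beta>(3) by simp
  then show ?thesis by (simp add: E_def)
qed

section \<open>The constant vector\<close>

text \<open>Minimality with respect to the space form determined by \<open>v\<close> means that the normal of \<open>V\<close>, the central
  sphere congruence, is orthogonal to \<open>v\<close>.\<close>

definition perp_at :: "'m::topological_space chart set \<Rightarrow> ('m \<Rightarrow> (real^5) set) \<Rightarrow> real^5 \<Rightarrow> 'm \<Rightarrow> bool" where
  "perp_at A y v p \<longleftrightarrow> (\<forall>c Y \<nu>. canonical_lift A y c Y \<longrightarrow> p \<in> fst c \<longrightarrow> \<nu> \<in> V_perp c Y p \<longrightarrow> ip52 \<nu> v = 0)"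

lemma perp_at_linear:
  "perp_at A y v p \<Longrightarrow> perp_at A y w p \<Longrightarrow> perp_at A y (a *\<^sub>R v - b *\<^sub>R w) p"
  "perp_at A y v p \<Longrightarrow> perp_at A y (a *\<^sub>R v) p"
  by (auto simp: perp_at_def sprod_simps)

text \<open>One patch suffices: the normal space does not depend on the canonical data by
  \<open>V_perp_change\<close>, and it is the line through \<open>n\<close>.\<close>

lemma perp_atI:
  assumes A: "smooth_atlas A" and L: "canonical_lift A y c Y" and p: "p \<in> fst c"
    and cp: "canonical_patch (snd c ` fst c) (in_chart c Y) n" and v: "ip52 (n (snd c p)) v = 0"
  shows "perp_at A y v p"
  unfolding perp_at_def
proof (intro allI impI)
  fix c' Y' \<nu> assume L': "canonical_lift A y c' Y'" and p': "p \<in> fst c'" and \<nu>: "\<nu> \<in> V_perp c' Y' p"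
  note D = canonical_liftD[OF L] and D' = canonical_liftD[OF L']
  have "\<nu> \<in> V_perp c Y p"
    by (rule V_perp_change[OF A D'(1) D(1) D'(2) D(2) p' p' p p D'(3)[OF p'] D(3)[OF p] \<nu>])
  then have "\<nu> = ip52 \<nu> (n (snd c p)) *\<^sub>R n (snd c p)" by (rule patch_V_perp(2)[OF A L cp p])
  then have "ip52 \<nu> v = ip52 (ip52 \<nu> (n (snd c p)) *\<^sub>R n (snd c p)) v" by simp
  then show "ip52 \<nu> v = 0" using v by (simp add: sprod_simps)
qed

lemma canonical_patch_subset:
  assumes "canonical_patch \<Omega> Y n" "open B" "B \<subseteq> \<Omega>"
  shows "canonical_patch B Y n"
proof -
  interpret canonical_patch \<Omega> Y n by fact
  show ?thesis
    using assms YY dYdY dYdY' nn nY ndY nddY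
    by unfold_locales (auto intro: smooth_on_subset[OF smooth_Y] smooth_on_subset[OF smooth_n])
qed

locale isothermic_willmore =
  fixes A :: "'m::t2_space chart set" and y :: "'m \<Rightarrow> (real^5) set" and \<sigma> :: real
  assumes atlas: "smooth_atlas A" and surface: "timelike_surface A y" and willmore: "willmore A y"
    and iso: "isothermic_sgn \<sigma> A y" and \<sigma>: "\<sigma> = 1 \<or> \<sigma> = - 1"
begin

lemma patch:
  obtains c Y n where "p \<in> fst c" "canonical_lift A y c Y" "canonical_patch (snd c ` fst c) (in_chart c Y) n"
    "\<And>i x. x \<in> snd c ` fst c \<Longrightarrow> canonical_patch.K (in_chart c Y) n i x \<noteq> 0"
    "\<And>x. x \<in> snd c ` fst c \<Longrightarrow> canonical_patch.K (in_chart c Y) n 2 x = \<sigma> * canonical_patch.K (in_chart c Y) n 1 x"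
proof -
  obtain c Y where c: "p \<in> fst c" "canonical_lift A y c Y"
    and h: "\<And>q. q \<in> fst c \<Longrightarrow> hopf c Y 1 q = \<sigma> *\<^sub>R hopf c Y 2 q"
    using iso unfolding isothermic_sgn_def by blast
  have um: "\<And>p. \<not> umbilic A y p" using iso by (simp add: isothermic_sgn_def)
  obtain n where n: "canonical_patch (snd c ` fst c) (in_chart c Y) n"
    "\<And>x. x \<in> snd c ` fst c \<Longrightarrow> canonical_patch.K (in_chart c Y) n 1 x \<noteq> 0"
    "\<And>x. x \<in> snd c ` fst c \<Longrightarrow> canonical_patch.K (in_chart c Y) n 1 x = \<sigma> * canonical_patch.K (in_chart c Y) n 2 x"
    using isothermic_patch[OF atlas c(2) um h \<sigma>] by blast
  have K2: "canonical_patch.K (in_chart c Y) n 2 x = \<sigma> * canonical_patch.K (in_chart c Y) n 1 x"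
    if "x \<in> snd c ` fst c" for x
    using n(3)[OF that] \<sigma> by auto
  have K0: "canonical_patch.K (in_chart c Y) n i x \<noteq> 0" if "x \<in> snd c ` fst c" for i x
    using n(2)[OF that] K2[OF that] \<sigma> exhaust_2[of i] by auto
  show ?thesis by (rule that[OF c n(1) K0 K2])
qed

lemma local_vector:
  obtains U v where "open U" "p \<in> U" "v \<noteq> 0" "\<And>q. q \<in> U \<Longrightarrow> perp_at A y v q"
proof -
  obtain c Y n where c: "p \<in> fst c" and L: "canonical_lift A y c Y"
    and cp: "canonical_patch (snd c ` fst c) (in_chart c Y) n"
    and K0: "\<And>i x. x \<in> snd c ` fst c \<Longrightarrow> canonical_patch.K (in_chart c Y) n i x \<noteq> 0"
    and K2: "\<And>x. x \<in> snd c ` fst c \<Longrightarrow> canonical_patch.K (in_chart c Y) n 2 x = \<sigma> * canonical_patch.K (in_chart c Y) n 1 x"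
    by (rule patch[of p]) (rule that; (assumption | blast))
  interpret canonical_patch "snd c ` fst c" "in_chart c Y" n by (rule cp)
  have ch: "is_chart c" using canonical_liftD(1)[OF L] by (rule local_coords_is_chart)
  have eq2: "pdiff 2 (pdiff 2 (K 1)) x + s 2 x / 2 * K 1 x = 0"
    and eq1: "pdiff 1 (pdiff 1 (K 2)) x + s 1 x / 2 * K 2 x = 0" if x: "x \<in> snd c ` fst c" for x
  proof -
    have "pdiff 1 (pdiff 1 (K 2)) x + s 1 x / 2 * K 2 x + (pdiff 2 (pdiff 2 (K 1)) x + s 2 x / 2 * K 1 x) = 0"
      by (rule willmore_euler_lagrange[OF atlas surface willmore L cp x])
    moreover have "pdiff 2 (pdiff 2 (K 1)) x + s 2 x / 2 * K 1 x = pdiff 1 (pdiff 1 (K 2)) x + s 1 x / 2 * K 2 x"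
      by (rule codazzi[OF x]) simp
    ultimately show "pdiff 2 (pdiff 2 (K 1)) x + s 2 x / 2 * K 1 x = 0"
      "pdiff 1 (pdiff 1 (K 2)) x + s 1 x / 2 * K 2 x = 0" by linarith+
  qed
  \<comment> \<open>As \<open>\<sigma>\<close> is constant with absolute value 1, the equation for
    \<open>K 2\<close> becomes one for \<open>K 1\<close>, and both directions now concern a single
    function.\<close>
  have eq: "pdiff i (pdiff i (K 1)) x + s i x / 2 * K 1 x = 0" if x: "x \<in> snd c ` fst c" for i x
  proof (cases "i = 1")
    case True
    have d1: "pdiff 1 (K 2) x = \<sigma> * pdiff 1 (K 1) x" if "x \<in> snd c ` fst c" for x
      using pdiff_cong[OF open_\<Omega> K2 smooth_K that, of 1] pdiff_mult[OF that smooth_on_const smooth_K, of 1 \<sigma> 1] by simp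
    have "pdiff 1 (pdiff 1 (K 2)) x = \<sigma> * pdiff 1 (pdiff 1 (K 1)) x"
      using pdiff_cong[OF open_\<Omega> d1 smooth_on_pdiff[OF smooth_K] x, of 1]
        pdiff_mult[OF x smooth_on_const smooth_on_pdiff[OF smooth_K], of 1 \<sigma> 1 1] by simp
    then show ?thesis using eq1[OF x] K2[OF x] \<sigma> True by auto
  next
    case False
    then show ?thesis using eq2[OF x] exhaust_2[of i] by auto
  qed
  obtain e where e: "e > 0" "ball (snd c p) e \<subseteq> snd c ` fst c"
    using open_\<Omega> c open_contains_ball by blast
  \<comment> \<open>The patch is shrunk to a ball, since \<open>constant_vector\<close> works on
    convex domains.\<close>
  let ?B = "ball (snd c p) e"
  interpret B: canonical_patch ?B "in_chart c Y" n
    by (rule canonical_patch_subset[OF cp open_ball e(2)])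
  obtain v where v: "\<And>x. x \<in> ?B \<Longrightarrow> ip52 (n x) v = 0" "\<And>x. x \<in> ?B \<Longrightarrow> ip52 (in_chart c Y x) v = K 1 x"
  proof (rule B.constant_vector[of "K 1" "\<lambda>i. if i = 1 then 1 else \<sigma>"])
    show "convex ?B" "?B \<noteq> {}" using e by auto
    show "smooth_on ?B (K 1)" by (rule smooth_on_subset[OF smooth_K e(2)])
    show "K i x = (if i = 1 then 1 else \<sigma>) * K 1 x" if "x \<in> ?B" for i x
      using K2[of x] that e(2) exhaust_2[of i] by auto
    show "pdiff i (pdiff i (K 1)) x + s i x / 2 * K 1 x = 0" if "x \<in> ?B" for i x
      using eq[of x i] that e(2) by blast
  qed (rule that)
  define U where "U = {q \<in> fst c. snd c q \<in> ?B}"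
  show ?thesis
  proof (rule that[of U v])
    have "continuous_on (fst c) (snd c)" using is_chart_homeomorphism[OF ch] by (simp add: homeomorphism_def)
    then have "open (fst c \<inter> snd c -` ?B)" using ch by (intro continuous_open_preimage) (auto simp: is_chart_def)
    moreover have "U = fst c \<inter> snd c -` ?B" by (auto simp: U_def)
    ultimately show "open U" by simp
    show "p \<in> U" using c e by (simp add: U_def)
    have "snd c p \<in> ?B" using e by simp
    then have "ip52 (in_chart c Y (snd c p)) v \<noteq> 0" using v(2)[of "snd c p"] K0[of "snd c p"] c by auto
    then show "v \<noteq> 0" by (auto simp: sprod_simps)
    show "perp_at A y v q" if "q \<in> U" for q
      using that by (intro perp_atI[OF atlas L _ cp] v) (auto simp: U_def)
  qed
qed

text \<open>The pairing with one line \<open>y p\<close> thus determines such a vector. On small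
  open sets this gives uniqueness up to a factor; with \<open>U = UNIV\<close> it shows that a
  nonzero global vector has nonzero pairing with every line of the surface.\<close>

lemma perp_at_zero:
  assumes U: "open U" "p \<in> U" and v: "\<And>q. q \<in> U \<Longrightarrow> perp_at A y v q" and u: "y p = span {u}" "ip52 u v = 0"
  shows "v = 0"
proof -
  obtain c Y n where c: "p \<in> fst c" and L: "canonical_lift A y c Y"
    and cp: "canonical_patch (snd c ` fst c) (in_chart c Y) n"
    and K0: "\<And>i x. x \<in> snd c ` fst c \<Longrightarrow> canonical_patch.K (in_chart c Y) n i x \<noteq> 0"
    by (rule patch[of p]) (rule that; (assumption | blast))
  have ch: "is_chart c" using canonical_liftD(1)[OF L] by (rule local_coords_is_chart)
  let ?B = "snd c ` (fst c \<inter> U)"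
  interpret canonical_patch ?B "in_chart c Y" n
    by (rule canonical_patch_subset[OF cp chart_open_image[OF ch U(1)]]) blast
  have x: "snd c p \<in> ?B" using c U by blast
  show ?thesis
  proof (rule perp_normal_zero[OF x])
    fix z assume "z \<in> ?B"
    then obtain q where q: "q \<in> fst c" "q \<in> U" "z = snd c q" by blast
    show "ip52 (n z) v = 0"
      using v[OF q(2)] L q(1) patch_V_perp(1)[OF atlas L cp q(1)] unfolding perp_at_def q(3) by blast
  next
    have "Y p \<in> span {u}"
      using local_liftD(5)[OF canonical_liftD(2)[OF L] c] u(1) span_base by blast
    then obtain k where "Y p = k *\<^sub>R u" by (auto simp: span_singleton)
    then show "ip52 (in_chart c Y (snd c p)) v = 0"
      using u(2) by (simp add: in_chart_apply[OF ch c] sprod_simps)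
  next
    show "K i (snd c p) \<noteq> 0" for i using K0 c by blast
  qed
qed

lemma surface_line: obtains u where "y p = span {u}" "u \<noteq> 0"
  using surface by (auto simp: timelike_surface_def Q31_def) metis

lemma global_vector:
  assumes conn: "connected (UNIV :: 'm set)"
  obtains v where "v \<noteq> 0" "\<And>p. perp_at A y v p"
proof -
  obtain p0 :: 'm where True by blast
  obtain U0 v where v: "open U0" "p0 \<in> U0" "v \<noteq> 0" "\<And>q. q \<in> U0 \<Longrightarrow> perp_at A y v q"
    using local_vector by blast
  \<comment> \<open>The points near which the local vector \<open>v\<close> keeps its property; this
    set is shown to be open and closed.\<close>
  define S where "S = \<Union>{U. open U \<and> (\<forall>q\<in>U. perp_at A y v q)}"
  have "open S" unfolding S_def by (rule open_Union) simp
  moreover have "open (- S)"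
  proof (subst open_subopen, intro ballI)
    fix p assume p: "p \<in> - S"
    obtain U w where w: "open U" "p \<in> U" "w \<noteq> 0" "\<And>q. q \<in> U \<Longrightarrow> perp_at A y w q"
      using local_vector by blast
    have "U \<inter> S = {}"
    proof (rule ccontr)
      assume "U \<inter> S \<noteq> {}"
      then obtain q U' where q: "q \<in> U" "q \<in> U'" "open U'" "\<And>q. q \<in> U' \<Longrightarrow> perp_at A y v q"
        unfolding S_def by blast
      obtain u where u: "y q = span {u}" using surface_line by blast
      have O: "open (U \<inter> U')" "q \<in> U \<inter> U'" using w q by auto
      have "ip52 u w \<noteq> 0" using perp_at_zero[OF w(1) q(1) w(4) u] w(3) by blast
      \<comment> \<open>The combination is orthogonal to \<open>u\<close> by construction, so it
        vanishes; \<open>v\<close> is then a multiple of \<open>w\<close>, and all of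
        \<open>U\<close> belongs to \<open>S\<close>.\<close>
      moreover have "ip52 u w *\<^sub>R v - ip52 u v *\<^sub>R w = 0"
        by (rule perp_at_zero[OF O _ u]) (use w q in \<open>auto intro!: perp_at_linear(1) simp: sprod_simps\<close>)
      ultimately have nz: "ip52 u w \<noteq> 0" and eq: "ip52 u w *\<^sub>R v = ip52 u v *\<^sub>R w" by simp_all
      have "v = inverse (ip52 u w) *\<^sub>R (ip52 u w *\<^sub>R v)" using nz by simp
      also have "\<dots> = (inverse (ip52 u w) * ip52 u v) *\<^sub>R w" by (simp only: eq scaleR_scaleR)
      finally have "perp_at A y v q" if "q \<in> U" for q using perp_at_linear(2)[OF w(4)[OF that]] by metis
      then have "p \<in> S" using w(1,2) unfolding S_def by blast
      then show False using p by blast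
    qed
    then show "\<exists>T. open T \<and> p \<in> T \<and> T \<subseteq> - S" using w by blast
  qed
  moreover have "p0 \<in> S" using v unfolding S_def by blast
  ultimately have "S = UNIV" using connectedD[OF conn, of S "- S"] by auto
  then have "perp_at A y v p" for p unfolding S_def by blast
  then show ?thesis using that v(3) by blast
qed

end

section \<open>Pseudo-orthogonal maps\<close>

lemma pseudo_orthogonal_compose:
  "pseudo_orthogonal S \<Longrightarrow> pseudo_orthogonal T \<Longrightarrow> pseudo_orthogonal (\<lambda>x. S (T x))"
  using linear_compose[of T S] by (auto simp: pseudo_orthogonal_def o_def)

text \<open>The reflection along \<open>a - b\<close> exchanges two vectors of equal square; it
  exists as soon as their difference is not null.\<close>

lemma reflection:
  assumes "ip52 a a = ip52 b b" "a = b \<or> ip52 (a - b) (a - b) \<noteq> 0"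
  obtains T where "pseudo_orthogonal T" "T a = b"
proof (cases "a = b")
  case True
  then show ?thesis using that[of "\<lambda>x. x"] by (simp add: pseudo_orthogonal_def linear_ident)
next
  case False
  define u where "u = a - b"
  have u: "ip52 u u \<noteq> 0" using assms False by (simp add: u_def)
  define T where "T x = x - (2 * ip52 x u / ip52 u u) *\<^sub>R u" for x
  have "linear T"
    by (rule linearI) (simp_all add: T_def sprod_simps algebra_simps add_divide_distrib)
  moreover have "ip52 (T x) (T z) = ip52 x z" for x z
    using u sprod_commute[of "{4, 5}" u z] by (simp add: T_def sprod_simps field_simps)
  ultimately have "pseudo_orthogonal T" by (simp add: pseudo_orthogonal_def)
  moreover have "T a = b"
  proof -
    have "2 * ip52 a u = ip52 u u"
      using assms(1) sprod_commute[of "{4, 5}" a b] by (simp add: u_def sprod_simps)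
    then show ?thesis using u by (simp add: T_def u_def)
  qed
  ultimately show ?thesis by (rule that)
qed

lemma ip52_expand: "ip52 a b = a $ 1 * b $ 1 + a $ 2 * b $ 2 + a $ 3 * b $ 3 - a $ 4 * b $ 4 - a $ 5 * b $ 5"
  by (simp add: sprod_def sum_5)

lemma vector_5:
  fixes a b c d e :: real
  shows "(vector [a, b, c, d, e] :: real^5) $ 1 = a" "(vector [a, b, c, d, e] :: real^5) $ 2 = b"
    "(vector [a, b, c, d, e] :: real^5) $ 3 = c" "(vector [a, b, c, d, e] :: real^5) $ 4 = d"
    "(vector [a, b, c, d, e] :: real^5) $ 5 = e"
  by (simp_all add: vector_def)

lemma normal_form_nonnull:
  assumes "ip52 v v * ip52 e e > 0"
  obtains r T where "r \<noteq> 0" "pseudo_orthogonal T" "T (r *\<^sub>R v) = e"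
proof -
  define q where "q = sqrt (ip52 e e / ip52 v v)"
  have pos: "ip52 e e / ip52 v v > 0" using assms by (auto simp: zero_less_divide_iff zero_less_mult_iff)
  have q: "q \<noteq> 0" using assms by (auto simp: q_def)
  have qq: "q * q = ip52 e e / ip52 v v"
    by (simp only: q_def real_sqrt_mult_self abs_of_pos[OF pos])
  define a where "a = q *\<^sub>R v"
  have aa: "ip52 a a = ip52 e e"
    using qq assms by (auto simp: a_def sprod_simps simp flip: mult.assoc)
  have ee: "ip52 e e \<noteq> 0" using assms by auto
  \<comment> \<open>By the parallelogram identity the differences of \<open>e\<close> with
    \<open>a\<close> and with \<open>- a\<close> cannot both be null, so after a change of sign a
    reflection applies.\<close>
  have "ip52 (a - e) (a - e) + ip52 (- a - e) (- a - e) = 4 * ip52 e e"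
    using aa sprod_commute[of "{4, 5}" a e] by (simp add: sprod_simps)
  then consider "ip52 (a - e) (a - e) \<noteq> 0" | "ip52 (- a - e) (- a - e) \<noteq> 0" using ee by fastforce
  then show ?thesis
  proof cases
    case 1
    then obtain T where "pseudo_orthogonal T" "T a = e" using reflection[OF aa] by blast
    then show ?thesis using that[of q T] q by (simp add: a_def)
  next
    case 2
    have "ip52 (- a) (- a) = ip52 e e" using aa by (simp add: sprod_simps)
    then obtain T where "pseudo_orthogonal T" "T (- a) = e" using reflection[of "- a" e] 2 by blast
    then show ?thesis using that[of "- q" T] q by (simp add: a_def)
  qed
qed

text \<open>Two reflections treat the positive and the negative coordinates separately. Each
  difference lies in a definite subspace, so it is null only if it is zero.\<close>

lemma normal_form_null:
  assumes v: "ip52 v v = 0" "v \<noteq> 0"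
  obtains r T where "r \<noteq> 0" "pseudo_orthogonal T" "T (r *\<^sub>R v) = vector [1, 0, 0, 0, 1]"
proof -
  define r where "r = sqrt ((v $ 1)\<^sup>2 + (v $ 2)\<^sup>2 + (v $ 3)\<^sup>2)"
  have r2: "r * r = (v $ 1)\<^sup>2 + (v $ 2)\<^sup>2 + (v $ 3)\<^sup>2" by (simp add: r_def)
  have r2': "r * r = (v $ 4)\<^sup>2 + (v $ 5)\<^sup>2" using v(1) r2 by (simp add: ip52_expand power2_eq_square)
  have r0: "r \<noteq> 0"
  proof
    assume "r = 0"
    then have "(v $ 1)\<^sup>2 + (v $ 2)\<^sup>2 + (v $ 3)\<^sup>2 = 0" "(v $ 4)\<^sup>2 + (v $ 5)\<^sup>2 = 0" using r2 r2' by simp_all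
    then have "v = 0" by (simp add: vec_eq_iff forall_5 add_nonneg_eq_0_iff)
    then show False using v(2) by simp
  qed
  define b where "b = (vector [r, 0, 0, v $ 4, v $ 5] :: real^5)"
  define d where "d = (vector [r, 0, 0, 0, r] :: real^5)"
  note vec = b_def d_def vector_5 ip52_expand
  have bb: "ip52 b b = 0" and dd: "ip52 d d = 0" using r2' by (simp_all add: vec power2_eq_square)
  have "v = b \<or> ip52 (v - b) (v - b) \<noteq> 0"
  proof (rule disjCI)
    assume "\<not> ip52 (v - b) (v - b) \<noteq> 0"
    then have "(v $ 1 - r)\<^sup>2 + (v $ 2)\<^sup>2 + (v $ 3)\<^sup>2 = 0" by (simp add: vec power2_eq_square)
    then show "v = b" by (simp add: vec_eq_iff forall_5 add_nonneg_eq_0_iff vec)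
  qed
  then obtain T1 where T1: "pseudo_orthogonal T1" "T1 v = b" using reflection[of v b] v(1) bb by metis
  have "b = d \<or> ip52 (b - d) (b - d) \<noteq> 0"
  proof (rule disjCI)
    assume "\<not> ip52 (b - d) (b - d) \<noteq> 0"
    moreover have "ip52 (b - d) (b - d) = - ((v $ 4)\<^sup>2 + (v $ 5 - r)\<^sup>2)"
      by (simp add: vec power2_eq_square)
    ultimately have "(v $ 4)\<^sup>2 + (v $ 5 - r)\<^sup>2 = 0" by (metis neg_equal_0_iff_equal)
    then show "b = d" by (simp add: vec_eq_iff forall_5 add_nonneg_eq_0_iff vec)
  qed
  then obtain T2 where T2: "pseudo_orthogonal T2" "T2 b = d" using reflection[of b d] bb dd by metis
  have T: "pseudo_orthogonal (\<lambda>x. T2 (T1 x))" by (rule pseudo_orthogonal_compose[OF T2(1) T1(1)])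
  then have "linear (\<lambda>x. T2 (T1 x))" by (simp add: pseudo_orthogonal_def)
  then have "T2 (T1 ((1 / r) *\<^sub>R v)) = (1 / r) *\<^sub>R d" using T1 T2 linear_scale by metis
  also have "\<dots> = vector [1, 0, 0, 0, 1]" using r0 by (simp add: vec_eq_iff forall_5 vec)
  finally show ?thesis using that[of "1 / r" "\<lambda>x. T2 (T1 x)"] T r0 by simp
qed

lemma pseudo_orthogonal_surj:
  assumes "pseudo_orthogonal T"
  obtains x where "T x = w"
proof -
  have lin: "linear T" using assms by (simp add: pseudo_orthogonal_def)
  have "x = 0" if "T x = 0" for x
  proof (rule sprod_nondegenerate)
    fix z show "ip52 x z = 0" using assms that unfolding pseudo_orthogonal_def by (metis sprod.zero_left)
  qed
  then have "surj T" using linear_injective_0[OF lin] linear_injective_imp_surjective[OF lin] by blast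
  then show ?thesis using that by (metis surjD)
qed

section \<open>Minimal surfaces in space forms\<close>

lemma trace_matrix_inv_2:
  fixes G H :: "real^2^2"
  assumes "det G \<noteq> 0"
  shows "trace (matrix_inv G ** H) =
    (G $ 2 $ 2 * H $ 1 $ 1 - G $ 1 $ 2 * H $ 2 $ 1 - G $ 2 $ 1 * H $ 1 $ 2 + G $ 1 $ 1 * H $ 2 $ 2) / det G"
proof -
  define D where "D = det G"
  have D: "G $ 1 $ 1 * G $ 2 $ 2 / D - G $ 1 $ 2 * G $ 2 $ 1 / D = 1"
    using assms by (simp add: D_def det_2 flip: diff_divide_distrib)
  \<comment> \<open>The adjugate divided by the determinant.\<close>
  define B :: "real^2^2" where
    "B = (\<chi> i j. (if i = j then (if i = 1 then G $ 2 $ 2 else G $ 1 $ 1) else - G $ i $ j) / D)"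
  have "B ** G = mat 1"
    using D by (simp add: vec_eq_iff forall_2 matrix_matrix_mult_def sum_2 B_def mat_def mult.commute)
  moreover have inv: "invertible G" using assms by (simp add: invertible_det_nz)
  moreover have "G ** matrix_inv G = mat 1"
    using inv unfolding matrix_inv_def invertible_def by (rule someI2_ex) blast
  ultimately have "matrix_inv G = B"
    by (metis matrix_mul_assoc matrix_mul_lid matrix_mul_rid)
  then show ?thesis
    by (simp add: trace_def sum_2 matrix_matrix_mult_def B_def D_def add_divide_distrib diff_divide_distrib)
qed

text \<open>Common core of the three space forms. The derivatives of \<open>z\<close> lie in the
  complement of \<open>v\<close>, because \<open>ip52 (z p) v\<close> is constant, and there
  \<open>\<pi>\<close> is an isometry. The last assumption lifts a normal of the projected surface
  to \<open>real^5\<close>, where the trace can be compared with canonical data.\<close>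

lemma (in isothermic_willmore) minimal_projection:
  fixes \<pi> :: "real^5 \<Rightarrow> real^'n::finite" and z :: "'m \<Rightarrow> real^5"
  assumes v: "\<And>p. perp_at A y v p" and k: "k \<noteq> 0"
    and z: "\<And>p. y p = span {z p}" "\<And>p. ip52 (z p) v = k"
    and \<pi>: "linear \<pi>" "\<And>w w'. ip52 w v = 0 \<Longrightarrow> ip52 w' v = 0 \<Longrightarrow> sprod N (\<pi> w) (\<pi> w') = ip52 w w'"
    and form: "\<And>p. \<pi> (z p) \<in> space_form N e"
    and normal: "\<And>p m. m \<in> space_form_tangent N e (\<pi> (z p)) \<Longrightarrow>
      \<exists>m'. ip52 m' (z p) = 0 \<and> ip52 m' v = 0 \<and> (\<forall>w. ip52 w v = 0 \<longrightarrow> ip52 m' w = sprod N (\<pi> w) m)"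
  shows "timelike_minimal_in N e A (\<lambda>p. \<pi> (z p))"
proof -
  define x where "x p = \<pi> (z p)" for p
  have bl: "bounded_linear \<pi>" using \<pi>(1) by (simp add: linear_conv_bounded_linear)
  have z0: "z p \<noteq> 0" for p using z(2)[of p] k by (auto simp: sprod_simps)
  have znull: "ip52 (z p) (z p) = 0" for p
  proof -
    obtain u where u: "y p = span {u}" "ip52 u u = 0" using surface by (auto simp: timelike_surface_def Q31_def) metis
    have "z p \<in> span {u}" using z(1)[of p] u(1) span_base by blast
    then show ?thesis using u(2) by (auto simp: span_singleton sprod_simps)
  qed
  have zsm: "smooth_map_on A UNIV z"
    unfolding smooth_map_on_def
  proof
    fix c assume c: "c \<in> A"
    note cc = atlas_local_coords[OF atlas c]
    have ch: "is_chart c" using cc by (rule local_coords_is_chart)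
    show "smooth_on (snd c ` (fst c \<inter> UNIV)) (in_chart c z)"
    proof (rule smooth_on_local)
      fix x assume "x \<in> snd c ` (fst c \<inter> UNIV)"
      then obtain p where p: "p \<in> fst c" "x = snd c p" by blast
      obtain W Y where W: "p \<in> W" "local_lift A y W Y" using surface unfolding timelike_surface_def by blast
      let ?S = "snd c ` (fst c \<inter> W)"
      have S: "open ?S" by (rule chart_open_image[OF ch local_liftD(1)[OF W(2)]])
      have Ysm: "smooth_on ?S (in_chart c Y)" by (rule smooth_on_in_chart[OF atlas cc local_liftD(1,2)[OF W(2)]])
      \<comment> \<open>The normalisation of \<open>z\<close> determines its factor relative to a
        smooth lift, so \<open>z\<close> inherits smoothness.\<close>
      have Yz: "ip52 (Y q) v \<noteq> 0 \<and> z q = (k / ip52 (Y q) v) *\<^sub>R Y q" if "q \<in> W" for q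
      proof -
        have "z q \<in> span {Y q}" using z(1)[of q] local_liftD(5)[OF W(2) that] span_base by blast
        then obtain a where a: "z q = a *\<^sub>R Y q" by (auto simp: span_singleton)
        then have "a * ip52 (Y q) v = k" using z(2)[of q] by (simp add: sprod_simps)
        then show ?thesis using a k by auto
      qed
      have "smooth_on ?S (\<lambda>x. (k / ip52 (in_chart c Y x) v) *\<^sub>R in_chart c Y x)"
        by (intro smooth_intros S Ysm) (use Yz in \<open>auto simp: in_chart_apply[OF ch]\<close>)
      then have "smooth_on ?S (in_chart c z)"
        by (rule smooth_on_cong[OF S, rotated]) (use Yz in \<open>auto simp: in_chart_apply[OF ch]\<close>)
      then show "\<exists>U. open U \<and> x \<in> U \<and> smooth_on U (in_chart c z)" using S p W by blast
    qed
  qed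
  have zlift: "local_lift A y UNIV z"
    unfolding local_lift_def using zsm z0 znull z(1) by simp
  have xsm: "smooth_map_on A UNIV x"
    unfolding smooth_map_on_def
  proof
    fix c assume c: "c \<in> A"
    have "open (snd c ` (fst c \<inter> UNIV))"
      using chart_open_image[OF local_coords_is_chart[OF atlas_local_coords[OF atlas c]]] by blast
    from smooth_on_bounded_linear[OF bl this, of "in_chart c z"]
    show "smooth_on (snd c ` (fst c \<inter> UNIV)) (in_chart c x)"
      using zsm c by (simp add: smooth_map_on_def in_chart_def x_def o_def)
  qed
  {
    fix c p assume c: "c \<in> A" and p: "p \<in> fst c"
    note cc = atlas_local_coords[OF atlas c]
    have ch: "is_chart c" using cc by (rule local_coords_is_chart)
    let ?S = "snd c ` fst c"
    have S: "open ?S" using ch by (simp add: is_chart_def)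
    have zs: "smooth_on ?S (in_chart c z)" using zsm c by (simp add: smooth_map_on_def)
    have xs: "smooth_on ?S (in_chart c x)" using xsm c by (simp add: smooth_map_on_def)
    have sp: "snd c p \<in> ?S" using p by blast
    have xz: "in_chart c x q = \<pi> (in_chart c z q)" for q by (simp add: in_chart_def x_def)
    have pdx: "pdiff i (in_chart c x) q = \<pi> (pdiff i (in_chart c z) q)" if "q \<in> ?S" for i q
      unfolding xz[abs_def] by (rule pdiff_bounded_linear[OF that bl zs])
    have pd1: "pd c i x p = \<pi> (pd c i z p)" for i using pdx[OF sp] by (simp add: pd_eq_pdiff)
    have pd2: "pd c i (pd c j x) p = \<pi> (pd c i (pd c j z) p)" for i j
    proof -
      have "pdiff i (pdiff j (in_chart c x)) (snd c p) = pdiff i (\<lambda>q. \<pi> (pdiff j (in_chart c z) q)) (snd c p)"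
        by (rule pdiff_cong[OF S pdx smooth_on_pdiff[OF xs] sp])
      also have "\<dots> = \<pi> (pdiff i (pdiff j (in_chart c z)) (snd c p))"
        by (rule pdiff_bounded_linear[OF sp bl smooth_on_pdiff[OF zs]])
      finally show ?thesis
        using pd_pd_eq_pdiff[OF ch open_UNIV _ p UNIV_I, of x] pd_pd_eq_pdiff[OF ch open_UNIV _ p UNIV_I, of z] xs zs
        by simp
    qed
    have zv: "ip52 (pdiff i (in_chart c z) q) v = 0" if "q \<in> ?S" for i q
    proof -
      have "pdiff i (\<lambda>q. ip52 (in_chart c z q) v) q = 0"
        by (rule pdiff_const_on[OF S _ that]) (auto simp: in_chart_def z(2))
      then show ?thesis
        using pdiff_bounded_linear[OF that sprod.bounded_linear_left zs] by simp
    qed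
    have v1: "ip52 (pd c i z p) v = 0" for i using zv[OF sp] by (simp add: pd_eq_pdiff)
    have v2: "ip52 (pd c i (pd c j z) p) v = 0" for i j
    proof -
      have "pdiff i (\<lambda>q. ip52 (pdiff j (in_chart c z) q) v) (snd c p) = 0"
        by (rule pdiff_const_on[OF S zv sp])
      then show ?thesis
        using pdiff_bounded_linear[OF sp sprod.bounded_linear_left smooth_on_pdiff[OF zs]]
          pd_pd_eq_pdiff[OF ch open_UNIV _ p UNIV_I, of z] zs by simp
    qed
    have difz: "differential c z p h = (\<Sum>i\<in>UNIV. h $ i *\<^sub>R pd c i z p)" for h
      by (rule differential_eq_pd[OF zs sp])
    have difx: "differential c x p h = \<pi> (differential c z p h)" for h
      unfolding difz differential_eq_pd[OF xs sp] pd1 by (simp add: linear_sum[OF \<pi>(1)] linear_scale[OF \<pi>(1)])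
    have dv: "ip52 (differential c z p h) v = 0" for h
      unfolding difz by (simp add: sum_2 sprod_simps v1)
    have metric: "sprod N (differential c x p h) (differential c x p h') = ip52 (differential c z p h) (differential c z p h')" for h h'
      unfolding difx by (rule \<pi>(2)[OF dv dv])
    obtain c0 Y n where c0: "p \<in> fst c0" and L: "canonical_lift A y c0 Y"
      by (rule patch[of p]) (rule that; assumption)
    note D = canonical_liftD[OF L]
    note can = D(3)[OF c0]
    have neg0: "gdet c0 Y p < 0" using canonical_gram[OF can] by simp
    note tl = timelike_of_gdet[OF atlas D(1) cc D(2) zlift c0 c0 p UNIV_I neg0]
    have lor: "lorentzian (\<lambda>h h'. sprod N (differential c x p h) (differential c x p h'))"
      unfolding metric by (rule tl(2))
    have lin: "linear (differential c x p)"
      unfolding differential_def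
      by (rule linear_frechet_derivative[OF smooth_on_imp_differentiable[OF xs sp]])
    have neg: "gdet c z p \<noteq> 0"
      by (rule lift_change_invariants[OF atlas D(1) cc D(2) zlift c0 c0 p UNIV_I]) (use neg0 in auto)
    have g: "gram c z p i j = sprod N (pd c i x p) (pd c j x p)" for i j
      unfolding pd1 gram_def by (rule \<pi>(2)[OF v1 v1, symmetric])
    have sym: "gram c z p 2 1 = gram c z p 1 2" by (rule gram_commute)
    have inj: "inj (differential c x p)"
    proof (subst linear_injective_0[OF lin], intro allI impI)
      fix h assume "differential c x p h = 0"
      then have "sprod N (\<Sum>i\<in>UNIV. h $ i *\<^sub>R pd c i x p) (pd c j x p) = 0" for j
        unfolding differential_eq_pd[OF xs sp] by (simp add: sprod_simps)
      then have e: "h $ 1 * gram c z p 1 j + h $ 2 * gram c z p 2 j = 0" for j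
        by (simp add: sum_2 sprod_simps g)
      have "h $ 1 * gdet c z p = 0" "h $ 2 * gdet c z p = 0"
        unfolding gdet_def using e[of 1] e[of 2] sym by algebra+
      then show "h = 0" using neg by (simp add: vec_eq_iff forall_2)
    qed
    have mean: "mean_curvature N c x p m = 0" if m: "unit_normal N e c x p m" for m
    proof -
      have mt: "m \<in> space_form_tangent N e (\<pi> (z p))" and mn: "\<And>h. sprod N (differential c x p h) m = 0"
        using m by (auto simp: unit_normal_def x_def)
      obtain m' where m': "ip52 m' (z p) = 0" "ip52 m' v = 0" "\<And>w. ip52 w v = 0 \<Longrightarrow> ip52 m' w = sprod N (\<pi> w) m"
        using normal[OF mt] by blast
      have m'd: "ip52 m' (pd c i z p) = 0" for i
      proof -
        have "pd c i x p = differential c x p (axis i 1)" by (simp add: pd_def)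
        then show ?thesis using m'(3)[OF v1] mn pd1 by simp
      qed
      have "gtr c z p m' = 0"
      proof (rule lift_change_invariants[OF atlas cc D(1) zlift D(2) p UNIV_I c0 c0])
        fix r
        let ?\<delta> = "det (matrix (differential c0 (snd c) p))"
        assume r: "r \<noteq> 0" "?\<delta> \<noteq> 0" "Y p = r *\<^sub>R z p"
          and ch: "\<And>m. ip52 m (z p) = 0 \<Longrightarrow> (\<And>i. ip52 m (pd c i z p) = 0) \<Longrightarrow>
            (\<forall>a. ip52 m (pd c0 a Y p) = 0) \<and> gtr c0 Y p m = r ^ 3 * ?\<delta>\<^sup>2 * gtr c z p m \<and>
            sdet c0 Y p m = r\<^sup>2 * ?\<delta>\<^sup>2 * sdet c z p m"
        have ch': "\<And>a. ip52 m' (pd c0 a Y p) = 0" "gtr c0 Y p m' = r ^ 3 * ?\<delta>\<^sup>2 * gtr c z p m'"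
          using ch[OF m'(1) m'd] by auto
        have m'Y: "ip52 m' (Y p) = 0" using m'(1) r(3) by (simp add: sprod_simps)
        \<comment> \<open>Chosen so that \<open>m' + \<mu> *\<^sub>R Y p\<close> is orthogonal to
          \<open>Y_uv\<close>; up to the factor -1/2 it is also the trace \<open>gtr\<close> of the
          lifted normal.\<close>
        define \<mu> where "\<mu> = 2 * sff c0 Y p m' 2 1"
        have "sff c0 Y p (m' + \<mu> *\<^sub>R Y p) 2 1 = 0"
          using lift_derivatives(2)[OF atlas D(1,2) c0 c0, of 2 1] canonical_gram(4)[OF can]
          by (simp add: sff_def sprod_simps \<mu>_def)
        moreover have "ip52 (Y p) (pd c0 i Y p) = 0" for i
          using lift_derivatives(1)[OF atlas D(1,2) c0 c0, of i] by (simp add: sprod_commute)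
        ultimately have "m' + \<mu> *\<^sub>R Y p \<in> V_perp c0 Y p"
          using ch'(1) m'Y local_liftD(4)[OF D(2) c0] by (simp add: V_perp_iff sprod_simps)
        \<comment> \<open>Both \<open>m'\<close> and the shifted vector are orthogonal to
          \<open>v\<close>, while \<open>ip52 (Y p) v = r * k\<close> is nonzero. The shift is
          therefore zero and the trace with it, which is minimality.\<close>
        then have "ip52 (m' + \<mu> *\<^sub>R Y p) v = 0" using v[of p] L c0 unfolding perp_at_def by blast
        then have "\<mu> * (r * k) = 0" using m'(2) z(2)[of p] r(3) by (simp add: sprod_simps)
        then have "\<mu> = 0" using r k by simp
        then have "gtr c0 Y p m' = 0"
          using canonical_gram[OF can] sff_commute[OF atlas D(1,2) c0 c0, of m' 1 2] by (simp add: gtr_def \<mu>_def)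
        then show "gtr c z p m' = 0" using ch'(2) r by simp
      qed
      moreover have "sff c z p m' i j = sprod N (pd c i (pd c j x) p) m" for i j
        unfolding pd2 sff_def using m'(3)[OF v2, of i j] by (simp add: sprod_commute)
      moreover have "det (fund1 N c x p) = gdet c z p"
        by (simp add: det_2 fund1_def g[symmetric] gdet_def sym power2_eq_square)
      ultimately show ?thesis
        using neg sym by (simp add: mean_curvature_def trace_matrix_inv_2 fund1_def fund2_def gtr_def g algebra_simps)
    qed
    note inj lor mean
  }
  then show ?thesis
    unfolding timelike_minimal_in_def timelike_surface_in_def x_def[symmetric, abs_def]
    using form xsm by (auto simp: x_def)
qed

text \<open>Every line can be normalised because a zero of the pairing would force
  \<open>v = 0\<close> by \<open>perp_at_zero\<close>.\<close>

lemma (in isothermic_willmore) section_exists: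
  assumes v: "v \<noteq> 0" "\<And>p. perp_at A y v p" and k: "k \<noteq> 0"
  obtains z where "\<And>p. y p = span {z p}" "\<And>p. ip52 (z p) v = k"
proof -
  have "\<exists>u. y p = span {u} \<and> ip52 u v = k" for p
  proof -
    obtain u where u: "y p = span {u}" using surface_line by blast
    have uv: "ip52 u v \<noteq> 0" using perp_at_zero[of UNIV p v u] v u by auto
    have "span {(k / ip52 u v) *\<^sub>R u} = span {u}"
      using span_image_scale[of "{u}" "\<lambda>_. k / ip52 u v"] k uv by simp
    then show ?thesis using u uv by (intro exI[of _ "(k / ip52 u v) *\<^sub>R u"]) (simp add: sprod_simps)
  qed
  then show ?thesis using that by metis
qed

lemma pseudo_orthogonal_image_span:
  assumes "pseudo_orthogonal T"
  shows "T ` span {z} = span {T z}"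
  using assms linear_span_image[of T "{z}"] by (simp add: pseudo_orthogonal_def)

section \<open>Coordinates of the three model space forms\<close>

lemma vector_4:
  fixes a b c d :: real
  shows "(vector [a, b, c, d] :: real^4) $ 1 = a" "(vector [a, b, c, d] :: real^4) $ 2 = b"
    "(vector [a, b, c, d] :: real^4) $ 3 = c" "(vector [a, b, c, d] :: real^4) $ 4 = d"
  by (simp_all add: vector_def)

lemma sprod_3: "sprod {3} x w = x $ 1 * w $ 1 + x $ 2 * w $ 2 - x $ 3 * w $ (3::3)"
  by (simp add: sprod_def sum_3)

lemma sprod_4:
  "sprod {4} x w = x $ 1 * w $ 1 + x $ 2 * w $ 2 + x $ 3 * w $ 3 - x $ 4 * w $ (4::4)"
  "sprod {3, 4} x w = x $ 1 * w $ 1 + x $ 2 * w $ 2 - x $ 3 * w $ 3 - x $ 4 * w $ (4::4)"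
  by (simp_all add: sprod_def sum_4)

lemma linear_vector_4: "linear (\<lambda>w :: real^5. vector [w $ i, w $ j, w $ k, w $ l] :: real^4)"
  by (rule linearI) (simp_all add: vec_eq_iff forall_4 vector_4)

lemma linear_vector_3: "linear (\<lambda>w :: real^5. vector [w $ i, w $ j, w $ k] :: real^3)"
  by (rule linearI) (simp_all add: vec_eq_iff forall_3)

lemma isothermic_willmore_minimal:
  fixes A :: "'m::t2_space chart set"
  assumes "isothermic_willmore A y \<sigma>" and conn: "connected (UNIV :: 'm set)"
  shows "(\<exists>x. minimal_in_R31 A x \<and> conformally_equivalent phi0 y x) \<or>
         (\<exists>x. minimal_in_S31 A x \<and> conformally_equivalent phi_plus y x) \<or>
         (\<exists>x. minimal_in_H31 A x \<and> conformally_equivalent phi_minus y x)"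
proof -
  interpret isothermic_willmore A y \<sigma> by fact
  obtain v0 where v0: "v0 \<noteq> 0" "\<And>p. perp_at A y v0 p" using global_vector[OF conn] by blast
  have nullz: "ip52 (z p) (z p) = 0" if "\<And>p. y p = span {z p}" for z p
  proof -
    obtain u where u: "y p = span {u}" "ip52 u u = 0" using surface by (auto simp: timelike_surface_def Q31_def) metis
    have "z p \<in> span {u}" using that[of p] u(1) span_base by blast
    then show ?thesis using u(2) by (auto simp: span_singleton sprod_simps)
  qed
  consider "ip52 v0 v0 = 0" | "ip52 v0 v0 < 0" | "ip52 v0 v0 > 0" by linarith
  then show ?thesis
  proof cases
    case 1
    obtain r T where rT: "r \<noteq> 0" "pseudo_orthogonal T" "T (r *\<^sub>R v0) = vector [1, 0, 0, 0, 1]"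
      using normal_form_null[OF 1 v0(1)] by blast
    define v where "v = r *\<^sub>R v0"
    have v: "v \<noteq> 0" "\<And>p. perp_at A y v p" using rT v0 by (auto simp: v_def intro: perp_at_linear(2))
    have T: "linear T" "\<And>a b. ip52 (T a) (T b) = ip52 a b" using rT by (auto simp: pseudo_orthogonal_def)
    have Tv: "ip52 w v = T w $ 1 - T w $ 5" for w
      using T(2)[of w v] rT(3) by (simp add: v_def ip52_expand vector_5)
    \<comment> \<open>The representative in \<open>phi0\<close> has first minus last coordinate
      equal to -1, which by \<open>Tv\<close> is this normalisation.\<close>
    obtain z where z: "\<And>p. y p = span {z p}" "\<And>p. ip52 (z p) v = - 1"
      using section_exists[OF v, of "- 1"] by auto
    \<comment> \<open>On the complement of \<open>v\<close> the first and last coordinates of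
      \<open>T w\<close> agree and cancel in the form, so omitting them is isometric there.\<close>
    define \<pi> :: "real^5 \<Rightarrow> real^3" where "\<pi> w = vector [T w $ 2, T w $ 3, T w $ 4]" for w
    have lin: "linear \<pi>"
      using linear_compose[OF T(1) linear_vector_3[of 2 3 4]] by (simp add: \<pi>_def[abs_def] o_def)
    have "minimal_in_R31 A (\<lambda>p. \<pi> (z p))"
    proof (rule minimal_projection[OF v(2) _ z lin])
      fix w w' assume "ip52 w v = 0" "ip52 w' v = 0"
      then have "T w $ 1 = T w $ 5" "T w' $ 1 = T w' $ 5" by (simp_all add: Tv)
      then show "sprod {3} (\<pi> w) (\<pi> w') = ip52 w w'"
        unfolding T(2)[of w w', symmetric] by (simp add: sprod_3 ip52_expand \<pi>_def)
    next
      fix p and m :: "real^3"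
      \<comment> \<open>Equal first and last entries make the lifted normal orthogonal to
        \<open>v\<close>; this value makes it orthogonal to \<open>z p\<close>, whose image under
        \<open>T\<close> has first and last coordinates differing by 1.\<close>
      let ?a = "sprod {3} (\<pi> (z p)) m"
      obtain m' where m': "T m' = vector [?a, m $ 1, m $ 2, m $ 3, ?a]"
        using pseudo_orthogonal_surj[OF rT(2)] by blast
      have "T (z p) $ 5 = T (z p) $ 1 + 1" using z(2)[of p] by (simp add: Tv)
      then have "ip52 m' (z p) = 0"
        unfolding T(2)[of m' "z p", symmetric] m' by (simp add: ip52_expand vector_5 \<pi>_def sprod_3 algebra_simps)
      moreover have "ip52 m' v = 0" by (simp add: Tv m' vector_5)
      moreover have "ip52 m' w = sprod {3} (\<pi> w) m" if "ip52 w v = 0" for w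
      proof -
        have "T w $ 1 = T w $ 5" using that by (simp add: Tv)
        then show ?thesis
          unfolding T(2)[of m' w, symmetric] m' by (simp add: ip52_expand vector_5 \<pi>_def sprod_3)
      qed
      ultimately show "\<exists>m'. ip52 m' (z p) = 0 \<and> ip52 m' v = 0 \<and> (\<forall>w. ip52 w v = 0 \<longrightarrow> ip52 m' w = sprod {3} (\<pi> w) m)"
        by blast
    qed (simp_all add: space_form_def)
    moreover have "T ` y p = phi0 (\<pi> (z p))" for p
    proof -
      have 5: "T (z p) $ 5 = T (z p) $ 1 + 1" using z(2)[of p] by (simp add: Tv)
      have "ip52 (T (z p)) (T (z p)) = 0" using nullz[OF z(1)] T(2) by simp
      \<comment> \<open>With the last coordinate equal to the first plus 1, the null condition is
        linear in the first coordinate and determines it.\<close>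
      then have q: "sprod {3} (\<pi> (z p)) (\<pi> (z p)) = 2 * T (z p) $ 1 + 1"
        by (simp add: ip52_expand 5 sprod_3 \<pi>_def algebra_simps)
      have "T (z p) = vector [(- 1 + sprod {3} (\<pi> (z p)) (\<pi> (z p))) / 2, \<pi> (z p) $ 1, \<pi> (z p) $ 2, \<pi> (z p) $ 3,
          (1 + sprod {3} (\<pi> (z p)) (\<pi> (z p))) / 2]"
        unfolding q by (simp add: vec_eq_iff forall_5 vector_5 5) (simp add: \<pi>_def)
      then show ?thesis
        unfolding phi0_def z(1) pseudo_orthogonal_image_span[OF rT(2)] by simp
    qed
    ultimately show ?thesis using rT(2) unfolding conformally_equivalent_def by blast
  next
    case 2
    have e: "ip52 (axis 5 1) (axis 5 1) = - 1" by (simp add: ip52_expand axis_def)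
    obtain r T where rT: "r \<noteq> 0" "pseudo_orthogonal T" "T (r *\<^sub>R v0) = axis 5 1"
      using normal_form_nonnull[of v0 "axis 5 1"] 2 e by auto
    define v where "v = r *\<^sub>R v0"
    have v: "v \<noteq> 0" "\<And>p. perp_at A y v p" using rT v0 by (auto simp: v_def intro: perp_at_linear(2))
    have T: "linear T" "\<And>a b. ip52 (T a) (T b) = ip52 a b" using rT by (auto simp: pseudo_orthogonal_def)
    have Tv: "ip52 w v = - T w $ 5" for w
      using T(2)[of w v] rT(3) by (simp add: v_def sprod_axis)
    \<comment> \<open>By \<open>Tv\<close> the last coordinate of \<open>T (z p)\<close> becomes 1,
      as in \<open>phi_plus\<close>.\<close>
    obtain z where z: "\<And>p. y p = span {z p}" "\<And>p. ip52 (z p) v = - 1"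
      using section_exists[OF v, of "- 1"] by auto
    have z5: "T (z p) $ 5 = 1" for p using z(2)[of p] by (simp add: Tv)
    define \<pi> :: "real^5 \<Rightarrow> real^4" where "\<pi> w = vector [T w $ 1, T w $ 2, T w $ 3, T w $ 4]" for w
    have lin: "linear \<pi>"
      using linear_compose[OF T(1) linear_vector_4[of 1 2 3 4]] by (simp add: \<pi>_def[abs_def] o_def)
    have "minimal_in_S31 A (\<lambda>p. \<pi> (z p))"
    proof (rule minimal_projection[OF v(2) _ z lin])
      fix w w' assume "ip52 w v = 0" "ip52 w' v = 0"
      then have "T w $ 5 = 0" "T w' $ 5 = 0" by (simp_all add: Tv)
      then show "sprod {4} (\<pi> w) (\<pi> w') = ip52 w w'"
        unfolding T(2)[of w w', symmetric] by (simp add: sprod_4 ip52_expand \<pi>_def vector_4)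
    next
      fix p
      have "ip52 (T (z p)) (T (z p)) = 0" using nullz[OF z(1)] T(2) by simp
      then show "\<pi> (z p) \<in> space_form {4} 1"
        by (simp add: space_form_def sprod_4 \<pi>_def vector_4 ip52_expand z5)
    next
      fix p and m :: "real^4" assume "m \<in> space_form_tangent {4} 1 (\<pi> (z p))"
      then have m: "sprod {4} (\<pi> (z p)) m = 0" by (simp add: space_form_tangent_def)
      obtain m' where m': "T m' = vector [m $ 1, m $ 2, m $ 3, m $ 4, 0]"
        using pseudo_orthogonal_surj[OF rT(2)] by blast
      have w: "ip52 m' w = sprod {4} (\<pi> w) m" for w
        unfolding T(2)[of m' w, symmetric] m' by (simp add: ip52_expand vector_5 \<pi>_def sprod_4 vector_4 algebra_simps)
      moreover have "ip52 m' v = 0" by (simp add: Tv m' vector_5)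
      ultimately show "\<exists>m'. ip52 m' (z p) = 0 \<and> ip52 m' v = 0 \<and> (\<forall>w. ip52 w v = 0 \<longrightarrow> ip52 m' w = sprod {4} (\<pi> w) m)"
        using m by metis
    qed simp
    moreover have "T ` y p = phi_plus (\<pi> (z p))" for p
    proof -
      have "T (z p) = vector [\<pi> (z p) $ 1, \<pi> (z p) $ 2, \<pi> (z p) $ 3, \<pi> (z p) $ 4, 1]"
        by (simp add: vec_eq_iff forall_5 vector_5 z5) (simp add: \<pi>_def vector_4)
      then show ?thesis
        unfolding phi_plus_def z(1) pseudo_orthogonal_image_span[OF rT(2)] by simp
    qed
    ultimately show ?thesis using rT(2) unfolding conformally_equivalent_def by blast
  next
    case 3
    have e: "ip52 (axis 1 1) (axis 1 1) = 1" by (simp add: ip52_expand axis_def)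
    obtain r T where rT: "r \<noteq> 0" "pseudo_orthogonal T" "T (r *\<^sub>R v0) = axis 1 1"
      using normal_form_nonnull[of v0 "axis 1 1"] 3 e by auto
    define v where "v = r *\<^sub>R v0"
    have v: "v \<noteq> 0" "\<And>p. perp_at A y v p" using rT v0 by (auto simp: v_def intro: perp_at_linear(2))
    have T: "linear T" "\<And>a b. ip52 (T a) (T b) = ip52 a b" using rT by (auto simp: pseudo_orthogonal_def)
    have Tv: "ip52 w v = T w $ 1" for w
      using T(2)[of w v] rT(3) by (simp add: v_def sprod_axis)
    \<comment> \<open>By \<open>Tv\<close> the first coordinate of \<open>T (z p)\<close> becomes 1,
      as in \<open>phi_minus\<close>.\<close>
    obtain z where z: "\<And>p. y p = span {z p}" "\<And>p. ip52 (z p) v = 1"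
      using section_exists[OF v, of 1] by auto
    have z1: "T (z p) $ 1 = 1" for p using z(2)[of p] by (simp add: Tv)
    define \<pi> :: "real^5 \<Rightarrow> real^4" where "\<pi> w = vector [T w $ 2, T w $ 3, T w $ 4, T w $ 5]" for w
    have lin: "linear \<pi>"
      using linear_compose[OF T(1) linear_vector_4[of 2 3 4 5]] by (simp add: \<pi>_def[abs_def] o_def)
    have "minimal_in_H31 A (\<lambda>p. \<pi> (z p))"
    proof (rule minimal_projection[OF v(2) _ z lin])
      fix w w' assume "ip52 w v = 0" "ip52 w' v = 0"
      then have "T w $ 1 = 0" "T w' $ 1 = 0" by (simp_all add: Tv)
      then show "sprod {3, 4} (\<pi> w) (\<pi> w') = ip52 w w'"
        unfolding T(2)[of w w', symmetric] by (simp add: sprod_4 ip52_expand \<pi>_def vector_4)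
    next
      fix p
      have "ip52 (T (z p)) (T (z p)) = 0" using nullz[OF z(1)] T(2) by simp
      then show "\<pi> (z p) \<in> space_form {3, 4} (- 1)"
        by (simp add: space_form_def sprod_4 \<pi>_def vector_4 ip52_expand z1)
    next
      fix p and m :: "real^4" assume "m \<in> space_form_tangent {3, 4} (- 1) (\<pi> (z p))"
      then have m: "sprod {3, 4} (\<pi> (z p)) m = 0" by (simp add: space_form_tangent_def)
      obtain m' where m': "T m' = vector [0, m $ 1, m $ 2, m $ 3, m $ 4]"
        using pseudo_orthogonal_surj[OF rT(2)] by blast
      have w: "ip52 m' w = sprod {3, 4} (\<pi> w) m" for w
        unfolding T(2)[of m' w, symmetric] m' by (simp add: ip52_expand vector_5 \<pi>_def sprod_4 vector_4 algebra_simps)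
      moreover have "ip52 m' v = 0" by (simp add: Tv m' vector_5)
      ultimately show "\<exists>m'. ip52 m' (z p) = 0 \<and> ip52 m' v = 0 \<and> (\<forall>w. ip52 w v = 0 \<longrightarrow> ip52 m' w = sprod {3, 4} (\<pi> w) m)"
        using m by metis
    qed simp
    moreover have "T ` y p = phi_minus (\<pi> (z p))" for p
    proof -
      have "T (z p) = vector [1, \<pi> (z p) $ 1, \<pi> (z p) $ 2, \<pi> (z p) $ 3, \<pi> (z p) $ 4]"
        by (simp add: vec_eq_iff forall_5 vector_5 z1) (simp add: \<pi>_def vector_4)
      then show ?thesis
        unfolding phi_minus_def z(1) pseudo_orthogonal_image_span[OF rT(2)] by simp
    qed
    ultimately show ?thesis using rT(2) unfolding conformally_equivalent_def by blast
  qed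
qed

theorem theoremB:
  fixes A :: "'m::{t2_space, second_countable_topology} chart set"
    and y :: "'m \<Rightarrow> (real^5) set"
  assumes "smooth_atlas A" and "connected (UNIV :: 'm set)"
    and "timelike_surface A y"
    and "isothermic A y"
    and "willmore A y"
  shows "(\<exists>x. minimal_in_R31 A x \<and> conformally_equivalent phi0 y x) \<or>
         (\<exists>x. minimal_in_S31 A x \<and> conformally_equivalent phi_plus y x) \<or>
         (\<exists>x. minimal_in_H31 A x \<and> conformally_equivalent phi_minus y x)"
proof -
  obtain \<sigma> where "isothermic_sgn \<sigma> A y" "\<sigma> = 1 \<or> \<sigma> = - 1"
    using assms(4) unfolding isothermic_def by blast
  then have "isothermic_willmore A y \<sigma>"
    using assms by unfold_locales
  then show ?thesis using assms(2) by (rule isothermic_willmore_minimal)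
qed

end
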